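(* Let $\{f_j^\lambda\}$ be a parametrized IFS satisfying (MA1)–(MA4) and the transversality condition (MT) on $U$. Let $\{\mu_\lambda\}_{\lambda\in\overline U}$ be a collection of finite Borel measures on $\Sigma$ satisfying (M) with constants $c>0$, $\theta\in(0,1]$. Then for Lebesgue almost every $\lambda\in U$, $$\dim_S(\nu_\lambda)\ge\min\{\dim_{cor}(\mu_\lambda,d_\lambda),\,1+\min\{\delta,\theta\}\},$$ where $\nu_\lambda=(\Pi^\lambda)_*\mu_\lambda$ and $\delta$ is the Hölder exponent in (MA1)–(MA3).
   Context: Setup: $X\subset\mathbb R$ compact nondegenerate interval, $\mathcal A=\{1,\dots,m\}$, $m\ge2$, $\Sigma=\mathcal A^{\mathbb N}$, $\Sigma^*$ finite words, $|\omega|$ length, $[\omega]$ cylinder, $\mathbf i|_n=i_1\dots i_n$, $\mathbf i\wedge\mathbf j$ longest common prefix. $U\subset\mathbb R^d$ bounded open. $f_j^\lambda:X\to X$ for $\lambda\in\overline U$; $f^\lambda_\omega=f^\lambda_{\omega_1}\circ\dots\circ f^\lambda_{\omega_n}$; $\Pi^\lambda(\mathbf i)=\lim_n f^\lambda_{\mathbf i|_n}(x)$; $d_\lambda(\mathbf i,\mathbf j)=|f^\lambda_{\mathbf i\wedge\mathbf j}(X)|$. Assumptions, $\delta\in(0,1)$: (MA1) each $f_j^\lambda$ is $C^{2+\delta}$ on $X$, second $x$-derivatives bounded uniformly and $\delta$-Hölder in $x$ and in $\lambda$ with uniform constants; (MA2) $\lambda\mapsto f_j^\lambda(x)$ is $C^{1+\delta}$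 on $U$ with $\partial_{\lambda_i}f_j^\lambda(x)$ $\delta$-Hölder in $\lambda$ uniformly in $x$; (MA3) the mixed partials $\partial^2f_j^\lambda/\partial x\partial\lambda_i$ exist, are continuous, uniformly bounded and $\delta$-Hölder in $x$ and in $\lambda$ uniformly; (MA4) $0<\gamma_1\le|\frac d{dx}f_j^\lambda(x)|\le\gamma_2<1$ for all $x,j,\lambda\in\overline U$. (MT): there is $\eta>0$ such that for all $\lambda\in\overline U$, $\mathbf i,\mathbf j$ with $i_1\ne j_1$: $|\Pi^\lambda(\mathbf i)-\Pi^\lambda(\mathbf j)|<\eta\Rightarrow|\nabla_\lambda(\Pi^\lambda(\mathbf i)-\Pi^\lambda(\mathbf j))|\ge\eta$. (M): there exist $c>0$ and $\theta\in(0,1]$ such that $e^{-c|\lambda-\lambda'|^\theta|\omega|}\mu_{\lambda'}([\omega])\le\mu_\lambda([\omega])\le e^{c|\lambda-\lambda'|^\theta|\omega|}\mu_{\lambda'}([\omega])$ for all $\omega\in\Sigma^*$, $|\omega|\ge1$, $\lambda,\lambda'\in\overline U$. $\dim_{cor}(\mu,\rho)=\sup\{\alpha>0:\iint\rho(x,y)^{-\alpha}d\mu d\mu<\infty\}$. For a finite Borel measure $\nu$ on $\mathbb R$, $\widehat\nu(\xi)=\int e^{i\xi x}d\nu(x)$ and $\dim_S\nu=\sup\{\alpha\in\mathbb R:\int|\widehat\nu(\xi)|^2(1+|\xi|)^{\alpha-1}d\xi<\infty\}$. *)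

theory Defs
  imports "HOL-Probability.Probability"
begin

text \<open>Symbolic space Sigma = A^N with A = {1..m}, sequences indexed from 0
  (i 0 is the first symbol), with the product (cylinder) sigma-algebra.\<close>
definition seqspace :: "nat \<Rightarrow> (nat \<Rightarrow> nat) measure" where
  "seqspace m = PiM UNIV (\<lambda>_. count_space {1..m})"

definition pref :: "(nat \<Rightarrow> nat) \<Rightarrow> nat \<Rightarrow> nat list" where
  "pref i n = map i [0..<n]"

definition cyl :: "nat \<Rightarrow> nat list \<Rightarrow> (nat \<Rightarrow> nat) set" where
  "cyl m w = {i \<in> space (seqspace m). pref i (length w) = w}"

definition comp_word :: "(nat \<Rightarrow> 'a \<Rightarrow> real \<Rightarrow> real) \<Rightarrow> 'a \<Rightarrow> nat list \<Rightarrow> real \<Rightarrow> real" where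
  "comp_word f l w = foldr (\<lambda>j g. f j l \<circ> g) w id"

definition proj :: "(nat \<Rightarrow> 'a \<Rightarrow> real \<Rightarrow> real) \<Rightarrow> real set \<Rightarrow> 'a \<Rightarrow> (nat \<Rightarrow> nat) \<Rightarrow> real" where
  "proj f X l i = lim (\<lambda>n. comp_word f l (pref i n) (Inf X))"

text \<open>Longest common prefix (for i different from j).\<close>
definition common_prefix :: "(nat \<Rightarrow> nat) \<Rightarrow> (nat \<Rightarrow> nat) \<Rightarrow> nat list" where
  "common_prefix i j = pref i (LEAST k. i k \<noteq> j k)"

definition symb_dist :: "(nat \<Rightarrow> 'a \<Rightarrow> real \<Rightarrow> real) \<Rightarrow> real set \<Rightarrow> 'a \<Rightarrow> (nat \<Rightarrow> nat) \<Rightarrow> (nat \<Rightarrow> nat) \<Rightarrow> real" where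
  "symb_dist f X l i j = (if i = j then 0 else diameter (comp_word f l (common_prefix i j) ` X))"

text \<open>Correlation dimension; rho^(-alpha) is read as infinity where rho = 0; sup of the
  empty set is 0.\<close>
definition corr_dim :: "'b measure \<Rightarrow> ('b \<Rightarrow> 'b \<Rightarrow> real) \<Rightarrow> ereal" where
  "corr_dim \<mu> \<rho> = Sup (insert 0 {ereal \<alpha> | \<alpha>. \<alpha> > 0 \<and>
     (\<integral>\<^sup>+ x. (\<integral>\<^sup>+ y. (if \<rho> x y = 0 then \<infinity> else ennreal (\<rho> x y powr (-\<alpha>))) \<partial>\<mu>) \<partial>\<mu>) < \<infinity>})"

text \<open>Sobolev dimension, with the Fourier transform given by the characteristic function
  char nu xi = integral of exp(i xi x).\<close>
definition sobolev_dim :: "real measure \<Rightarrow> ereal" where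
  "sobolev_dim \<nu> = Sup {ereal \<alpha> | \<alpha>.
     (\<integral>\<^sup>+ \<xi>. ennreal ((cmod (char \<nu> \<xi>))\<^sup>2 * (1 + \<bar>\<xi>\<bar>) powr (\<alpha> - 1)) \<partial>lborel) < \<infinity>}"

end

theory Submission
  imports Defs
begin

text \<open>Testing the Fourier transform against the dyadic dilates of a compactly supported, mean-zero
  kernel whose transform is nonnegative (a difference of two tents) reduces finiteness of the Sobolev integral
  to a summable bound for the double integrals of that kernel applied to 2^n times the difference of two projected points.
  Near a fixed parameter these double integrals are replaced, up to summable errors, by finite sums over
  cylinders of length proportional to n, so that the parameter-dependent measures enter only through cylinder
  masses, which are Hoelder continuous by (M). For a pair of cylinders with longest common prefix u the difference
  of the projections is a slope, comparable to the diameter of the image of u, times a transversal function.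
  Integrating in the direction of the gradient, every factor can be frozen at one point; the frozen
  integral vanishes because the kernel has mean zero, and the Hoelder errors gain the power
  1 + min(delta, theta) of the scale. Summation over the pairs gives the energy of the measure at the fixed
  parameter. A Lindeloef argument over rational exponents makes any continuity of the correlation dimension in the
  parameter unnecessary.\<close>

section \<open>The wavelet and its Fourier transform\<close>

text \<open>(M) controls cylinder masses only, and its factor grows with the length of the cylinder;
  two measures of the family may be mutually singular, so no density can be carried through the
  integral over the parameter. At scale 2^n the comparison costs a factor exp (const * n *
  r^\<theta>) on a ball of radius r, and the distortion of the slopes costs a factor of the same
  kind. These losses are exponential in n, but their rate tends to 0 with r, so they fit into the
  gap between the exponent to be proved and the exponent of finite energy. This forces the argument
  to be local, with a radius depending on that gap. The cap on the exponent has this origin: the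
  integrand lives on an interval of length l, comparable to the reciprocal of the effective
  frequency, and freezing leaves an error l^\<beta> on it, where \<beta> is a Hoelder exponent
  shared by the weights and the gradients; the product l^(1+\<beta>) is all that is gained.
  Positivity of the transform makes each dyadic contribution nonnegative, so that a summable bound
  for the averages over the parameter gives finiteness at almost every parameter.\<close>

definition tent :: "real \<Rightarrow> real" where "tent x = max 0 (1 - \<bar>x\<bar>)"

text \<open>Stretching the tent by 2 and halving its height preserves the integral, so the
  difference has mean zero. The same dilation turns the transform into
  \<open>fejer t - fejer (2 * t)\<close>, which the double-angle formula shows to be
  nonnegative.\<close>

definition wavelet :: "real \<Rightarrow> real" where "wavelet x = tent x - tent (x / 2) / 2"

lemma tent_lipschitz: "\<bar>tent x - tent y\<bar> \<le> \<bar>x - y\<bar>"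
  unfolding tent_def by (simp add: max_def abs_if)

lemma wavelet_lipschitz: "\<bar>wavelet x - wavelet y\<bar> \<le> 2 * \<bar>x - y\<bar>"
  using tent_lipschitz[of x y] tent_lipschitz[of "x/2" "y/2"] unfolding wavelet_def
  by (simp add: abs_if split: if_splits)

lemma abs_wavelet_le_1: "\<bar>wavelet x\<bar> \<le> 1"
proof -
  have "0 \<le> tent y \<and> tent y \<le> 1" for y
    unfolding tent_def by simp
  from this[of x] this[of "x / 2"] show ?thesis
    unfolding wavelet_def by (simp add: abs_le_iff)
qed

lemma wavelet_eq_0: "2 \<le> \<bar>x\<bar> \<Longrightarrow> wavelet x = 0"
  unfolding wavelet_def tent_def by (simp add: max_def)

text \<open>Evenness in this form allows the sign of a slope to be dropped, so that only its modulus
  has to be controlled.\<close>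

lemma wavelet_abs [simp]: "wavelet \<bar>x\<bar> = wavelet x"
  unfolding wavelet_def tent_def by simp

lemma continuous_on_tent [continuous_intros]:
  "continuous_on A h \<Longrightarrow> continuous_on A (\<lambda>x. tent (h x))"
  unfolding tent_def by (intro continuous_intros)

lemma continuous_on_wavelet [continuous_intros]:
  "continuous_on A h \<Longrightarrow> continuous_on A (\<lambda>x. wavelet (h x))"
  unfolding wavelet_def by (intro continuous_intros) auto

lemma tent_measurable [measurable]: "tent \<in> borel_measurable borel"
  by (intro borel_measurable_continuous_onI continuous_intros)

lemma wavelet_measurable [measurable]: "wavelet \<in> borel_measurable borel"
  by (intro borel_measurable_continuous_onI continuous_intros)

lemma integrable_tent: "integrable lborel tent"
proof (rule integrableI_bounded_set[where A="{-1..1}" and B=1])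
  show "AE x in lborel. x \<in> {-1..1} \<longrightarrow> norm (tent x) \<le> 1"
    by (auto simp: tent_def)
  show "AE x in lborel. x \<notin> {-1..1} \<longrightarrow> tent x = 0"
    by (auto simp: tent_def max_def)
qed (auto simp: emeasure_lborel_Icc_eq)

lemma integral_wavelet: "(\<integral>x. wavelet x \<partial>lborel) = 0"
proof -
  have "(\<integral>x. tent x \<partial>lborel) = \<bar>1/2\<bar> *\<^sub>R (\<integral>x. tent (0 + (1/2) * x) \<partial>lborel)"
    by (rule lborel_integral_real_affine) simp
  moreover have "integrable lborel (\<lambda>x. tent (0 + (1/2) * x))"
    by (intro lborel_integrable_real_affine integrable_tent) simp
  ultimately show ?thesis
    unfolding wavelet_def using integrable_tent by (simp add: field_simps)
qed

lemma integrable_wavelet: "integrable lborel wavelet"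
proof -
  have "integrable lborel (\<lambda>x. tent (0 + (1/2) * x))"
    by (intro lborel_integrable_real_affine integrable_tent) simp
  then show ?thesis
    unfolding wavelet_def[abs_def] using integrable_tent by (simp add: field_simps)
qed

lemma integral_wavelet_affine:
  assumes "p \<noteq> 0"
  shows "integrable lborel (\<lambda>s. wavelet (z + p * s))" "(\<integral>s. wavelet (z + p * s) \<partial>lborel) = 0"
proof -
  show "integrable lborel (\<lambda>s. wavelet (z + p * s))"
    by (intro lborel_integrable_real_affine integrable_wavelet assms)
  have "(\<integral>x. wavelet x \<partial>lborel) = \<bar>p\<bar> *\<^sub>R (\<integral>s. wavelet (z + p * s) \<partial>lborel)"
    by (rule lborel_integral_real_affine) fact
  then show "(\<integral>s. wavelet (z + p * s) \<partial>lborel) = 0"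
    using assms by (simp add: integral_wavelet)
qed

text \<open>Division by zero makes the value at 0 equal to 0 instead of 1; only almost every point matters.\<close>

definition fejer :: "real \<Rightarrow> real" where "fejer t = (2 * sin (t / 2) / t)\<^sup>2"

lemma fejer_measurable [measurable]: "fejer \<in> borel_measurable borel"
  unfolding fejer_def[abs_def] by measurable

lemma fejer_nonneg: "0 \<le> fejer t" unfolding fejer_def by simp

lemma fejer_le_1: "fejer t \<le> 1"
proof -
  have "\<bar>2 * sin (t/2) / t\<bar> \<le> 1"
    using abs_sin_x_le_abs_x[of "t/2"] by (simp add: abs_mult divide_simps)
  then show ?thesis unfolding fejer_def by (simp add: abs_square_le_1)
qed

lemma fejer_le: "fejer t \<le> 4 / t\<^sup>2"
proof -
  have "(sin (t/2))\<^sup>2 \<le> 1" by (simp add: abs_square_le_1)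
  then show ?thesis unfolding fejer_def
    by (simp add: power_divide power_mult_distrib divide_right_mono)
qed

lemma integrable_fejer: "integrable lborel fejer"
proof (rule integrableI_bounded)
  have tail: "(\<integral>\<^sup>+x. ennreal (4 / x\<^sup>2) * indicator {1..} x \<partial>lborel) = ennreal (0 - (- 4 / 1))"
  proof (rule nn_integral_FTC_atLeast)
    fix x :: real assume "1 \<le> x"
    then show "((\<lambda>x. - 4 / x) has_real_derivative 4 / x\<^sup>2) (at x)"
      by (auto intro!: derivative_eq_intros simp: power2_eq_square)
  next
    have "((\<lambda>x::real. -4 * inverse x) \<longlongrightarrow> -4 * 0) at_top"
      by (intro tendsto_mult tendsto_const tendsto_inverse_0_at_top filterlim_ident)
    then show "((\<lambda>x::real. -4 / x) \<longlongrightarrow> 0) at_top" by (simp add: field_simps)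
  qed auto
  have tail': "(\<integral>\<^sup>+x. ennreal (4 / x\<^sup>2) * indicator {..-1} x \<partial>lborel) = ennreal 4"
  proof -
    have "(\<integral>\<^sup>+x. ennreal (4 / x\<^sup>2) * indicator {1..} x \<partial>lborel)
      = ennreal \<bar>-1\<bar> * (\<integral>\<^sup>+x. ennreal (4 / (0 + (-1) * x)\<^sup>2) * indicator {1..} (0 + (-1) * x) \<partial>lborel)"
      by (rule nn_integral_real_affine) auto
    also have "\<dots> = (\<integral>\<^sup>+x. ennreal (4 / x\<^sup>2) * indicator {..-1} x \<partial>lborel)"
      by (auto intro!: nn_integral_cong simp: indicator_def)
    finally show ?thesis using tail by simp
  qed
  have "(\<integral>\<^sup>+x. ennreal (norm (fejer x)) \<partial>lborel) \<le>
     (\<integral>\<^sup>+x. indicator {-1..1} x + (ennreal (4 / x\<^sup>2) * indicator {1..} x + ennreal (4 / x\<^sup>2) * indicator {..-1} x) \<partial>lborel)"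
  proof (intro nn_integral_mono)
    fix x :: real
    show "ennreal (norm (fejer x)) \<le> indicator {-1..1} x + (ennreal (4 / x\<^sup>2) * indicator {1..} x + ennreal (4 / x\<^sup>2) * indicator {..-1} x)"
    proof (cases "x \<in> {-1..1}")
      case True
      then have "ennreal (norm (fejer x)) \<le> indicator {-1..1} x"
        using fejer_le_1[of x] fejer_nonneg[of x] by simp
      then show ?thesis by (rule order_trans) simp
    next
      case False
      then have "indicator {1..} x + indicator {..-1} x = (1::ennreal)" by (auto simp: indicator_def)
      then have "ennreal (4 / x\<^sup>2) * indicator {1..} x + ennreal (4 / x\<^sup>2) * indicator {..-1} x = ennreal (4 / x\<^sup>2)"
        by (simp flip: distrib_left)
      then show ?thesis using False fejer_le[of x] fejer_nonneg[of x] by (simp add: ennreal_leI)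
    qed
  qed
  also have "\<dots> = (\<integral>\<^sup>+x. indicator {-1..1::real} x \<partial>lborel) + ((\<integral>\<^sup>+x. ennreal (4 / x\<^sup>2) * indicator {1..} x \<partial>lborel)
     + (\<integral>\<^sup>+x. ennreal (4 / x\<^sup>2) * indicator {..-1} x \<partial>lborel))"
    by (simp add: nn_integral_add)
  also have "\<dots> < \<infinity>" unfolding tail tail' by (simp add: emeasure_lborel_Icc_eq)
  finally show "(\<integral>\<^sup>+x. ennreal (norm (fejer x)) \<partial>lborel) < \<infinity>" .
qed simp

lemma integrable_fejer_cos: "integrable lborel (\<lambda>t. fejer t * cos (t * x))"
  by (rule Bochner_Integration.integrable_bound[OF integrable_fejer])
     (auto simp: abs_mult fejer_nonneg intro!: mult_left_le)

section \<open>Fourier inversion for the tent\<close>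

lemma char_uniform_unit:
  assumes "t \<noteq> 0"
  shows "char (uniform_measure lborel {0..1}) t = (iexp t - 1) / (\<i> * t)"
proof -
  have "char (uniform_measure lborel {0..1}) t = (CLINT x|density lborel (indicator {0..1}). iexp (t * x))"
    unfolding char_def uniform_measure_def by (simp add: divide_ennreal_def emeasure_lborel_Icc_eq)
  also have "\<dots> = (CLINT x|lborel. indicator {0..1} x *\<^sub>R iexp (t * x))"
    by (subst integral_density[where g="indicator {0..1}", symmetric]) (auto simp: ennreal_indicator)
  also have "\<dots> = (CLBINT x=0..1. iexp (t * x))"
    using interval_integral_Icc[of 0 1 "\<lambda>x. iexp (t * x)"] by (simp add: set_lebesgue_integral_def zero_ereal_def one_ereal_def)
  also have "\<dots> = iexp (t * 1) / (\<i> * t) - iexp (t * 0) / (\<i> * t)"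
    unfolding zero_ereal_def one_ereal_def
  proof (rule interval_integral_FTC_finite)
    fix x :: real
    show "((\<lambda>x. iexp (t * x) / (\<i> * t)) has_vector_derivative iexp (t * x)) (at x within {min 0 1..max 0 1})"
      using assms by (auto intro!: derivative_eq_intros simp: has_vector_derivative_complex_iff Re_divide Im_divide Re_exp Im_exp power2_eq_square)
  qed (intro continuous_intros)
  finally show ?thesis by (simp add: diff_divide_distrib)
qed

text \<open>The first quotient is the kernel of the Levy inversion formula for the interval from x
  to x + 1, the second is the characteristic function of the uniform law on [0,1]; their product is
  the integrand of the inversion formula.\<close>

lemma fejer_complex:
  assumes "t \<noteq> 0"
  shows "(iexp (- (t * x)) - iexp (- (t * (x + 1)))) / (\<i> * t) * ((iexp t - 1) / (\<i> * t))
     = of_real (fejer t) * iexp (- (t * x))"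
proof -
  have *: "fejer t = (2 - 2 * cos t) / t\<^sup>2"
    using cos_double_sin[of "t / 2"] by (simp add: fejer_def power_divide power_mult_distrib)
  have e: "iexp (- (t * (x + 1))) = iexp (- (t * x)) * iexp (- t)"
    by (simp add: algebra_simps flip: exp_add)
  have m: "iexp (- t) * iexp t = 1" by (simp flip: exp_add)
  have c: "iexp t + iexp (- t) = of_real (2 * cos t)"
    by (simp add: complex_eq_iff Re_exp Im_exp)
  have "(iexp (- (t * x)) - iexp (- (t * (x + 1)))) * (iexp t - 1)
      = iexp (- (t * x)) * (iexp t + iexp (- t) - 1 - iexp (- t) * iexp t)"
    unfolding e by (simp add: algebra_simps)
  also have "\<dots> = iexp (- (t * x)) * of_real (2 * cos t - 2)"
    unfolding m c by simp
  finally have "(iexp (- (t * x)) - iexp (- (t * (x + 1)))) / (\<i> * t) * ((iexp t - 1) / (\<i> * t))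
     = iexp (- (t * x)) * of_real (2 * cos t - 2) / (\<i> * t)\<^sup>2"
    by (simp add: power2_eq_square)
  also have "\<dots> = of_real (fejer t) * iexp (- (t * x))"
    unfolding * using assms by (simp add: power_mult_distrib divide_simps) (simp add: algebra_simps)
  finally show ?thesis .
qed

text \<open>\<open>tent x\<close> is the mass that the uniform law on [0,1] gives to the interval
  from x to x + 1, so Levy inversion for this law is the cosine integral of the Fejer
  kernel.\<close>

lemma integral_fejer_cos: "(\<integral>t. fejer t * cos (t * x) \<partial>lborel) = 2 * pi * tent x"
proof -
  let ?M = "uniform_measure lborel {0..1::real}"
  have "prob_space ?M" by (rule prob_space_uniform_measure) auto
  then interpret real_distribution ?M
    by (intro real_distribution.intro real_distribution_axioms.intro) auto
  \<comment> \<open>Levy inversion for an interval requires that its end points carry no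
    mass.\<close>
  have m0: "measure ?M {y} = 0" for y
  proof -
    have "emeasure lborel ({0..1} \<inter> {y}) \<le> emeasure lborel {y}" by (intro emeasure_mono) auto
    then show ?thesis by (simp add: measure_def)
  qed
  have mt: "measure ?M {x<..x+1} = tent x"
  proof -
    have "{0..1} \<inter> {x<..x+1} = (if x < 0 then {0..min 1 (x+1)} else {x<..1})"
      by (auto simp: min_def)
    then show ?thesis by (simp add: measure_def emeasure_lborel_Icc_eq tent_def max_def min_def divide_ennreal_def)
  qed
  let ?h = "\<lambda>t. of_real (fejer t) * iexp (- (t * x))"
  have "(\<lambda>T. 1 / (2 * pi) * (CLBINT t=-T..T. (iexp (- (t * x)) - iexp (- (t * (x + 1)))) / (\<i> * t) * char ?M t))
    \<longlonglongrightarrow> measure ?M {x<..x+1}"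
    by (rule Levy_Inversion) (auto simp: m0 simp del: measure_uniform_measure)
  moreover have "(CLBINT t=-real T..real T. (iexp (- (t * x)) - iexp (- (t * (x + 1)))) / (\<i> * t) * char ?M t)
     = (CLINT t|lborel. indicator {-real T<..<real T} t *\<^sub>R ?h t)" for T :: nat
  proof -
    have "(CLBINT t=-real T..real T. (iexp (- (t * x)) - iexp (- (t * (x + 1)))) / (\<i> * t) * char ?M t)
      = (CLINT t|lborel. indicator {-real T<..<real T} t *\<^sub>R ((iexp (- (t * x)) - iexp (- (t * (x + 1)))) / (\<i> * t) * char ?M t))"
      by (simp add: interval_lebesgue_integral_def set_lebesgue_integral_def)
    also have "\<dots> = (CLINT t|lborel. indicator {-real T<..<real T} t *\<^sub>R ?h t)"
    proof (rule integral_cong_AE)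
      show "AE t in lborel. indicator {-real T<..<real T} t *\<^sub>R ((iexp (- (t * x)) - iexp (- (t * (x + 1)))) / (\<i> * t) * char ?M t)
         = indicator {-real T<..<real T} t *\<^sub>R ?h t"
        using AE_lborel_singleton[of 0]
      proof eventually_elim
        case (elim t)
        then show ?case by (simp only: char_uniform_unit fejer_complex not_False_eq_True)
      qed
    qed measurable
    finally show ?thesis .
  qed
  ultimately have lim: "(\<lambda>T. 1 / (2 * pi) * (CLINT t|lborel. indicator {-real T<..<real T} t *\<^sub>R ?h t)) \<longlonglongrightarrow> tent x"
    unfolding mt by simp
  \<comment> \<open>Inversion yields only a limit over symmetric intervals; domination by
    \<open>fejer\<close> identifies it with the Lebesgue integral over the line.\<close>
  have "(\<lambda>T. CLINT t|lborel. indicator {-real T<..<real T} t *\<^sub>R ?h t) \<longlonglongrightarrow> (CLINT t|lborel. ?h t)"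
  proof (rule integral_dominated_convergence[where w=fejer])
    show "AE t in lborel. (\<lambda>T. indicator {-real T<..<real T} t *\<^sub>R ?h t) \<longlonglongrightarrow> ?h t"
    proof (rule AE_I2)
      fix t :: real
      obtain n :: nat where n: "\<bar>t\<bar> < real n" using reals_Archimedean2 by blast
      have "\<forall>\<^sub>F T in sequentially. indicator {-real T<..<real T} t *\<^sub>R ?h t = ?h t"
        using eventually_ge_at_top[of n] by eventually_elim (use n in \<open>auto simp: indicator_def\<close>)
      then show "(\<lambda>T. indicator {-real T<..<real T} t *\<^sub>R ?h t) \<longlonglongrightarrow> ?h t"
        by (rule tendsto_eventually)
    qed
    show "AE t in lborel. norm (indicator {-real T<..<real T} t *\<^sub>R ?h t) \<le> fejer t" for T :: nat
      by (auto simp: norm_mult fejer_nonneg indicator_def)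
  qed (use integrable_fejer in auto)
  from tendsto_mult[OF tendsto_const[of "complex_of_real (1 / (2 * pi))"] this]
  have "1 / (2 * pi) * (CLINT t|lborel. ?h t) = tent x"
    using lim LIMSEQ_unique by (metis (no_types, lifting))
  then have eq: "(CLINT t|lborel. ?h t) = of_real (2 * pi * tent x)"
    by (simp add: field_simps)
  have "integrable lborel ?h"
    by (rule Bochner_Integration.integrable_bound[OF integrable_fejer]) (auto simp: norm_mult)
  then have "(\<integral>t. Re (?h t) \<partial>lborel) = Re (of_real (2 * pi * tent x))"
    using integral_Re eq by metis
  then show ?thesis by (simp add: Re_exp)
qed

section \<open>Fourier transform of the wavelet\<close>

definition wavelet_hat :: "real \<Rightarrow> real" where "wavelet_hat t = fejer t - fejer (2 * t)"

lemma wavelet_hat_measurable [measurable]: "wavelet_hat \<in> borel_measurable borel"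
  unfolding wavelet_hat_def[abs_def] by measurable

text \<open>By the double-angle formula \<open>fejer (2 * t)\<close> is \<open>fejer t\<close> times
  a squared cosine. The factorization displays both the sign and the lower bound used below.\<close>

lemma wavelet_hat_eq: "wavelet_hat t = fejer t * (sin (t / 2))\<^sup>2"
proof -
  have "sin t = 2 * sin (t / 2) * cos (t / 2)" using sin_double[of "t / 2"] by simp
  then have "fejer (2 * t) = fejer t * (cos (t / 2))\<^sup>2"
    unfolding fejer_def by (simp add: power_divide power_mult_distrib)
  then show ?thesis unfolding wavelet_hat_def by (simp add: sin_squared_eq algebra_simps)
qed

lemma wavelet_hat_nonneg: "0 \<le> wavelet_hat t"
  unfolding wavelet_hat_eq by (simp add: fejer_nonneg)

text \<open>The dilates of this shell by powers of 2 cover all frequencies of modulus at least 1, so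
  a constant lower bound here is enough. The value is 4 sin(s/2)^4 / s^2 with s^2 at most 4.\<close>

lemma wavelet_hat_ge:
  assumes "1 \<le> \<bar>t\<bar>" "\<bar>t\<bar> \<le> 2"
  shows "sin (1 / 2) ^ 4 \<le> wavelet_hat t"
proof -
  define s where "s = \<bar>t\<bar>"
  have s: "1 \<le> s" "s \<le> 2" using assms by (auto simp: s_def)
  have "wavelet_hat t = wavelet_hat s"
    by (simp add: s_def wavelet_hat_def fejer_def abs_if)
  also have "\<dots> = 4 * sin (s / 2) ^ 4 / s\<^sup>2"
    unfolding wavelet_hat_eq fejer_def by (simp add: power_divide power_mult_distrib)
  also have "4 * sin (s / 2) ^ 4 / s\<^sup>2 \<ge> sin (s / 2) ^ 4"
  proof -
    have "s\<^sup>2 \<le> 2\<^sup>2" using s by (intro power_mono) auto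
    then have "s\<^sup>2 * sin (s / 2) ^ 4 \<le> 4 * sin (s / 2) ^ 4" by (intro mult_right_mono) auto
    then show ?thesis using s by (simp add: le_divide_eq mult.commute)
  qed
  also have "sin (s / 2) \<ge> sin (1 / 2)"
    using s pi_gt3 by (intro sin_monotone_2pi_le) auto
  then have "sin (s / 2) ^ 4 \<ge> sin (1 / 2) ^ 4"
    using pi_gt3 by (intro power_mono) (auto intro!: sin_ge_zero)
  finally show ?thesis by simp
qed

lemma integrable_wavelet_hat: "integrable lborel wavelet_hat"
proof -
  have "integrable lborel (\<lambda>x. fejer (0 + 2 * x))"
    by (intro lborel_integrable_real_affine integrable_fejer) simp
  then show ?thesis unfolding wavelet_hat_def[abs_def] using integrable_fejer by simp
qed

lemma integral_wavelet_hat_cos: "(\<integral>t. wavelet_hat t * cos (t * x) \<partial>lborel) = 2 * pi * wavelet x"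
proof -
  let ?f = "\<lambda>t. fejer t * cos (t * (x / 2))"
  have f2: "integrable lborel (\<lambda>t. ?f (0 + 2 * t))"
    by (intro lborel_integrable_real_affine integrable_fejer_cos) simp
  have "(\<integral>t. ?f t \<partial>lborel) = \<bar>2\<bar> *\<^sub>R (\<integral>t. ?f (0 + 2 * t) \<partial>lborel)"
    by (rule lborel_integral_real_affine) simp
  then have "(\<integral>t. ?f (0 + 2 * t) \<partial>lborel) = pi * tent (x / 2)"
    using integral_fejer_cos[of "x / 2"] by simp
  moreover have "(\<integral>t. wavelet_hat t * cos (t * x) \<partial>lborel)
     = (\<integral>t. fejer t * cos (t * x) - ?f (0 + 2 * t) \<partial>lborel)"
    unfolding wavelet_hat_def by (simp add: algebra_simps)
  ultimately show ?thesis
    using f2 integrable_fejer_cos[of x] by (simp add: integral_fejer_cos wavelet_def algebra_simps)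
qed

lemma integral_wavelet_hat_scaled:
  assumes "N > 0"
  shows "(\<integral>t. wavelet_hat (t / N) * cos (t * z) \<partial>lborel) = 2 * pi * N * wavelet (N * z)"
proof -
  have "(\<integral>t. wavelet_hat (t / N) * cos (t * z) \<partial>lborel)
     = \<bar>N\<bar> *\<^sub>R (\<integral>t. wavelet_hat ((0 + N * t) / N) * cos ((0 + N * t) * z) \<partial>lborel)"
    using assms by (intro lborel_integral_real_affine) simp
  also have "\<dots> = N * (\<integral>t. wavelet_hat t * cos (t * (N * z)) \<partial>lborel)"
    using assms by (simp add: ac_simps)
  finally show ?thesis by (simp add: integral_wavelet_hat_cos)
qed

lemma integrable_wavelet_hat_scaled:
  assumes "N > 0"
  shows "integrable lborel (\<lambda>t. wavelet_hat (t / N))"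
proof -
  have "integrable lborel (\<lambda>t. wavelet_hat (0 + (1 / N) * t))"
    using assms by (intro lborel_integrable_real_affine integrable_wavelet_hat) simp
  then show ?thesis by simp
qed

section \<open>Frequency bands and the Sobolev integral\<close>

lemma cmod_char_squared:
  assumes "finite_measure \<nu>" and [measurable_cong]: "sets \<nu> = sets borel"
  shows "(cmod (char \<nu> t))\<^sup>2 = (\<integral>p. cos (t * (fst p - snd p)) \<partial>(\<nu> \<Otimes>\<^sub>M \<nu>))"
proof -
  interpret finite_measure \<nu> by fact
  interpret P: pair_sigma_finite \<nu> \<nu> ..
  interpret PF: finite_measure "\<nu> \<Otimes>\<^sub>M \<nu>" by (rule finite_measure_pair_measure) (rule assms(1))+
  have ic: "integrable \<nu> (\<lambda>x. cos (t * x))" and isn: "integrable \<nu> (\<lambda>x. sin (t * x))"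
    by (auto intro!: integrable_const_bound[where B=1])
  have ie: "integrable \<nu> (\<lambda>x. iexp (t * x))"
    by (auto intro!: integrable_const_bound[where B=1])
  have Re: "Re (char \<nu> t) = (\<integral>x. cos (t * x) \<partial>\<nu>)" and Im: "Im (char \<nu> t) = (\<integral>x. sin (t * x) \<partial>\<nu>)"
    unfolding char_def using integral_Re[OF ie] integral_Im[OF ie] by (simp_all add: Re_exp Im_exp)
  have "(\<integral>p. cos (t * (fst p - snd p)) \<partial>(\<nu> \<Otimes>\<^sub>M \<nu>)) = (\<integral>x. (\<integral>y. cos (t * (x - y)) \<partial>\<nu>) \<partial>\<nu>)"
    by (subst P.integral_fst'[symmetric]) (auto intro!: PF.integrable_const_bound[where B=1])
  also have "\<dots> = (\<integral>x. cos (t * x) * (\<integral>y. cos (t * y) \<partial>\<nu>) + sin (t * x) * (\<integral>y. sin (t * y) \<partial>\<nu>) \<partial>\<nu>)"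
    using ic isn by (intro Bochner_Integration.integral_cong) (auto simp: right_diff_distrib cos_diff)
  also have "\<dots> = (\<integral>y. cos (t * y) \<partial>\<nu>)\<^sup>2 + (\<integral>y. sin (t * y) \<partial>\<nu>)\<^sup>2"
    using ic isn by (simp add: power2_eq_square)
  finally show ?thesis by (simp add: cmod_power2 Re Im)
qed

text \<open>Up to the factor \<open>2 * pi * N\<close> this is the energy of the Fourier transform
  at frequencies of order N, written without the Fourier transform so that it can be pulled back to
  the symbolic space.\<close>

definition band :: "real measure \<Rightarrow> real \<Rightarrow> real" where
  "band \<nu> N = (\<integral>p. wavelet (N * (fst p - snd p)) \<partial>(\<nu> \<Otimes>\<^sub>M \<nu>))"

lemma char_measurable_finite:
  assumes "finite_measure \<nu>" and [measurable_cong]: "sets \<nu> = sets borel"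
  shows "char \<nu> \<in> borel_measurable borel"
proof -
  interpret finite_measure \<nu> by fact
  show ?thesis unfolding char_def[abs_def] by measurable
qed

text \<open>Fubini exchanges the frequency with the pair of points. Nonnegativity of
  \<open>band\<close> is invisible in its definition, since the wavelet changes sign; it is
  inherited from the transform.\<close>

lemma nn_integral_char_band:
  assumes fin: "finite_measure \<nu>" and [measurable_cong]: "sets \<nu> = sets borel" and N: "N > 0"
  shows "(\<integral>\<^sup>+t. ennreal ((cmod (char \<nu> t))\<^sup>2 * wavelet_hat (t / N)) \<partial>lborel) = ennreal (2 * pi * N * band \<nu> N)"
    and "0 \<le> band \<nu> N"
proof -
  note [measurable] = char_measurable_finite[OF assms(1,2)]
  interpret finite_measure \<nu> by fact
  interpret PF: finite_measure "\<nu> \<Otimes>\<^sub>M \<nu>" by (rule finite_measure_pair_measure) (rule fin)+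
  interpret Q: pair_sigma_finite lborel "\<nu> \<Otimes>\<^sub>M \<nu>" ..
  let ?F = "\<lambda>t p. wavelet_hat (t / N) * cos (t * (fst p - snd p))"
  have int: "integrable (lborel \<Otimes>\<^sub>M (\<nu> \<Otimes>\<^sub>M \<nu>)) (\<lambda>(t, p). ?F t p)"
  proof (rule Q.Fubini_integrable)
    show "AE t in lborel. integrable (\<nu> \<Otimes>\<^sub>M \<nu>) (\<lambda>p. case (t, p) of (t, p) \<Rightarrow> ?F t p)"
      by (auto intro!: AE_I2 PF.integrable_const_bound[where B=1])
    have "integrable lborel (\<lambda>t. wavelet_hat (t / N) * measure (\<nu> \<Otimes>\<^sub>M \<nu>) (space (\<nu> \<Otimes>\<^sub>M \<nu>)))"
      using integrable_wavelet_hat_scaled[OF N] by simp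
    then show "integrable lborel (\<lambda>t. \<integral>p. norm (case (t, p) of (t, p) \<Rightarrow> ?F t p) \<partial>(\<nu> \<Otimes>\<^sub>M \<nu>))"
    proof (rule Bochner_Integration.integrable_bound)
      show "AE t in lborel. norm (\<integral>p. norm (case (t, p) of (t, p) \<Rightarrow> ?F t p) \<partial>(\<nu> \<Otimes>\<^sub>M \<nu>))
         \<le> norm (wavelet_hat (t / N) * measure (\<nu> \<Otimes>\<^sub>M \<nu>) (space (\<nu> \<Otimes>\<^sub>M \<nu>)))"
      proof (rule AE_I2)
        fix t :: real
        have "(\<integral>p. norm (?F t p) \<partial>(\<nu> \<Otimes>\<^sub>M \<nu>)) \<le> (\<integral>p. wavelet_hat (t / N) \<partial>(\<nu> \<Otimes>\<^sub>M \<nu>))"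
          by (intro integral_mono PF.integrable_const_bound[where B="wavelet_hat (t / N)"])
             (auto simp: abs_mult wavelet_hat_nonneg mult_left_le)
        then show "norm (\<integral>p. norm (case (t, p) of (t, p) \<Rightarrow> ?F t p) \<partial>(\<nu> \<Otimes>\<^sub>M \<nu>))
         \<le> norm (wavelet_hat (t / N) * measure (\<nu> \<Otimes>\<^sub>M \<nu>) (space (\<nu> \<Otimes>\<^sub>M \<nu>)))"
          using wavelet_hat_nonneg[of "t / N"] by (simp add: mult.commute)
      qed
    qed measurable
  qed measurable
  have "(\<integral>t. (\<integral>p. ?F t p \<partial>(\<nu> \<Otimes>\<^sub>M \<nu>)) \<partial>lborel) = (\<integral>p. (\<integral>t. ?F t p \<partial>lborel) \<partial>(\<nu> \<Otimes>\<^sub>M \<nu>))"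
    using Q.Fubini_integral[OF int] by simp
  also have "\<dots> = 2 * pi * N * band \<nu> N"
    unfolding integral_wavelet_hat_scaled[OF N] band_def by simp
  also have "(\<integral>t. (\<integral>p. ?F t p \<partial>(\<nu> \<Otimes>\<^sub>M \<nu>)) \<partial>lborel) = (\<integral>t. (cmod (char \<nu> t))\<^sup>2 * wavelet_hat (t / N) \<partial>lborel)"
    unfolding cmod_char_squared[OF assms(1,2)] by (simp add: mult.commute)
  finally have eq: "(\<integral>t. (cmod (char \<nu> t))\<^sup>2 * wavelet_hat (t / N) \<partial>lborel) = 2 * pi * N * band \<nu> N" .
  have "integrable lborel (\<lambda>t. \<integral>p. (case (t, p) of (t, p) \<Rightarrow> ?F t p) \<partial>(\<nu> \<Otimes>\<^sub>M \<nu>))"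
    using Q.integrable_fst'[OF int] by simp
  then have "integrable lborel (\<lambda>t. (cmod (char \<nu> t))\<^sup>2 * wavelet_hat (t / N))"
    unfolding cmod_char_squared[OF assms(1,2)] by (simp add: mult.commute)
  then show "(\<integral>\<^sup>+t. ennreal ((cmod (char \<nu> t))\<^sup>2 * wavelet_hat (t / N)) \<partial>lborel) = ennreal (2 * pi * N * band \<nu> N)"
    by (subst nn_integral_eq_integral) (auto simp: eq wavelet_hat_nonneg)
  have "0 \<le> (\<integral>t. (cmod (char \<nu> t))\<^sup>2 * wavelet_hat (t / N) \<partial>lborel)"
    by (intro Bochner_Integration.integral_nonneg) (auto simp: wavelet_hat_nonneg)
  then show "0 \<le> band \<nu> N" unfolding eq using N pi_gt_zero by (metis mult_pos_pos zero_le_mult_iff not_le zero_less_numeral)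
qed

text \<open>The modulus in the exponent treats growing and decaying weights together. The range up
  to 4 is that of (1 + |t|) / 2^n when 1 < |t| and 2^n <= |t| <= 2^(n+1).\<close>

lemma powr_weight_le:
  fixes y q :: real
  assumes "1 \<le> y" "y \<le> 4"
  shows "y powr q \<le> 4 powr \<bar>q\<bar>"
proof -
  have "y powr q \<le> y powr \<bar>q\<bar>" using assms by (intro powr_mono) auto
  also have "\<dots> \<le> 4 powr \<bar>q\<bar>" using assms by (intro powr_mono2) auto
  finally show ?thesis .
qed

text \<open>On the shell 2^n <= |t| <= 2^(n+1) the weight is at most a constant times 2^((q-1)n),
  and the dilated transform is bounded below. The shell therefore contributes at most a constant
  times 2^((q-1)n) * 2^n * \<open>band \<nu> (2 ^ n)\<close>.\<close>

lemma sobolev_integral_finite: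
  assumes fin: "finite_measure \<nu>" and sets [measurable_cong]: "sets \<nu> = sets borel"
    and sm: "summable (\<lambda>n. 2 powr (q * real n) * band \<nu> (2 ^ n))"
  shows "(\<integral>\<^sup>+ t. ennreal ((cmod (char \<nu> t))\<^sup>2 * (1 + \<bar>t\<bar>) powr (q - 1)) \<partial>lborel) < \<infinity>"
proof -
  interpret finite_measure \<nu> by fact
  note [measurable] = char_measurable_finite[OF assms(1,2)]
  define \<kappa> :: real where "\<kappa> = sin (1 / 2) ^ 4"
  have \<kappa>: "\<kappa> > 0" unfolding \<kappa>_def using pi_gt3 by (intro zero_less_power sin_gt_zero) auto
  define A :: real where "A = 4 powr \<bar>q - 1\<bar>"
  define m where "m = measure \<nu> (space \<nu>)"
  have cm: "cmod (char \<nu> t) \<le> m" for t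
  proof -
    have "cmod (char \<nu> t) \<le> (\<integral>x. norm (iexp (t * x)) \<partial>\<nu>)"
      unfolding char_def by (rule integral_norm_bound)
    then show ?thesis by (simp add: m_def)
  qed
  let ?g = "\<lambda>n t. ennreal (2 powr ((q - 1) * real n)) * ennreal ((cmod (char \<nu> t))\<^sup>2 * wavelet_hat (t / 2 ^ n))"
  have pt: "ennreal ((cmod (char \<nu> t))\<^sup>2 * (1 + \<bar>t\<bar>) powr (q - 1))
      \<le> ennreal (m\<^sup>2 * A) * indicator {-1..1} t + ennreal (A / \<kappa>) * (\<Sum>n. ?g n t)" for t
  proof (cases "t \<in> {-1..1}")
    case True
    have "(cmod (char \<nu> t))\<^sup>2 * (1 + \<bar>t\<bar>) powr (q - 1) \<le> m\<^sup>2 * A"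
      unfolding A_def using True by (intro mult_mono power_mono cm powr_weight_le) (auto simp: m_def)
    then have "ennreal ((cmod (char \<nu> t))\<^sup>2 * (1 + \<bar>t\<bar>) powr (q - 1)) \<le> ennreal (m\<^sup>2 * A) * indicator {-1..1} t"
      using True by (simp add: ennreal_leI)
    then show ?thesis by (rule order_trans) simp
  next
    case False
    then have t: "\<bar>t\<bar> > 1" by auto
    \<comment> \<open>The index of the dyadic shell that contains t.\<close>
    define n where "n = nat \<lfloor>log 2 \<bar>t\<bar>\<rfloor>"
    have "0 \<le> log 2 \<bar>t\<bar>" using t by simp
    then have n: "real n \<le> log 2 \<bar>t\<bar>" "log 2 \<bar>t\<bar> < real n + 1"
      unfolding n_def by linarith+
    have n1: "2 ^ n \<le> \<bar>t\<bar>"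
      using n(1) t by (subst (asm) le_log_iff) (auto simp: powr_realpow)
    have n2: "\<bar>t\<bar> \<le> 2 * 2 ^ n"
      using n(2) t by (subst (asm) log_less_iff) (auto simp: powr_add powr_realpow)
    define y where "y = (1 + \<bar>t\<bar>) / 2 ^ n"
    have p1: "1 \<le> (2::real) ^ n" by simp
    have y: "1 \<le> y" "y \<le> 4" unfolding y_def using n1 n2 p1 t by (simp_all add: divide_simps)
    have "(1 + \<bar>t\<bar>) powr (q - 1) = (2 ^ n * y) powr (q - 1)"
      by (simp add: y_def)
    also have "\<dots> = 2 powr ((q - 1) * real n) * y powr (q - 1)"
      using y by (simp add: powr_mult powr_powr mult.commute flip: powr_realpow)
    also have "\<dots> \<le> 2 powr ((q - 1) * real n) * A"
      unfolding A_def by (intro mult_left_mono powr_weight_le y) auto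
    finally have le: "(1 + \<bar>t\<bar>) powr (q - 1) \<le> 2 powr ((q - 1) * real n) * A" .
    have "\<kappa> \<le> wavelet_hat (t / 2 ^ n)"
      unfolding \<kappa>_def using n1 n2 by (intro wavelet_hat_ge) (simp_all add: abs_divide divide_simps)
    then have "1 \<le> wavelet_hat (t / 2 ^ n) / \<kappa>" using \<kappa> by (simp add: le_divide_eq)
    then have "(1 + \<bar>t\<bar>) powr (q - 1) * 1 \<le> (2 powr ((q - 1) * real n) * A) * (wavelet_hat (t / 2 ^ n) / \<kappa>)"
      using le by (intro mult_mono) (auto simp: A_def)
    then have "(cmod (char \<nu> t))\<^sup>2 * (1 + \<bar>t\<bar>) powr (q - 1)
      \<le> (cmod (char \<nu> t))\<^sup>2 * ((2 powr ((q - 1) * real n) * A) * (wavelet_hat (t / 2 ^ n) / \<kappa>))"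
      by (intro mult_left_mono) auto
    also have "\<dots> = A / \<kappa> * (2 powr ((q - 1) * real n) * ((cmod (char \<nu> t))\<^sup>2 * wavelet_hat (t / 2 ^ n)))"
      by simp
    finally have "ennreal ((cmod (char \<nu> t))\<^sup>2 * (1 + \<bar>t\<bar>) powr (q - 1)) \<le> ennreal (A / \<kappa>) * ?g n t"
      using \<kappa> by (simp add: ennreal_leI A_def wavelet_hat_nonneg flip: ennreal_mult)
    also have "?g n t \<le> (\<Sum>n. ?g n t)"
      using sum_le_suminf[of "\<lambda>n. ?g n t" "{n}"] by simp
    then have "ennreal (A / \<kappa>) * ?g n t \<le> ennreal (A / \<kappa>) * (\<Sum>n. ?g n t)"
      by (rule mult_left_mono) simp
    finally show ?thesis by (rule order_trans) simp
  qed
  have "(\<integral>\<^sup>+ t. ennreal ((cmod (char \<nu> t))\<^sup>2 * (1 + \<bar>t\<bar>) powr (q - 1)) \<partial>lborel)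
     \<le> (\<integral>\<^sup>+ t. ennreal (m\<^sup>2 * A) * indicator {-1..1} t + ennreal (A / \<kappa>) * (\<Sum>n. ?g n t) \<partial>lborel)"
    by (intro nn_integral_mono pt)
  also have "\<dots> = ennreal (m\<^sup>2 * A) * emeasure lborel {-1..1::real} + ennreal (A / \<kappa>) * (\<Sum>n. \<integral>\<^sup>+ t. ?g n t \<partial>lborel)"
    by (subst nn_integral_add) (auto simp: nn_integral_cmult nn_integral_cmult_indicator nn_integral_suminf)
  also have "(\<lambda>n. \<integral>\<^sup>+ t. ?g n t \<partial>lborel) = (\<lambda>n. ennreal (2 * pi * (2 powr (q * real n) * band \<nu> (2 ^ n))))"
  proof
    fix n
    have "(\<integral>\<^sup>+ t. ?g n t \<partial>lborel) = ennreal (2 powr ((q - 1) * real n)) * ennreal (2 * pi * 2 ^ n * band \<nu> (2 ^ n))"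
      by (subst nn_integral_cmult) (auto simp: nn_integral_char_band[OF fin sets])
    also have "\<dots> = ennreal (2 powr ((q - 1) * real n) * (2 * pi * 2 ^ n * band \<nu> (2 ^ n)))"
      using nn_integral_char_band(2)[OF fin sets, of "2 ^ n"] by (subst ennreal_mult) auto
    also have "2 powr ((q - 1) * real n) * (2 * pi * 2 ^ n * band \<nu> (2 ^ n)) = 2 * pi * (2 powr (q * real n) * band \<nu> (2 ^ n))"
      by (simp add: left_diff_distrib powr_diff powr_realpow)
    finally show "(\<integral>\<^sup>+ t. ?g n t \<partial>lborel) = ennreal (2 * pi * (2 powr (q * real n) * band \<nu> (2 ^ n)))" .
  qed
  also have "(\<Sum>n. ennreal (2 * pi * (2 powr (q * real n) * band \<nu> (2 ^ n)))) = ennreal (\<Sum>n. 2 * pi * (2 powr (q * real n) * band \<nu> (2 ^ n)))"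
    using nn_integral_char_band(2)[OF fin sets] by (intro suminf_ennreal2 summable_mult sm) auto
  also have "ennreal (m\<^sup>2 * A) * emeasure lborel {-1..1::real} + ennreal (A / \<kappa>) * \<dots> < \<infinity>"
    by (simp add: emeasure_lborel_Icc_eq ennreal_mult_less_top)
  finally show ?thesis .
qed

section \<open>Oscillatory integrals along a direction\<close>

lemma norm_integral_le_interval:
  fixes F :: "real \<Rightarrow> real"
  assumes bd: "\<And>s. \<bar>F s\<bar> \<le> B" and supp: "\<And>s. \<bar>s - c\<bar> > r \<Longrightarrow> F s = 0" and r: "0 \<le> r"
  shows "\<bar>\<integral>s. F s \<partial>lborel\<bar> \<le> 2 * r * B"
proof -
  have "\<bar>\<integral>s. F s \<partial>lborel\<bar> \<le> (\<integral>s. indicator {c - r..c + r} s *\<^sub>R B \<partial>lborel)"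
  proof (cases "integrable lborel F")
    case True
    have "norm (\<integral>s. F s \<partial>lborel) \<le> (\<integral>s. norm (F s) \<partial>lborel)"
      by (rule integral_norm_bound)
    also have "\<dots> \<le> (\<integral>s. indicator {c - r..c + r} s *\<^sub>R B \<partial>lborel)"
    proof (rule integral_mono)
      show "integrable lborel (\<lambda>s. indicator {c - r..c + r} s *\<^sub>R B)"
        by (intro integrable_scaleR_left integrable_real_indicator) (auto simp: emeasure_lborel_Icc_eq)
      show "norm (F s) \<le> indicator {c - r..c + r} s *\<^sub>R B" for s
        using bd[of s] supp[of s] by (cases "\<bar>s - c\<bar> > r") (auto simp: indicator_def)
    qed (use True in auto)
    finally show ?thesis by simp
  next
    case False
    \<comment> \<open>A non-integrable function has integral 0 by convention, so only the sign of B
      matters here.\<close>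
    have "0 \<le> B" using bd[of 0] by linarith
    then show ?thesis using False by (simp add: not_integrable_integral_eq)
  qed
  also have "\<dots> = 2 * r * B" using r by simp
  finally show ?thesis .
qed

text \<open>Freezing the amplitude A, the modulus g and the linear part of h at one point of the support
  leaves the integral of an affinely rescaled mean-zero wavelet.\<close>

lemma oscillatory_integral_bound:
  fixes A g h :: "real \<Rightarrow> real" and I :: "real set"
  assumes meas [measurable]: "(\<lambda>s. A s * wavelet (N * g s * h s)) \<in> borel_measurable borel"
    and N: "N > 0" and \<beta>: "0 < \<beta>" "\<beta> \<le> 1" and \<kappa>: "0 < \<kappa>" and g0: "0 < g0" and L: "0 \<le> L" and H: "0 \<le> H" and D: "0 \<le> D" and M1: "0 \<le> M1" and g01: "g0 \<le> g1"
    and A0: "\<And>s. s \<notin> I \<Longrightarrow> A s = 0" and AM: "\<And>s. \<bar>A s\<bar> \<le> M"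
    and A1: "\<And>s t. s \<in> I \<Longrightarrow> \<bar>s - t\<bar> \<le> 1 \<Longrightarrow> \<bar>A s - A t\<bar> \<le> M1 * \<bar>s - t\<bar> powr \<beta>"
    and g: "\<And>s. s \<in> I \<Longrightarrow> g0 \<le> g s" "\<And>s. s \<in> I \<Longrightarrow> g s \<le> g1"
    and gL: "\<And>s t. s \<in> I \<Longrightarrow> t \<in> I \<Longrightarrow> \<bar>g s - g t\<bar> \<le> L * g1 * \<bar>s - t\<bar>"
    and hlow: "\<And>s t. s \<in> I \<Longrightarrow> t \<in> I \<Longrightarrow> \<kappa> * \<bar>s - t\<bar> \<le> \<bar>h s - h t\<bar>"
    and hup: "\<And>s t. s \<in> I \<Longrightarrow> t \<in> I \<Longrightarrow> \<bar>h s - h t\<bar> \<le> D * \<bar>s - t\<bar>"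
    and hd: "\<And>s. s \<in> I \<Longrightarrow> \<exists>h1. \<kappa> \<le> \<bar>h1\<bar> \<and> (\<forall>t\<in>I. \<bar>h t - h s - h1 * (t - s)\<bar> \<le> H * \<bar>t - s\<bar> powr (1 + \<beta>))"
    and l: "l = 4 / (N * g0 * \<kappa>)" "l \<le> 1"
  shows "\<bar>\<integral>s. A s * wavelet (N * g s * h s) \<partial>lborel\<bar>
     \<le> 2 * l * (l powr \<beta> * (M1 + 2 * M * (g1 / g0) * (L * (2 + 4 * D / \<kappa>) + 4 * H / \<kappa>)))"
proof -
  define C where "C = M1 + 2 * M * (g1 / g0) * (L * (2 + 4 * D / \<kappa>) + 4 * H / \<kappa>)"
  let ?F = "\<lambda>s. A s * wavelet (N * g s * h s)"
  have M: "0 \<le> M" using AM[of 0] by linarith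
  have l0: "l > 0" using l N g0 \<kappa> by simp
  \<comment> \<open>Lipschitz errors of order l are absorbed in the Hoelder rate.\<close>
  have l\<beta>: "l \<le> l powr \<beta>" using l0 l \<beta> powr_mono'[of \<beta> 1 l] by simp
  show ?thesis
  proof (cases "\<exists>s. ?F s \<noteq> 0")
    case False
    then have F0: "?F = (\<lambda>s. 0)" by (intro ext) auto
    show ?thesis unfolding F0 using M M1 l0 L D H \<kappa> g0 g01 by simp
  next
    case True
    \<comment> \<open>The freezing point is taken where the integrand does not vanish. There the
      argument of the wavelet is less than 2 in modulus, so \<open>h s1\<close> is small, and the
      lower bound on increments of h confines the support around it.\<close>
    then obtain s1 where s1: "?F s1 \<noteq> 0" by auto
    have s1I: "s1 \<in> I" using A0 s1 by force
    have gpos: "g s > 0" if "s \<in> I" for s using g(1)[OF that] g0 by linarith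
    have g1: "0 < g1" using g[OF s1I] g0 by linarith
    have small: "\<bar>h s\<bar> \<le> 2 / (N * g0)" if "s \<in> I" "wavelet (N * g s * h s) \<noteq> 0" for s
    proof -
      have "\<bar>N * g s * h s\<bar> < 2" using that(2) wavelet_eq_0[of "N * g s * h s"] by fastforce
      then have "N * g s * \<bar>h s\<bar> < 2" using N gpos[OF that(1)] by (simp add: abs_mult)
      moreover have "N * g0 * \<bar>h s\<bar> \<le> N * g s * \<bar>h s\<bar>"
        using N g(1)[OF that(1)] by (intro mult_right_mono mult_left_mono) auto
      ultimately have "\<bar>h s\<bar> * (N * g0) \<le> 2" by (simp add: mult.commute)
      then show ?thesis using N g0 by (simp add: le_divide_eq)
    qed
    obtain h1 where h1: "\<kappa> \<le> \<bar>h1\<bar>" "\<And>t. t \<in> I \<Longrightarrow> \<bar>h t - h s1 - h1 * (t - s1)\<bar> \<le> H * \<bar>t - s1\<bar> powr (1 + \<beta>)"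
      using hd[OF s1I] by blast
    define p where "p = N * g s1 * h1"
    define z where "z = N * g s1 * h s1 - p * s1"
    let ?T = "\<lambda>s. A s1 * wavelet (z + p * s)"
    have zp: "z + p * s = N * g s1 * (h s1 + h1 * (s - s1))" for s
      unfolding z_def p_def by (simp add: algebra_simps)
    have p0: "p \<noteq> 0" unfolding p_def using N gpos[OF s1I] h1 \<kappa> by auto
    have T: "integrable lborel ?T" "(\<integral>s. ?T s \<partial>lborel) = 0"
      using integral_wavelet_affine[OF p0, of z] by auto
    have hs1: "\<bar>h s1\<bar> \<le> 2 / (N * g0)" using small s1I s1 by auto
    \<comment> \<open>h is at most 2 / (N g0) in modulus at s and at s1, while it varies by at least
      \<kappa> |s - s1|; the sum 2 + 2 is the 4 in the definition of l.\<close>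
    have far_F: "?F s = 0" if "\<bar>s - s1\<bar> > l" for s
    proof (rule ccontr)
      assume nz: "?F s \<noteq> 0"
      then have sI: "s \<in> I" using A0 by force
      have "\<kappa> * \<bar>s - s1\<bar> \<le> \<bar>h s\<bar> + \<bar>h s1\<bar>" using hlow[OF sI s1I] by linarith
      also have "\<dots> \<le> 2 / (N * g0) + 2 / (N * g0)" using small[OF sI] nz hs1 by auto
      also have "\<dots> = \<kappa> * l" unfolding l using \<kappa> by simp
      finally show False using that \<kappa> by simp
    qed
    have far_T: "?T s = 0" if "\<bar>s - s1\<bar> > l" for s
    proof -
      have "4 / (N * g0) = \<kappa> * l" unfolding l using \<kappa> by simp
      also have "\<dots> < \<kappa> * \<bar>s - s1\<bar>" using that \<kappa> by simp
      also have "\<dots> \<le> \<bar>h1\<bar> * \<bar>s - s1\<bar>" using h1 by (intro mult_right_mono) auto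
      also have "\<dots> \<le> \<bar>h s1 + h1 * (s - s1)\<bar> + \<bar>h s1\<bar>"
        by (simp flip: abs_mult)
      finally have "2 / (N * g0) \<le> \<bar>h s1 + h1 * (s - s1)\<bar>" using hs1 by (simp add: field_simps)
      then have "2 \<le> N * g0 * \<bar>h s1 + h1 * (s - s1)\<bar>" using N g0 by (simp add: divide_le_eq mult.commute)
      also have "\<dots> \<le> N * g s1 * \<bar>h s1 + h1 * (s - s1)\<bar>"
        using N g(1)[OF s1I] by (intro mult_right_mono mult_left_mono) auto
      finally have "2 \<le> \<bar>z + p * s\<bar>" unfolding zp using N gpos[OF s1I] by (simp add: abs_mult)
      then show ?thesis using wavelet_eq_0 by simp
    qed
    have C: "0 \<le> C" "M1 \<le> C" unfolding C_def using M M1 L D H \<kappa> g0 g1 by simp_all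
    have diff: "\<bar>?F s - ?T s\<bar> \<le> l powr \<beta> * C" for s
    proof (cases "\<bar>s - s1\<bar> > l")
      case True
      then show ?thesis using far_F[OF True] far_T[OF True] mult_nonneg_nonneg[OF powr_ge_zero[of l \<beta>] C(1)] by linarith
    next
      case False
      then have sl: "\<bar>s - s1\<bar> \<le> l" by simp
      have powl: "\<bar>s - s1\<bar> powr \<beta> \<le> l powr \<beta>" using sl \<beta> by (intro powr_mono2) auto
      have A_s: "\<bar>A s - A s1\<bar> \<le> M1 * l powr \<beta>"
        using A1[OF s1I, of s] sl l(2) powl M1 by (smt (verit) abs_minus_commute mult_left_mono)
      show ?thesis
      proof (cases "s \<in> I")
        case False
        then have "?F s = 0" using A0 by simp
        moreover have "\<bar>?T s\<bar> \<le> \<bar>A s1\<bar> * 1" unfolding abs_mult by (intro mult_left_mono abs_wavelet_le_1) auto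
        moreover have "\<bar>A s1\<bar> \<le> l powr \<beta> * M1" using A_s A0[OF False] by (simp add: mult.commute)
        moreover have "l powr \<beta> * M1 \<le> l powr \<beta> * C" using C by (intro mult_left_mono) auto
        ultimately show ?thesis by linarith
      next
        case True
        have hs: "\<bar>h s\<bar> \<le> 2 / (N * g0) + D * l"
        proof -
          have "\<bar>h s\<bar> \<le> \<bar>h s1\<bar> + D * \<bar>s - s1\<bar>" using hup[OF True s1I] by linarith
          also have "D * \<bar>s - s1\<bar> \<le> D * l" using sl D by (intro mult_left_mono) auto
          finally show ?thesis using hs1 by linarith
        qed
        have "N * g s * h s - (z + p * s) = N * ((g s - g s1) * h s + g s1 * (h s - h s1 - h1 * (s - s1)))"
          unfolding zp by (simp add: algebra_simps)
        then have "\<bar>N * g s * h s - (z + p * s)\<bar> = N * \<bar>(g s - g s1) * h s + g s1 * (h s - h s1 - h1 * (s - s1))\<bar>"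
          using N by (simp add: abs_mult)
        also have "\<dots> \<le> N * (\<bar>g s - g s1\<bar> * \<bar>h s\<bar> + g s1 * \<bar>h s - h s1 - h1 * (s - s1)\<bar>)"
          using N gpos[OF s1I] abs_triangle_ineq[of "(g s - g s1) * h s" "g s1 * (h s - h s1 - h1 * (s - s1))"]
          by (intro mult_left_mono) (auto simp: abs_mult)
        also have "\<dots> \<le> N * ((L * g1 * l) * (2 / (N * g0) + D * l) + g1 * (H * l powr (1 + \<beta>)))"
        proof (intro mult_left_mono add_mono mult_mono hs)
          have "\<bar>g s - g s1\<bar> \<le> L * g1 * \<bar>s - s1\<bar>" by (rule gL[OF True s1I])
          also have "\<dots> \<le> L * g1 * l" using sl L g1 by (intro mult_left_mono) auto
          finally show "\<bar>g s - g s1\<bar> \<le> L * g1 * l" .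
          have "\<bar>h s - h s1 - h1 * (s - s1)\<bar> \<le> H * \<bar>s - s1\<bar> powr (1 + \<beta>)" by (rule h1(2)[OF True])
          also have "\<dots> \<le> H * l powr (1 + \<beta>)" using sl H \<beta> by (intro mult_left_mono powr_mono2) auto
          finally show "\<bar>h s - h s1 - h1 * (s - s1)\<bar> \<le> H * l powr (1 + \<beta>)" .
        qed (use g[OF s1I] N L g1 l0 in auto)
        also have "\<dots> = (g1 / g0) * (L * (2 + 4 * D / \<kappa>)) * l + (g1 / g0) * (4 * H / \<kappa>) * l powr \<beta>"
        proof -
          \<comment> \<open>Eliminating N through l makes each error a constant times l or
            l^\<beta>.\<close>
          have Neq: "N = 4 / (l * (g0 * \<kappa>))" unfolding l using N g0 \<kappa> by simp
          have lp: "l powr (1 + \<beta>) = l * l powr \<beta>" using l0 by (simp add: powr_add)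
          show ?thesis unfolding lp Neq using l0 g0 \<kappa> by (simp add: field_simps)
        qed
        also have "\<dots> \<le> (g1 / g0) * (L * (2 + 4 * D / \<kappa>)) * l powr \<beta> + (g1 / g0) * (4 * H / \<kappa>) * l powr \<beta>"
          using l\<beta> g1 g0 L D H \<kappa> by (intro add_mono mult_left_mono) auto
        finally have arg: "\<bar>N * g s * h s - (z + p * s)\<bar> \<le> l powr \<beta> * ((g1 / g0) * (L * (2 + 4 * D / \<kappa>) + 4 * H / \<kappa>))"
          by (simp add: algebra_simps)
        have "?F s - ?T s = (A s - A s1) * wavelet (N * g s * h s) + A s1 * (wavelet (N * g s * h s) - wavelet (z + p * s))"
          by (simp add: algebra_simps)
        also have "\<bar>\<dots>\<bar> \<le> \<bar>A s - A s1\<bar> * 1 + M * (2 * \<bar>N * g s * h s - (z + p * s)\<bar>)"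
          by (intro order_trans[OF abs_triangle_ineq] add_mono)
             (auto simp: abs_mult simp del: mult_1_right intro!: mult_mono abs_wavelet_le_1 AM wavelet_lipschitz M)
        also have "\<dots> \<le> M1 * l powr \<beta> + M * (2 * (l powr \<beta> * ((g1 / g0) * (L * (2 + 4 * D / \<kappa>) + 4 * H / \<kappa>))))"
          using A_s arg M by (intro add_mono mult_left_mono) auto
        also have "\<dots> = l powr \<beta> * C" unfolding C_def by (simp add: algebra_simps)
        finally show ?thesis .
      qed
    qed
    have intF: "integrable lborel ?F"
    proof (rule integrableI_bounded_set[where A="{s1 - l..s1 + l}" and B=M])
      show "AE s in lborel. s \<in> {s1 - l..s1 + l} \<longrightarrow> norm (?F s) \<le> M"
      proof (intro AE_I2 impI)
        fix s
        have "\<bar>A s\<bar> * \<bar>wavelet (N * g s * h s)\<bar> \<le> M * 1"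
          using M by (intro mult_mono AM abs_wavelet_le_1) auto
        then show "norm (?F s) \<le> M" by (simp add: abs_mult)
      qed
      show "AE s in lborel. s \<notin> {s1 - l..s1 + l} \<longrightarrow> ?F s = 0"
        proof (intro AE_I2 impI)
        fix s assume "s \<notin> {s1 - l..s1 + l}"
        then have "\<bar>s - s1\<bar> > l" unfolding atLeastAtMost_iff by linarith
        then show "?F s = 0" by (rule far_F)
      qed
    qed (auto simp: emeasure_lborel_Icc_eq)
    have "(\<integral>s. ?F s \<partial>lborel) = (\<integral>s. ?F s - ?T s \<partial>lborel)"
      using intF T by (subst Bochner_Integration.integral_diff) auto
    also have "\<bar>\<dots>\<bar> \<le> 2 * l * (l powr \<beta> * C)"
    proof (rule norm_integral_le_interval[where c=s1])
      show "\<bar>?F s - ?T s\<bar> \<le> l powr \<beta> * C" for s by (rule diff)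
      show "?F s - ?T s = 0" if "l < \<bar>s - s1\<bar>" for s using far_F[OF that] far_T[OF that] by linarith
    qed (use l0 in simp)
    finally show ?thesis unfolding C_def .
  qed
qed

section \<open>Slicing an integral along a direction\<close>

lemma integral_translate:
  fixes F :: "'a::euclidean_space \<Rightarrow> real"
  assumes [measurable]: "F \<in> borel_measurable borel"
  shows "(\<integral>l. F (l + v) \<partial>lborel) = (\<integral>l. F l \<partial>lborel)"
    and "integrable lborel (\<lambda>l. F (l + v)) \<longleftrightarrow> integrable lborel F"
proof -
  have "(\<integral>l. F l \<partial>lborel) = (\<integral>l. F l \<partial>distr lborel borel ((+) v))"
    by (simp add: lborel_distr_plus)
  also have "\<dots> = (\<integral>l. F (l + v) \<partial>lborel)"
    by (subst integral_distr) (auto simp: add.commute)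
  finally show "(\<integral>l. F (l + v) \<partial>lborel) = (\<integral>l. F l \<partial>lborel)" by simp
  have "integrable lborel F \<longleftrightarrow> integrable (distr lborel borel ((+) v)) F"
    by (simp add: lborel_distr_plus)
  also have "\<dots> \<longleftrightarrow> integrable lborel (\<lambda>l. F (l + v))"
    by (subst integrable_distr_eq) (auto simp: add.commute)
  finally show "integrable lborel (\<lambda>l. F (l + v)) \<longleftrightarrow> integrable lborel F" by simp
qed

lemma unit_window:
  fixes y :: real
  shows "(\<integral>s. indicator {0..1} (y - s) \<partial>lborel) = (1::real)"
  "integrable lborel (\<lambda>s. indicator {0..1} (y - s) :: real)"
proof -
  have eq: "(\<lambda>s. indicator {0..1} (y - s) :: real) = indicator {y - 1..y}"
    by (rule ext) (auto simp: indicator_def)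
  show "(\<integral>s. indicator {0..1} (y - s) \<partial>lborel) = (1::real)" unfolding eq by simp
  show "integrable lborel (\<lambda>s. indicator {0..1} (y - s) :: real)" unfolding eq
    by (intro integrable_real_indicator) (auto simp: emeasure_lborel_Icc_eq)
qed

text \<open>Windows of unit length in the direction e give Fubini in an arbitrary direction by translation
  invariance alone, without rotating coordinates.\<close>

lemma integral_slices:
  fixes F :: "'a::euclidean_space \<Rightarrow> real"
  assumes F: "integrable lborel F" and e: "norm e = 1"
  shows "(\<integral>l. F l \<partial>lborel) = (\<integral>l. indicator {0..1} (l \<bullet> e) * (\<integral>s. F (l + s *\<^sub>R e) \<partial>lborel) \<partial>lborel)"
proof -
  have [measurable]: "F \<in> borel_measurable borel" using F by auto
  let ?K = "\<lambda>l s. F l * indicator {0..1} (l \<bullet> e - s)"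
  have intK: "integrable (lborel \<Otimes>\<^sub>M lborel) (\<lambda>(l, s). ?K l s)"
  proof (rule lborel_pair.Fubini_integrable)
    show "integrable lborel (\<lambda>l. \<integral>s. norm (case (l, s) of (l, s) \<Rightarrow> ?K l s) \<partial>lborel)"
      using F by (simp add: abs_mult unit_window)
    show "AE l in lborel. integrable lborel (\<lambda>s. case (l, s) of (l, s) \<Rightarrow> ?K l s)"
      by (simp add: unit_window)
  qed measurable
  have sh: "?K (l + s *\<^sub>R e) s = F (l + s *\<^sub>R e) * indicator {0..1} (l \<bullet> e)" for l s
    using e by (simp add: inner_add_left norm_eq_1)
  let ?K' = "\<lambda>l s. F (l + s *\<^sub>R e) * indicator {0..1} (l \<bullet> e)"
  have intK': "integrable (lborel \<Otimes>\<^sub>M lborel) (\<lambda>(s, l). ?K' l s)"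
  proof (rule lborel_pair.Fubini_integrable)
    have "integrable lborel (\<lambda>s. \<integral>l. norm (?K l s) \<partial>lborel)"
      using lborel_pair.integrable_snd[of "\<lambda>l s. norm (?K l s)"] integrable_norm[OF intK] by (simp add: case_prod_unfold)
    moreover have "(\<integral>l. norm (?K l s) \<partial>lborel) = (\<integral>l. norm (?K' l s) \<partial>lborel)" for s
      unfolding sh[symmetric] by (rule integral_translate(1)[symmetric]) measurable
    ultimately show "integrable lborel (\<lambda>s. \<integral>l. norm (case (s, l) of (s, l) \<Rightarrow> ?K' l s) \<partial>lborel)"
      by simp
    have "AE s in lborel. integrable lborel (\<lambda>l. ?K l s)"
      using lborel_pair.AE_integrable_snd[OF intK] by simp
    moreover have "integrable lborel (\<lambda>l. ?K' l s) \<longleftrightarrow> integrable lborel (\<lambda>l. ?K l s)" for s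
      unfolding sh[symmetric] by (rule integral_translate(2)) measurable
    ultimately show "AE s in lborel. integrable lborel (\<lambda>l. case (s, l) of (s, l) \<Rightarrow> ?K' l s)"
      by simp
  qed measurable
  have "(\<integral>l. F l \<partial>lborel) = (\<integral>l. (\<integral>s. ?K l s \<partial>lborel) \<partial>lborel)"
    by (simp add: unit_window)
  also have "\<dots> = (\<integral>s. (\<integral>l. ?K l s \<partial>lborel) \<partial>lborel)"
    using lborel_pair.Fubini_integral[OF intK] by simp
  also have "\<dots> = (\<integral>s. (\<integral>l. ?K' l s \<partial>lborel) \<partial>lborel)"
    unfolding sh[symmetric]
    by (intro Bochner_Integration.integral_cong refl integral_translate(1)[symmetric]) measurable
  also have "\<dots> = (\<integral>l. (\<integral>s. ?K' l s \<partial>lborel) \<partial>lborel)"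
    using lborel_pair.Fubini_integral[OF intK'] by simp
  finally show ?thesis by (simp add: mult.commute)
qed

text \<open>The window fixes the component along e up to length 1 and the support fixes the position
  up to the shift s, so only a bounded set of base points contributes.\<close>

lemma integral_le_slices:
  fixes F :: "'a::euclidean_space \<Rightarrow> real"
  assumes F: "integrable lborel F" and e: "norm e = 1"
    and supp: "\<And>l. l \<notin> ball l0 R \<Longrightarrow> F l = 0"
    and B: "\<And>l. \<bar>\<integral>s. F (l + s *\<^sub>R e) \<partial>lborel\<bar> \<le> B"
  shows "\<bar>\<integral>l. F l \<partial>lborel\<bar> \<le> measure lborel (cball l0 (2 * R + 1 + norm l0)) * B"
proof -
  let ?C = "cball l0 (2 * R + 1 + norm l0)"
  let ?G = "\<lambda>l. indicator {0..1} (l \<bullet> e) * (\<integral>s. F (l + s *\<^sub>R e) \<partial>lborel)"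
  have [measurable]: "F \<in> borel_measurable borel" using F by auto
  have far: "?G l = 0" if l: "l \<notin> ?C" for l
  proof (cases "l \<bullet> e \<in> {0..1}")
    case True
    have "F (l + s *\<^sub>R e) = 0" for s
    proof (rule ccontr)
      assume "F (l + s *\<^sub>R e) \<noteq> 0"
      then have n: "norm (l + s *\<^sub>R e - l0) < R" using supp[of "l + s *\<^sub>R e"] by (auto simp: dist_norm norm_minus_commute)
      have "\<bar>(l + s *\<^sub>R e - l0) \<bullet> e\<bar> \<le> norm (l + s *\<^sub>R e - l0)"
        using Cauchy_Schwarz_ineq2[of "l + s *\<^sub>R e - l0" e] e by simp
      moreover have "\<bar>l0 \<bullet> e\<bar> \<le> norm l0" using Cauchy_Schwarz_ineq2[of l0 e] e by simp
      moreover have "(l + s *\<^sub>R e - l0) \<bullet> e = l \<bullet> e + s - l0 \<bullet> e"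
        using e by (simp add: inner_add_left inner_diff_left norm_eq_1)
      \<comment> \<open>Comparing components along e bounds the shift; adding the distance R from
        the centre gives the radius \<open>2 * R + 1 + norm l0\<close>.\<close>
      ultimately have "\<bar>s\<bar> \<le> R + 1 + norm l0" using n True unfolding atLeastAtMost_iff by linarith
      moreover have "norm (l - l0) \<le> norm (l + s *\<^sub>R e - l0) + \<bar>s\<bar>"
        using norm_triangle_ineq4[of "l + s *\<^sub>R e - l0" "s *\<^sub>R e"] e by (simp add: algebra_simps)
      ultimately show False using l n by (simp add: dist_norm norm_minus_commute)
    qed
    then show ?thesis by simp
  qed simp
  have Gle: "\<bar>?G l\<bar> \<le> indicator ?C l *\<^sub>R B" for l
    using far[of l] B[of l] by (auto simp: indicator_def abs_mult)
  have "\<bar>\<integral>l. ?G l \<partial>lborel\<bar> \<le> (\<integral>l. indicator ?C l *\<^sub>R B \<partial>lborel)"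
  proof -
    have intC: "integrable lborel (\<lambda>l. indicator ?C l *\<^sub>R B)"
      using emeasure_bounded_finite[OF bounded_cball]
      by (intro integrable_scaleR_left integrable_real_indicator) (auto simp: top.not_eq_extremum)
    then have "integrable lborel ?G"
      by (rule Bochner_Integration.integrable_bound) (use Gle in \<open>auto intro!: AE_I2 order_trans[OF _ abs_ge_self]\<close>)
    then have "norm (\<integral>l. ?G l \<partial>lborel) \<le> (\<integral>l. norm (?G l) \<partial>lborel)" by (intro integral_norm_bound)
    also have "\<dots> \<le> (\<integral>l. indicator ?C l *\<^sub>R B \<partial>lborel)"
      using \<open>integrable lborel ?G\<close> intC Gle by (intro integral_mono) auto
    finally show ?thesis by simp
  qed
  also have "\<dots> = measure lborel ?C * B" by simp
  finally show ?thesis unfolding integral_slices[OF F e] .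
qed

section \<open>The parametrized iterated function system\<close>

lemma in_seqspace_iff: "i \<in> space (seqspace m) \<longleftrightarrow> (\<forall>n. i n \<in> {1..m})"
  by (auto simp: seqspace_def space_PiM)

lemma pref_add: "pref i (p + n) = pref i p @ pref (\<lambda>k. i (k + p)) n"
  unfolding pref_def by (rule nth_equalityI) (auto simp: nth_append add.commute)

lemma length_pref [simp]: "length (pref i n) = n"
  unfolding pref_def by simp

lemma set_pref: "(\<forall>n. i n \<in> {1..m}) \<Longrightarrow> set (pref i n) \<subseteq> {1..m}"
  unfolding pref_def by auto

lemma comp_word_simps [simp]:
  "comp_word f l [] x = x" "comp_word f l (j # w) x = f j l (comp_word f l w x)"
  unfolding comp_word_def by simp_all

lemma comp_word_append: "comp_word f l (u @ w) x = comp_word f l u (comp_word f l w x)"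
  by (induction u) simp_all

text \<open>The local regularity is kept in quantitative form. Differentiability in the parameter
  appears as a first-order expansion with a uniform remainder, a property that passes through
  compositions and pointwise limits without exchanging limits and derivatives. The set B has
  diameter at most 1 so that larger powers of distances are smaller.\<close>

locale param_ifs =
  fixes a b :: real and m :: nat and B :: "'a::euclidean_space set"
    and f f1 :: "nat \<Rightarrow> 'a \<Rightarrow> real \<Rightarrow> real" and fl :: "nat \<Rightarrow> 'a \<Rightarrow> real \<Rightarrow> 'a"
    and C \<gamma>1 \<gamma>2 \<beta> :: real
  assumes ab: "a < b" and C: "0 \<le> C" and \<gamma>: "0 < \<gamma>1" "0 < \<gamma>2" "\<gamma>2 < 1" and \<beta>: "0 < \<beta>" "\<beta> \<le> 1"
    and B1: "\<And>l l'. l \<in> B \<Longrightarrow> l' \<in> B \<Longrightarrow> norm (l' - l) \<le> 1"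
    and maps: "\<And>j l x. j \<in> {1..m} \<Longrightarrow> l \<in> B \<Longrightarrow> x \<in> {a..b} \<Longrightarrow> f j l x \<in> {a..b}"
    and d1: "\<And>j l x. j \<in> {1..m} \<Longrightarrow> l \<in> B \<Longrightarrow> x \<in> {a..b} \<Longrightarrow>
               (f j l has_real_derivative f1 j l x) (at x within {a..b})"
    and f1_lip: "\<And>j l x y. j \<in> {1..m} \<Longrightarrow> l \<in> B \<Longrightarrow> x \<in> {a..b} \<Longrightarrow> y \<in> {a..b} \<Longrightarrow> \<bar>f1 j l x - f1 j l y\<bar> \<le> C * \<bar>x - y\<bar>"
    and f1_lam: "\<And>j l l' x. j \<in> {1..m} \<Longrightarrow> l \<in> B \<Longrightarrow> l' \<in> B \<Longrightarrow> x \<in> {a..b} \<Longrightarrow> \<bar>f1 j l' x - f1 j l x\<bar> \<le> C * norm (l' - l)"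
    and f1_bd: "\<And>j l x. j \<in> {1..m} \<Longrightarrow> l \<in> B \<Longrightarrow> x \<in> {a..b} \<Longrightarrow> \<gamma>1 \<le> \<bar>f1 j l x\<bar> \<and> \<bar>f1 j l x\<bar> \<le> \<gamma>2"
    and f_exp: "\<And>j l l' x. j \<in> {1..m} \<Longrightarrow> l \<in> B \<Longrightarrow> l' \<in> B \<Longrightarrow> x \<in> {a..b} \<Longrightarrow>
               \<bar>f j l' x - f j l x - fl j l x \<bullet> (l' - l)\<bar> \<le> C * norm (l' - l) powr (1 + \<beta>)"
    and fl_bd: "\<And>j l x. j \<in> {1..m} \<Longrightarrow> l \<in> B \<Longrightarrow> x \<in> {a..b} \<Longrightarrow> norm (fl j l x) \<le> C"
begin

lemma norm_powr_le:
  assumes "l \<in> B" "l' \<in> B"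
  shows "norm (l' - l) powr (1 + \<beta>) \<le> norm (l' - l)" "(norm (l' - l))\<^sup>2 \<le> norm (l' - l) powr (1 + \<beta>)"
proof -
  show "norm (l' - l) powr (1 + \<beta>) \<le> norm (l' - l)"
    using powr_mono'[of 1 "1 + \<beta>" "norm (l' - l)"] B1[OF assms] \<beta> by simp
  show "(norm (l' - l))\<^sup>2 \<le> norm (l' - l) powr (1 + \<beta>)"
    using powr_mono'[of "1 + \<beta>" 2 "norm (l' - l)"] B1[OF assms] \<beta> by (simp add: powr_numeral)
qed

lemma f_mvt:
  assumes "j \<in> {1..m}" "l \<in> B" "x \<in> {a..b}" "y \<in> {a..b}"
  shows "\<exists>z\<in>{a..b}. f j l x - f j l y = f1 j l z * (x - y) \<and> \<bar>z - y\<bar> \<le> \<bar>x - y\<bar>"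
proof -
  have *: "\<exists>z\<in>{a..b}. f j l y - f j l x = f1 j l z * (y - x) \<and> x \<le> z \<and> z \<le> y"
    if "x \<in> {a..b}" "y \<in> {a..b}" "x < y" for x y
  proof -
    have "\<exists>z\<in>{x<..<y}. f j l y - f j l x = (\<lambda>h. f1 j l z * h) (y - x)"
    proof (rule mvt_simple[OF \<open>x < y\<close>])
      fix z assume z: "x \<le> z" "z \<le> y"
      have "(f j l has_real_derivative f1 j l z) (at z within {x..y})"
        using that z by (intro DERIV_subset[OF d1[OF assms(1,2)]]) auto
      then show "(f j l has_derivative (\<lambda>h. f1 j l z * h)) (at z within {x..y})"
        by (simp add: has_field_derivative_def)
    qed
    then show ?thesis using that by force
  qed
  consider "x < y" | "x = y" | "y < x" by linarith
  then show ?thesis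
  proof cases
    case 1
    from *[OF assms(3,4) 1] obtain z where "z \<in> {a..b}" "f j l y - f j l x = f1 j l z * (y - x)" "x \<le> z" "z \<le> y" by blast
    then show ?thesis using 1 by (intro bexI[of _ z]) (auto simp: algebra_simps)
  next
    case 2
    then show ?thesis using assms by auto
  next
    case 3
    from *[OF assms(4,3) 3] obtain z where "z \<in> {a..b}" "f j l x - f j l y = f1 j l z * (x - y)" "y \<le> z" "z \<le> x" by blast
    then show ?thesis using 3 by (intro bexI[of _ z]) auto
  qed
qed

lemma f_lip:
  assumes "j \<in> {1..m}" "l \<in> B" "x \<in> {a..b}" "y \<in> {a..b}"
  shows "\<bar>f j l x - f j l y\<bar> \<le> \<gamma>2 * \<bar>x - y\<bar>"
proof -
  obtain z where "z \<in> {a..b}" "f j l x - f j l y = f1 j l z * (x - y)" using f_mvt[OF assms] by blast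
  then show ?thesis using f1_bd[OF assms(1,2), of z] by (simp add: abs_mult mult_right_mono)
qed

lemma f_lam:
  assumes "j \<in> {1..m}" "l \<in> B" "l' \<in> B" "x \<in> {a..b}"
  shows "\<bar>f j l' x - f j l x\<bar> \<le> 2 * C * norm (l' - l)"
proof -
  have "\<bar>fl j l x \<bullet> (l' - l)\<bar> \<le> C * norm (l' - l)"
    using Cauchy_Schwarz_ineq2[of "fl j l x" "l' - l"] mult_right_mono[OF fl_bd[OF assms(1,2,4)], of "norm (l' - l)"] by simp
  moreover have "C * norm (l' - l) powr (1 + \<beta>) \<le> C * norm (l' - l)"
    using norm_powr_le(1)[OF assms(2,3)] C by (rule mult_left_mono)
  ultimately show ?thesis using f_exp[OF assms] by linarith
qed

text \<open>The intermediate point of the mean value theorem is no farther from y than x is, so the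
  Lipschitz bound on the derivative gives a quadratic remainder.\<close>

lemma f_taylor:
  assumes "j \<in> {1..m}" "l \<in> B" "x \<in> {a..b}" "y \<in> {a..b}"
  shows "\<bar>f j l x - f j l y - f1 j l y * (x - y)\<bar> \<le> C * (x - y)\<^sup>2"
proof -
  obtain z where z: "z \<in> {a..b}" "f j l x - f j l y = f1 j l z * (x - y)" "\<bar>z - y\<bar> \<le> \<bar>x - y\<bar>" using f_mvt[OF assms] by blast
  have "\<bar>f j l x - f j l y - f1 j l y * (x - y)\<bar> = \<bar>f1 j l z - f1 j l y\<bar> * \<bar>x - y\<bar>"
    unfolding z(2) by (simp add: left_diff_distrib flip: abs_mult)
  also have "\<dots> \<le> (C * \<bar>x - y\<bar>) * \<bar>x - y\<bar>"
    using f1_lip[OF assms(1,2) z(1) assms(4)] mult_left_mono[OF z(3) C] by (intro mult_right_mono) auto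
  finally show ?thesis by (simp add: power2_eq_square abs_mult_self_eq mult.assoc)
qed

section \<open>Compositions: contraction and dependence on the parameter\<close>

lemma comp_word_in:
  assumes "set w \<subseteq> {1..m}" "l \<in> B" "x \<in> {a..b}"
  shows "comp_word f l w x \<in> {a..b}"
  using assms(1)
proof (induction w)
  case (Cons j w)
  then show ?case using maps[of j l] assms by simp
qed (use assms in simp)

lemma comp_word_lip:
  assumes "set w \<subseteq> {1..m}" "l \<in> B" "x \<in> {a..b}" "y \<in> {a..b}"
  shows "\<bar>comp_word f l w x - comp_word f l w y\<bar> \<le> \<gamma>2 ^ length w * \<bar>x - y\<bar>"
  using assms(1)
proof (induction w)
  case (Cons j w)
  then have w: "set w \<subseteq> {1..m}" "j \<in> {1..m}" by auto
  have "\<bar>comp_word f l (j # w) x - comp_word f l (j # w) y\<bar> \<le> \<gamma>2 * \<bar>comp_word f l w x - comp_word f l w y\<bar>"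
    using f_lip[OF w(2) assms(2) comp_word_in[OF w(1) assms(2,3)] comp_word_in[OF w(1) assms(2,4)]] by simp
  also have "\<dots> \<le> \<gamma>2 * (\<gamma>2 ^ length w * \<bar>x - y\<bar>)"
    using Cons.IH[OF w(1)] \<gamma> by (intro mult_left_mono) auto
  finally show ?case by (simp add: mult.assoc)
qed simp

text \<open>The fixed point of t -> 2 C + \<gamma>2 t, the recursion caused by one further letter;
  this makes the constant independent of the length of the word. \<open>D\<close> and
  \<open>H\<close> are fixed points of the corresponding recursions for gradients and
  remainders.\<close>

definition K1 where "K1 = 2 * C / (1 - \<gamma>2)"

lemma K1: "0 \<le> K1" "2 * C + \<gamma>2 * K1 = K1"
  unfolding K1_def using C \<gamma> by (simp_all add: field_simps)

lemma comp_word_lam: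
  assumes "set w \<subseteq> {1..m}" "l \<in> B" "l' \<in> B" "x \<in> {a..b}"
  shows "\<bar>comp_word f l' w x - comp_word f l w x\<bar> \<le> K1 * norm (l' - l)"
  using assms(1)
proof (induction w)
  case (Cons j w)
  then have w: "set w \<subseteq> {1..m}" "j \<in> {1..m}" by auto
  let ?p = "comp_word f l w x" and ?p' = "comp_word f l' w x"
  note p = comp_word_in[OF w(1) assms(2,4)] and p' = comp_word_in[OF w(1) assms(3,4)]
  have "\<bar>comp_word f l' (j # w) x - comp_word f l (j # w) x\<bar> \<le> \<bar>f j l' ?p' - f j l' ?p\<bar> + \<bar>f j l' ?p - f j l ?p\<bar>"
    by simp
  also have "\<dots> \<le> \<gamma>2 * \<bar>?p' - ?p\<bar> + 2 * C * norm (l' - l)"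
    by (intro add_mono f_lip f_lam w assms p p')
  also have "\<dots> \<le> \<gamma>2 * (K1 * norm (l' - l)) + 2 * C * norm (l' - l)"
    using Cons.IH[OF w(1)] \<gamma> C by (intro add_mono mult_left_mono) auto
  also have "\<dots> = (2 * C + \<gamma>2 * K1) * norm (l' - l)" by (simp add: algebra_simps)
  finally show ?case unfolding K1(2) .
next
  case Nil
  then show ?case using K1 by simp
qed

definition D where "D = C / (1 - \<gamma>2)"
definition H where "H = (C * K1\<^sup>2 + C * K1 + C) / (1 - \<gamma>2)"

lemma D: "0 \<le> D" "C + \<gamma>2 * D = D"
  unfolding D_def using C \<gamma> by (simp_all add: field_simps)

lemma H: "0 \<le> H" "(C * K1\<^sup>2 + C * K1 + C) + \<gamma>2 * H = H"
  unfolding H_def using C \<gamma> K1(1) by (auto simp add: field_simps)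

text \<open>The gradient obeys the chain rule along the word, and contraction by \<gamma>2 keeps
  both its norm and the remainder bounded uniformly in the length.\<close>

lemma comp_word_exp:
  assumes "set w \<subseteq> {1..m}" "l \<in> B" "x \<in> {a..b}"
  shows "\<exists>G. norm G \<le> D \<and> (\<forall>l'\<in>B. \<bar>comp_word f l' w x - comp_word f l w x - G \<bullet> (l' - l)\<bar> \<le> H * norm (l' - l) powr (1 + \<beta>))"
  using assms(1)
proof (induction w)
  case Nil
  then show ?case using D H by (intro exI[of _ 0]) simp
next
  case (Cons j w)
  then have w: "set w \<subseteq> {1..m}" "j \<in> {1..m}" by auto
  obtain G where G: "norm G \<le> D" "\<And>l'. l' \<in> B \<Longrightarrow> \<bar>comp_word f l' w x - comp_word f l w x - G \<bullet> (l' - l)\<bar> \<le> H * norm (l' - l) powr (1 + \<beta>)"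
    using Cons.IH[OF w(1)] by blast
  define p where "p = comp_word f l w x"
  have p: "p \<in> {a..b}" unfolding p_def by (rule comp_word_in[OF w(1) assms(2,3)])
  show ?case
  proof (intro exI[of _ "fl j l p + f1 j l p *\<^sub>R G"] conjI ballI)
    have "norm (fl j l p + f1 j l p *\<^sub>R G) \<le> norm (fl j l p) + \<bar>f1 j l p\<bar> * norm G"
      using norm_triangle_ineq[of "fl j l p" "f1 j l p *\<^sub>R G"] by simp
    also have "\<dots> \<le> C + \<gamma>2 * D"
      using f1_bd[OF w(2) assms(2) p] \<gamma> G by (intro add_mono mult_mono fl_bd w assms p) auto
    finally show "norm (fl j l p + f1 j l p *\<^sub>R G) \<le> D" unfolding D(2) .
  next
    fix l' assume l': "l' \<in> B"
    define p' where "p' = comp_word f l' w x"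
    have p': "p' \<in> {a..b}" unfolding p'_def by (rule comp_word_in[OF w(1) l' assms(3)])
    define n where "n = norm (l' - l)"
    have pp: "\<bar>p' - p\<bar> \<le> K1 * n" unfolding p_def p'_def n_def by (rule comp_word_lam[OF w(1) assms(2) l' assms(3)])
    have n2: "n\<^sup>2 \<le> n powr (1 + \<beta>)" unfolding n_def by (rule norm_powr_le(2)[OF assms(2) l'])
    have e1: "\<bar>f j l' p' - f j l' p - f1 j l' p * (p' - p)\<bar> \<le> C * K1\<^sup>2 * n powr (1 + \<beta>)"
    proof -
      have "(p' - p)\<^sup>2 \<le> (K1 * n)\<^sup>2" using power_mono[OF pp, of 2] by simp
      then have "C * (p' - p)\<^sup>2 \<le> C * (K1\<^sup>2 * n powr (1 + \<beta>))"
        using n2 C by (intro mult_left_mono order_trans[OF \<open>(p' - p)\<^sup>2 \<le> _\<close>]) (auto simp: power_mult_distrib intro!: mult_left_mono)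
      then show ?thesis using f_taylor[OF w(2) l' p' p] by simp
    qed
    have e2: "\<bar>(f1 j l' p - f1 j l p) * (p' - p)\<bar> \<le> C * K1 * n powr (1 + \<beta>)"
    proof -
      have "\<bar>(f1 j l' p - f1 j l p) * (p' - p)\<bar> \<le> (C * n) * (K1 * n)"
        unfolding abs_mult using f1_lam[OF w(2) assms(2) l' p] pp C by (intro mult_mono) (auto simp: n_def)
      also have "\<dots> = C * K1 * n\<^sup>2" by (simp add: power2_eq_square)
      also have "\<dots> \<le> C * K1 * n powr (1 + \<beta>)" using n2 C K1(1) by (intro mult_left_mono) auto
      finally show ?thesis .
    qed
    have e3: "\<bar>f1 j l p * (p' - p - G \<bullet> (l' - l))\<bar> \<le> \<gamma>2 * (H * n powr (1 + \<beta>))"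
      unfolding abs_mult using f1_bd[OF w(2) assms(2) p] G(2)[OF l'] \<gamma>
      by (intro mult_mono) (auto simp: p_def p'_def n_def)
    have e4: "\<bar>f j l' p - f j l p - fl j l p \<bullet> (l' - l)\<bar> \<le> C * n powr (1 + \<beta>)"
      unfolding n_def by (rule f_exp[OF w(2) assms(2) l' p])
    \<comment> \<open>The four errors are the Taylor remainder in x, the change of the derivative
      with the parameter, the inherited remainder, and the expansion of the outer map in the
      parameter. All but the inherited one make up the numerator of \<open>H\<close>.\<close>
    have "f j l' p' - f j l p - (fl j l p + f1 j l p *\<^sub>R G) \<bullet> (l' - l)
      = (f j l' p' - f j l' p - f1 j l' p * (p' - p)) + (f1 j l' p - f1 j l p) * (p' - p)
        + f1 j l p * (p' - p - G \<bullet> (l' - l)) + (f j l' p - f j l p - fl j l p \<bullet> (l' - l))"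
      by (simp add: algebra_simps)
    also have "\<bar>\<dots>\<bar> \<le> C * K1\<^sup>2 * n powr (1 + \<beta>) + C * K1 * n powr (1 + \<beta>) + \<gamma>2 * (H * n powr (1 + \<beta>)) + C * n powr (1 + \<beta>)"
      using e1 e2 e3 e4 by linarith
    also have "\<dots> = ((C * K1\<^sup>2 + C * K1 + C) + \<gamma>2 * H) * n powr (1 + \<beta>)" by (simp add: algebra_simps)
    finally show "\<bar>comp_word f l' (j # w) x - comp_word f l (j # w) x - (fl j l p + f1 j l p *\<^sub>R G) \<bullet> (l' - l)\<bar> \<le> H * norm (l' - l) powr (1 + \<beta>)"
      unfolding H(2) by (simp add: p_def p'_def n_def)
  qed
qed

section \<open>The natural projection\<close>

abbreviation P where "P \<equiv> proj f {a..b}"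

lemma a_in: "a \<in> {a..b}" "b \<in> {a..b}" using ab by auto

lemma comp_word_pref_diff:
  assumes "\<forall>n. i n \<in> {1..m}" "l \<in> B"
  shows "\<bar>comp_word f l (pref i (n + k)) a - comp_word f l (pref i n) a\<bar> \<le> \<gamma>2 ^ n * (b - a)"
proof -
  have s: "set (pref (\<lambda>k. i (k + n)) k) \<subseteq> {1..m}" using assms by (intro set_pref) auto
  let ?y = "comp_word f l (pref (\<lambda>k. i (k + n)) k) a"
  have y: "?y \<in> {a..b}" by (rule comp_word_in[OF s assms(2) a_in(1)])
  have "\<bar>comp_word f l (pref i (n + k)) a - comp_word f l (pref i n) a\<bar> \<le> \<gamma>2 ^ n * \<bar>?y - a\<bar>"
    unfolding pref_add comp_word_append
    using comp_word_lip[OF set_pref[OF assms(1), of n] assms(2) y a_in(1)] by simp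
  also have "\<dots> \<le> \<gamma>2 ^ n * (b - a)" using y \<gamma> by (intro mult_left_mono) auto
  finally show ?thesis .
qed

lemma proj_lim:
  assumes "\<forall>n. i n \<in> {1..m}" "l \<in> B"
  shows "(\<lambda>n. comp_word f l (pref i n) a) \<longlonglongrightarrow> P l i"
proof -
  have "Cauchy (\<lambda>n. comp_word f l (pref i n) a)"
  proof (rule CauchyI')
    fix e :: real assume e: "e > 0"
    have "(\<lambda>n. \<gamma>2 ^ n * (b - a)) \<longlonglongrightarrow> 0 * (b - a)"
      using \<gamma> by (intro tendsto_intros LIMSEQ_realpow_zero) auto
    then have "\<forall>\<^sub>F n in sequentially. \<gamma>2 ^ n * (b - a) < e" using e by (intro order_tendstoD(2)) auto
    then obtain M where M: "\<gamma>2 ^ M' * (b - a) < e" if "M' \<ge> M" for M' by (auto simp: eventually_sequentially)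
    show "\<exists>M. \<forall>m'\<ge>M. \<forall>n>m'. dist (comp_word f l (pref i m') a) (comp_word f l (pref i n) a) < e"
    proof (intro exI[of _ M] allI impI)
      fix m' n assume "M \<le> m'" "m' < n"
      then show "dist (comp_word f l (pref i m') a) (comp_word f l (pref i n) a) < e"
        using comp_word_pref_diff[OF assms, of m' "n - m'"] M[of m'] by (simp add: dist_real_def abs_minus_commute)
    qed
  qed
  then have "convergent (\<lambda>n. comp_word f l (pref i n) a)" by (simp add: Cauchy_convergent_iff)
  \<comment> \<open>The orbit in \<open>proj\<close> starts at \<open>Inf X\<close>, which is a for
    this interval.\<close>
  then show ?thesis unfolding proj_def using ab by (simp add: convergent_LIMSEQ_iff)
qed

lemma proj_in:
  assumes "\<forall>n. i n \<in> {1..m}" "l \<in> B"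
  shows "P l i \<in> {a..b}"
  by (rule closed_sequentially[OF closed_atLeastAtMost _ proj_lim[OF assms]])
     (intro allI comp_word_in set_pref assms a_in)

lemma proj_approx:
  assumes "\<forall>n. i n \<in> {1..m}" "l \<in> B"
  shows "\<bar>P l i - comp_word f l (pref i n) a\<bar> \<le> \<gamma>2 ^ n * (b - a)"
proof (rule LIMSEQ_le_const2)
  show "(\<lambda>k. \<bar>comp_word f l (pref i (k + n)) a - comp_word f l (pref i n) a\<bar>) \<longlonglongrightarrow> \<bar>P l i - comp_word f l (pref i n) a\<bar>"
    by (intro tendsto_intros LIMSEQ_ignore_initial_segment proj_lim assms)
  show "\<exists>N. \<forall>k\<ge>N. \<bar>comp_word f l (pref i (k + n)) a - comp_word f l (pref i n) a\<bar> \<le> \<gamma>2 ^ n * (b - a)"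
    using comp_word_pref_diff[OF assms, of n] by (auto simp: add.commute)
qed

text \<open>Self-similarity of the projection: it moves a common prefix of two sequences to the
  front, so that \<open>slope_eq\<close> can factor the difference of their projections.\<close>

lemma proj_shift:
  assumes "\<forall>n. i n \<in> {1..m}" "l \<in> B"
  shows "P l i = comp_word f l (pref i p) (P l (\<lambda>n. i (n + p)))"
proof (rule LIMSEQ_unique)
  let ?i = "\<lambda>n. i (n + p)"
  have i: "\<forall>n. ?i n \<in> {1..m}" using assms by auto
  show "(\<lambda>n. comp_word f l (pref i (n + p)) a) \<longlonglongrightarrow> P l i"
    by (intro LIMSEQ_ignore_initial_segment proj_lim assms)
  have "(\<lambda>n. comp_word f l (pref i p) (comp_word f l (pref ?i n) a) - comp_word f l (pref i p) (P l ?i)) \<longlonglongrightarrow> 0"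
  proof (rule Lim_null_comparison)
    have "(\<lambda>n. \<gamma>2 ^ p * \<bar>comp_word f l (pref ?i n) a - P l ?i\<bar>) \<longlonglongrightarrow> \<gamma>2 ^ p * \<bar>P l ?i - P l ?i\<bar>"
      by (intro tendsto_intros proj_lim i assms)
    then show "(\<lambda>n. \<gamma>2 ^ p * \<bar>comp_word f l (pref ?i n) a - P l ?i\<bar>) \<longlonglongrightarrow> 0" by simp
    show "\<forall>\<^sub>F n in sequentially. norm (comp_word f l (pref i p) (comp_word f l (pref ?i n) a) - comp_word f l (pref i p) (P l ?i))
       \<le> \<gamma>2 ^ p * \<bar>comp_word f l (pref ?i n) a - P l ?i\<bar>"
      using comp_word_lip[OF set_pref[OF assms(1), of p] assms(2) comp_word_in[OF set_pref[OF i] assms(2) a_in(1)] proj_in[OF i assms(2)]]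
      by (intro always_eventually) auto
  qed
  then have "(\<lambda>n. comp_word f l (pref i p) (comp_word f l (pref ?i n) a)) \<longlonglongrightarrow> comp_word f l (pref i p) (P l ?i)"
    by (rule LIM_zero_cancel)
  then show "(\<lambda>n. comp_word f l (pref i (n + p)) a) \<longlonglongrightarrow> comp_word f l (pref i p) (P l ?i)"
    by (simp add: pref_add comp_word_append add.commute[of _ p])
qed

lemma proj_lam:
  assumes "\<forall>n. i n \<in> {1..m}" "l \<in> B" "l' \<in> B"
  shows "\<bar>P l' i - P l i\<bar> \<le> K1 * norm (l' - l)"
proof (rule LIMSEQ_le_const2)
  show "(\<lambda>n. \<bar>comp_word f l' (pref i n) a - comp_word f l (pref i n) a\<bar>) \<longlonglongrightarrow> \<bar>P l' i - P l i\<bar>"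
    by (intro tendsto_intros proj_lim assms)
qed (use comp_word_lam[OF set_pref[OF assms(1)] assms(2,3) a_in(1)] in blast)

text \<open>The gradients of the finite compositions stay in a compact ball, so they have a cluster point,
  which inherits the uniform first-order expansion.\<close>

lemma proj_exp:
  assumes "\<forall>n. i n \<in> {1..m}" "l \<in> B"
  shows "\<exists>G. norm G \<le> D \<and> (\<forall>l'\<in>B. \<bar>P l' i - P l i - G \<bullet> (l' - l)\<bar> \<le> H * norm (l' - l) powr (1 + \<beta>))"
proof -
  have "\<forall>n. \<exists>G. norm G \<le> D \<and> (\<forall>l'\<in>B. \<bar>comp_word f l' (pref i n) a - comp_word f l (pref i n) a - G \<bullet> (l' - l)\<bar> \<le> H * norm (l' - l) powr (1 + \<beta>))"
    by (intro allI comp_word_exp set_pref assms a_in)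
  then obtain G where G: "\<And>n. norm (G n) \<le> D"
    "\<And>n l'. l' \<in> B \<Longrightarrow> \<bar>comp_word f l' (pref i n) a - comp_word f l (pref i n) a - G n \<bullet> (l' - l)\<bar> \<le> H * norm (l' - l) powr (1 + \<beta>)"
    by metis
  have "seq_compact (cball (0::'a) D)" by (simp add: compact_imp_seq_compact)
  moreover have "\<forall>n. G n \<in> cball 0 D" using G by simp
  ultimately obtain g r where g: "g \<in> cball 0 D" "strict_mono r" "(G \<circ> r) \<longlonglongrightarrow> g"
    unfolding seq_compact_def by metis
  show ?thesis
  proof (intro exI[of _ g] conjI ballI)
    show "norm g \<le> D" using g by simp
    fix l' assume l': "l' \<in> B"
    show "\<bar>P l' i - P l i - g \<bullet> (l' - l)\<bar> \<le> H * norm (l' - l) powr (1 + \<beta>)"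
    proof (rule LIMSEQ_le_const2)
      have lim: "(\<lambda>n. comp_word f q (pref i (r n)) a) \<longlonglongrightarrow> P q i" if "q \<in> B" for q
        using LIMSEQ_subseq_LIMSEQ[OF proj_lim[OF assms(1) that] g(2)] by (simp add: o_def)
      have lim2: "(\<lambda>n. G (r n)) \<longlonglongrightarrow> g" using g(3) by (simp add: o_def)
      show "(\<lambda>n. \<bar>comp_word f l' (pref i (r n)) a - comp_word f l (pref i (r n)) a - G (r n) \<bullet> (l' - l)\<bar>) \<longlonglongrightarrow> \<bar>P l' i - P l i - g \<bullet> (l' - l)\<bar>"
        by (intro tendsto_intros lim lim2 l' assms)
    qed (use G(2)[OF l'] in blast)
  qed
qed

section \<open>Divided differences and bounded distortion\<close>

definition divdiff where "divdiff j l x y = integral {0..1} (\<lambda>t. f1 j l (y + t * (x - y)))"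

lemma segment_in:
  assumes "x \<in> {a..b}" "y \<in> {a..b}" "t \<in> {0..1::real}"
  shows "y + t * (x - y) \<in> {a..b}"
proof -
  have "y + t * (x - y) = (1 - t) *\<^sub>R y + t *\<^sub>R x" by (simp add: algebra_simps)
  then show ?thesis using convexD_alt[OF convex_real_interval(5) assms(2,1), of t] assms(3) by simp
qed

lemma f1_segment_integrable:
  assumes "j \<in> {1..m}" "l \<in> B" "x \<in> {a..b}" "y \<in> {a..b}"
  shows "(\<lambda>t. f1 j l (y + t * (x - y))) integrable_on {0..1}"
proof (rule integrable_continuous_real)
  have "C-lipschitz_on {a..b} (f1 j l)"
    using f1_lip[OF assms(1,2)] C by (auto simp: lipschitz_on_def dist_real_def)
  then have "continuous_on {a..b} (f1 j l)" by (rule lipschitz_on_continuous_on)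
  then show "continuous_on {0..1} (\<lambda>t. f1 j l (y + t * (x - y)))"
    by (rule continuous_on_compose2) (use segment_in[OF assms(3,4)] in \<open>auto intro!: continuous_intros\<close>)
qed

lemma divdiff_eq:
  assumes "j \<in> {1..m}" "l \<in> B" "x \<in> {a..b}" "y \<in> {a..b}"
  shows "f j l x - f j l y = divdiff j l x y * (x - y)"
proof -
  have "((\<lambda>t. f1 j l (y + t * (x - y)) * (x - y)) has_integral (f j l (y + 1 * (x - y)) - f j l (y + 0 * (x - y)))) {0..1}"
  proof (rule fundamental_theorem_of_calculus)
    fix t :: real assume t: "t \<in> {0..1}"
    have "((f j l \<circ> (\<lambda>t. y + t * (x - y))) has_real_derivative f1 j l (y + t * (x - y)) * (x - y)) (at t within {0..1})"
    proof (rule DERIV_image_chain)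
      show "(f j l has_real_derivative f1 j l (y + t * (x - y))) (at (y + t * (x - y)) within (\<lambda>t. y + t * (x - y)) ` {0..1})"
        using segment_in[OF assms(3,4)] t by (intro DERIV_subset[OF d1[OF assms(1,2)]]) auto
      show "((\<lambda>t. y + t * (x - y)) has_real_derivative x - y) (at t within {0..1})"
        by (auto intro!: derivative_eq_intros)
    qed
    then show "((\<lambda>t. f j l (y + t * (x - y))) has_vector_derivative f1 j l (y + t * (x - y)) * (x - y)) (at t within {0..1})"
      by (simp add: has_real_derivative_iff_has_vector_derivative o_def)
  qed simp
  then have "integral {0..1} (\<lambda>t. f1 j l (y + t * (x - y)) * (x - y)) = f j l x - f j l y"
    by (auto dest: integral_unique)
  then show ?thesis unfolding divdiff_def by simp
qed

text \<open>An average of derivatives could be small by cancellation; the mean value theorem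
  identifies it with a single value of the derivative, which has both bounds.\<close>

lemma divdiff_bd:
  assumes "j \<in> {1..m}" "l \<in> B" "x \<in> {a..b}" "y \<in> {a..b}"
  shows "\<gamma>1 \<le> \<bar>divdiff j l x y\<bar>" "\<bar>divdiff j l x y\<bar> \<le> \<gamma>2"
proof -
  have "\<exists>z\<in>{a..b}. divdiff j l x y = f1 j l z"
  proof (cases "x = y")
    case True
    then show ?thesis using assms unfolding divdiff_def by auto
  next
    case False
    then show ?thesis using f_mvt[OF assms] divdiff_eq[OF assms] by auto
  qed
  then show "\<gamma>1 \<le> \<bar>divdiff j l x y\<bar>" "\<bar>divdiff j l x y\<bar> \<le> \<gamma>2" using f1_bd[OF assms(1,2)] by auto
qed

text \<open>This bound, valid up to and across the diagonal, is the reason for the integral form of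
  \<open>divdiff\<close>: a difference quotient has no value at x = y and shows no such regularity
  near it.\<close>

lemma divdiff_lip:
  assumes j: "j \<in> {1..m}" and l: "l \<in> B" "l' \<in> B" and xy: "x \<in> {a..b}" "y \<in> {a..b}" "x' \<in> {a..b}" "y' \<in> {a..b}"
  shows "\<bar>divdiff j l x y - divdiff j l' x' y'\<bar> \<le> C * (norm (l - l') + \<bar>x - x'\<bar> + \<bar>y - y'\<bar>)"
proof -
  let ?R = "C * (norm (l - l') + \<bar>x - x'\<bar> + \<bar>y - y'\<bar>)"
  have "norm (integral {0..1} (\<lambda>t. f1 j l (y + t * (x - y)) - f1 j l' (y' + t * (x' - y')))) \<le> integral {0..1} (\<lambda>t::real. ?R)"
  proof (rule integral_norm_bound_integral)
    fix t :: real assume t: "t \<in> {0..1}"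
    let ?z = "y + t * (x - y)" and ?z' = "y' + t * (x' - y')"
    have z: "?z \<in> {a..b}" "?z' \<in> {a..b}" using segment_in t xy by auto
    have "?z - ?z' = (1 - t) * (y - y') + t * (x - x')" by (simp add: algebra_simps)
    also have "\<bar>\<dots>\<bar> \<le> (1 - t) * \<bar>y - y'\<bar> + t * \<bar>x - x'\<bar>"
      using t by (intro order_trans[OF abs_triangle_ineq]) (simp add: abs_mult)
    also have "\<dots> \<le> 1 * \<bar>y - y'\<bar> + 1 * \<bar>x - x'\<bar>" using t by (intro add_mono mult_right_mono) auto
    finally have "C * \<bar>?z - ?z'\<bar> \<le> C * (\<bar>x - x'\<bar> + \<bar>y - y'\<bar>)" using C by (intro mult_left_mono) auto
    moreover have "\<bar>f1 j l ?z - f1 j l ?z'\<bar> \<le> C * \<bar>?z - ?z'\<bar>" by (intro f1_lip j l z)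
    moreover have "\<bar>f1 j l ?z' - f1 j l' ?z'\<bar> \<le> C * norm (l - l')" by (intro f1_lam j l z)
    ultimately show "norm (f1 j l ?z - f1 j l' ?z') \<le> ?R" by (simp add: algebra_simps)
  next
    show "(\<lambda>t. f1 j l (y + t * (x - y)) - f1 j l' (y' + t * (x' - y'))) integrable_on {0..1}"
      by (intro Henstock_Kurzweil_Integration.integrable_diff f1_segment_integrable j l xy)
  qed (rule integrable_const_ivl)
  then show ?thesis unfolding divdiff_def
    using f1_segment_integrable[OF j l(1) xy(1,2)] f1_segment_integrable[OF j l(2) xy(3,4)]
    by (simp add: Henstock_Kurzweil_Integration.integral_diff)
qed

text \<open>The divided difference of the whole composition as a product over letters, the form in
  which distortion estimates multiply.\<close>

primrec slope :: "nat list \<Rightarrow> 'a \<Rightarrow> real \<Rightarrow> real \<Rightarrow> real" where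
  "slope [] l x y = 1"
| "slope (j # w) l x y = divdiff j l (comp_word f l w x) (comp_word f l w y) * slope w l x y"

lemma slope_eq:
  assumes "set w \<subseteq> {1..m}" "l \<in> B" "x \<in> {a..b}" "y \<in> {a..b}"
  shows "comp_word f l w x - comp_word f l w y = slope w l x y * (x - y)"
  using assms(1)
proof (induction w)
  case (Cons j w)
  then show ?case
    using divdiff_eq[OF _ assms(2) comp_word_in[OF _ assms(2,3)] comp_word_in[OF _ assms(2,4)], of j w w] by simp
qed simp

lemma slope_bd:
  assumes "set w \<subseteq> {1..m}" "l \<in> B" "x \<in> {a..b}" "y \<in> {a..b}"
  shows "0 < \<bar>slope w l x y\<bar>" "\<bar>slope w l x y\<bar> \<le> 1"
proof -
  have "0 < \<bar>slope w l x y\<bar> \<and> \<bar>slope w l x y\<bar> \<le> 1" using assms(1)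
  proof (induction w)
    case (Cons j w)
    then have w: "set w \<subseteq> {1..m}" "j \<in> {1..m}" by auto
    let ?q = "divdiff j l (comp_word f l w x) (comp_word f l w y)"
    have q: "\<gamma>1 \<le> \<bar>?q\<bar>" "\<bar>?q\<bar> \<le> \<gamma>2"
      using divdiff_bd[OF w(2) assms(2) comp_word_in[OF w(1) assms(2,3)] comp_word_in[OF w(1) assms(2,4)]] by auto
    then have "\<bar>?q\<bar> * \<bar>slope w l x y\<bar> \<le> 1 * 1"
      using Cons.IH[OF w(1)] \<gamma> by (intro mult_mono) auto
    moreover have "0 < \<bar>?q\<bar> * \<bar>slope w l x y\<bar>" using q \<gamma> Cons.IH[OF w(1)] by (intro mult_pos_pos) auto
    ultimately show ?case by (simp add: abs_mult)
  qed simp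
  then show "0 < \<bar>slope w l x y\<bar>" "\<bar>slope w l x y\<bar> \<le> 1" by auto
qed

definition Kd where "Kd = C / \<gamma>1 * (1 + 2 * K1 + 1 / (1 - \<gamma>2))"

lemma Kd: "0 \<le> Kd" unfolding Kd_def using C \<gamma> K1(1) by simp

text \<open>Per letter, the ratio of two divided differences is at most 1 + error / \<gamma>1, hence
  at most the exponential of the error. Differences in x and y shrink geometrically along the word
  and have a bounded sum, whereas a change of the parameter enters afresh at each letter and
  produces the factor \<open>length w\<close>.\<close>

lemma slope_distortion:
  assumes w: "set w \<subseteq> {1..m}" and l: "l \<in> B" "l' \<in> B" and xy: "x \<in> {a..b}" "y \<in> {a..b}" "x' \<in> {a..b}" "y' \<in> {a..b}"
  shows "\<bar>slope w l x y\<bar> \<le> exp (Kd * (real (length w) * norm (l - l') + \<bar>x - x'\<bar> + \<bar>y - y'\<bar>)) * \<bar>slope w l' x' y'\<bar>"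
proof -
  let ?d = "\<bar>x - x'\<bar> + \<bar>y - y'\<bar>"
  let ?S = "\<lambda>n. \<Sum>i<n. \<gamma>2 ^ i"
  let ?E = "\<lambda>n. C / \<gamma>1 * ((1 + 2 * K1) * (real n * norm (l - l')) + ?S n * ?d)"
  have "\<bar>slope w l x y\<bar> \<le> exp (?E (length w)) * \<bar>slope w l' x' y'\<bar>"
    using w
  proof (induction w)
    case (Cons j w)
    then have w: "set w \<subseteq> {1..m}" "j \<in> {1..m}" by auto
    let ?p = "\<lambda>l x. comp_word f l w x"
    let ?q = "divdiff j l (?p l x) (?p l y)" and ?q' = "divdiff j l' (?p l' x') (?p l' y')"
    note in1 = comp_word_in[OF w(1)]
    have pd: "\<bar>?p l x - ?p l' x'\<bar> \<le> \<gamma>2 ^ length w * \<bar>x - x'\<bar> + K1 * norm (l - l')" if "x \<in> {a..b}" "x' \<in> {a..b}" for x x'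
      using comp_word_lip[OF w(1) l(1) that] comp_word_lam[OF w(1) l(2,1) that(2)] by linarith
    have "\<bar>?q - ?q'\<bar> \<le> C * (norm (l - l') + \<bar>?p l x - ?p l' x'\<bar> + \<bar>?p l y - ?p l' y'\<bar>)"
      by (intro divdiff_lip w l in1 xy)
    also have "\<dots> \<le> C * ((1 + 2 * K1) * norm (l - l') + \<gamma>2 ^ length w * ?d)"
      using pd[OF xy(1,3)] pd[OF xy(2,4)] C by (intro mult_left_mono) (auto simp: algebra_simps)
    finally have dq: "\<bar>?q - ?q'\<bar> \<le> C * ((1 + 2 * K1) * norm (l - l') + \<gamma>2 ^ length w * ?d)" (is "_ \<le> ?c") .
    have q': "\<gamma>1 \<le> \<bar>?q'\<bar>" by (intro divdiff_bd w l in1 xy)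
    have c0: "0 \<le> ?c" using dq by linarith
    have "\<bar>?q\<bar> \<le> \<bar>?q'\<bar> + ?c" using dq by linarith
    also have "?c \<le> ?c / \<gamma>1 * \<bar>?q'\<bar>"
      using mult_left_mono[OF q', of "?c / \<gamma>1"] c0 \<gamma> by simp
    also have "\<bar>?q'\<bar> + ?c / \<gamma>1 * \<bar>?q'\<bar> = (1 + ?c / \<gamma>1) * \<bar>?q'\<bar>" by (simp add: algebra_simps)
    also have "\<dots> \<le> exp (?c / \<gamma>1) * \<bar>?q'\<bar>" by (intro mult_right_mono exp_ge_add_one_self) auto
    finally have q: "\<bar>?q\<bar> \<le> exp (?c / \<gamma>1) * \<bar>?q'\<bar>" by simp
    have "\<bar>slope (j # w) l x y\<bar> \<le> (exp (?c / \<gamma>1) * \<bar>?q'\<bar>) * (exp (?E (length w)) * \<bar>slope w l' x' y'\<bar>)"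
      unfolding slope.simps abs_mult by (intro mult_mono q Cons.IH w) auto
    also have "\<dots> = exp (?c / \<gamma>1 + ?E (length w)) * \<bar>slope (j # w) l' x' y'\<bar>"
      by (simp add: abs_mult exp_add)
    also have "?c / \<gamma>1 + ?E (length w) = ?E (length (j # w))"
      by (simp add: algebra_simps add_divide_distrib)
    finally show ?case .
  qed simp
  also have "?E (length w) \<le> Kd * (real (length w) * norm (l - l') + ?d)"
  proof -
    have "?S (length w) \<le> 1 / (1 - \<gamma>2)"
      using \<gamma> by (simp add: sum_gp_strict divide_right_mono)
    then have "?S (length w) \<le> 1 + 2 * K1 + 1 / (1 - \<gamma>2)" using K1(1) by linarith
    from mult_right_mono[OF this, of ?d]
    have "?S (length w) * ?d \<le> (1 + 2 * K1 + 1 / (1 - \<gamma>2)) * ?d" by simp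
    moreover have "(1 + 2 * K1) * (real (length w) * norm (l - l')) \<le> (1 + 2 * K1 + 1 / (1 - \<gamma>2)) * (real (length w) * norm (l - l'))"
      using \<gamma> by (intro mult_right_mono) auto
    ultimately have "(1 + 2 * K1) * (real (length w) * norm (l - l')) + ?S (length w) * ?d
      \<le> (1 + 2 * K1 + 1 / (1 - \<gamma>2)) * (real (length w) * norm (l - l')) + (1 + 2 * K1 + 1 / (1 - \<gamma>2)) * ?d"
      by linarith
    then have "?E (length w) \<le> C / \<gamma>1 * ((1 + 2 * K1 + 1 / (1 - \<gamma>2)) * (real (length w) * norm (l - l')) + (1 + 2 * K1 + 1 / (1 - \<gamma>2)) * ?d)"
      using C \<gamma> by (intro mult_left_mono) auto
    then show ?thesis unfolding Kd_def by (simp add: algebra_simps)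
  qed
  finally show ?thesis by (simp add: add.assoc mult_right_mono)
qed

text \<open>At a fixed parameter the distortion bound loses its length term, so the slope at any one
  pair of points controls the diameter of the image. This connects the slopes with the symbolic
  metric.\<close>

lemma diameter_le_slope:
  assumes w: "set w \<subseteq> {1..m}" and l: "l \<in> B" and xy: "x \<in> {a..b}" "y \<in> {a..b}"
  shows "diameter (comp_word f l w ` {a..b}) \<le> exp (Kd * (2 * (b - a))) * (b - a) * \<bar>slope w l x y\<bar>"
proof (rule diameter_le)
  show "comp_word f l w ` {a..b} \<noteq> {} \<or> 0 \<le> exp (Kd * (2 * (b - a))) * (b - a) * \<bar>slope w l x y\<bar>"
    using ab by auto
  fix p q assume "p \<in> comp_word f l w ` {a..b}" "q \<in> comp_word f l w ` {a..b}"
  then obtain x' y' where xy': "x' \<in> {a..b}" "y' \<in> {a..b}" "p = comp_word f l w x'" "q = comp_word f l w y'" by auto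
  have "norm (p - q) = \<bar>slope w l x' y'\<bar> * \<bar>x' - y'\<bar>"
    unfolding xy' slope_eq[OF w l xy'(1,2)] by (simp add: abs_mult)
  also have "\<dots> \<le> (exp (Kd * (real (length w) * norm (l - l) + \<bar>x' - x\<bar> + \<bar>y' - y\<bar>)) * \<bar>slope w l x y\<bar>) * (b - a)"
    using xy' by (intro mult_mono slope_distortion w l xy) auto
  also have "\<dots> \<le> (exp (Kd * (2 * (b - a))) * \<bar>slope w l x y\<bar>) * (b - a)"
    using xy xy' ab Kd by (intro mult_right_mono) (auto intro!: mult_left_mono)
  finally show "norm (p - q) \<le> exp (Kd * (2 * (b - a))) * (b - a) * \<bar>slope w l x y\<bar>" by (simp add: ac_simps)
qed

lemma diameter_le_pow:
  assumes w: "set w \<subseteq> {1..m}" and l: "l \<in> B"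
  shows "diameter (comp_word f l w ` {a..b}) \<le> \<gamma>2 ^ length w * (b - a)"
proof (rule diameter_le)
  show "comp_word f l w ` {a..b} \<noteq> {} \<or> 0 \<le> \<gamma>2 ^ length w * (b - a)"
    using ab by auto
  fix p q assume "p \<in> comp_word f l w ` {a..b}" "q \<in> comp_word f l w ` {a..b}"
  then obtain x' y' where xy': "x' \<in> {a..b}" "y' \<in> {a..b}" "p = comp_word f l w x'" "q = comp_word f l w y'" by auto
  have "\<gamma>2 ^ length w * \<bar>x' - y'\<bar> \<le> \<gamma>2 ^ length w * (b - a)"
    using xy' \<gamma> by (intro mult_left_mono) auto
  then show "norm (p - q) \<le> \<gamma>2 ^ length w * (b - a)"
    using comp_word_lip[OF w l xy'(1,2)] xy'(3,4) by simp
qed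

end

section \<open>Transversality\<close>

lemma holder_continuous_on:
  fixes h :: "'a::real_normed_vector \<Rightarrow> real"
  assumes "\<And>x y. x \<in> S \<Longrightarrow> y \<in> S \<Longrightarrow> \<bar>h x - h y\<bar> \<le> K * norm (x - y) powr s" "0 < s"
  shows "continuous_on S h"
  unfolding continuous_on_def
proof -
  show "\<forall>x\<in>S. (h \<longlongrightarrow> h x) (at x within S)"
  proof
    fix x assume x: "x \<in> S"
    have "((\<lambda>y. K * norm (y - x) powr s) \<longlongrightarrow> K * norm (x - x) powr s) (at x within S)"
      using assms(2) by (intro tendsto_intros) auto
    then have "((\<lambda>y. K * norm (y - x) powr s) \<longlongrightarrow> 0) (at x within S)" by simp
    moreover have "\<forall>\<^sub>F y in at x within S. norm (h y - h x) \<le> K * norm (y - x) powr s"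
      using assms(1)[OF _ x] by (auto simp: eventually_at_filter)
    ultimately have "((\<lambda>y. h y - h x) \<longlongrightarrow> 0) (at x within S)"
      by (rule Lim_null_comparison[rotated])
    then show "(h \<longlongrightarrow> h x) (at x within S)" by (rule LIM_zero_cancel)
  qed
qed

text \<open>Converts a ratio bound exp x into a difference bound linear in x.\<close>

lemma exp_minus_one_le: "exp (x::real) - 1 \<le> x * exp x"
proof -
  have "1 - x \<le> exp (- x)" using exp_ge_add_one_self[of "- x"] by simp
  then have "(1 - x) * exp x \<le> exp (- x) * exp x" by (intro mult_right_mono) auto
  then show ?thesis by (simp add: left_diff_distrib flip: exp_add)
qed

lemma norm_integral_le_ball:
  fixes F :: "'a::euclidean_space \<Rightarrow> real"
  assumes [measurable]: "F \<in> borel_measurable borel" and S: "bounded S" "S \<in> sets borel"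
    and M: "\<And>l. \<bar>F l\<bar> \<le> M" and supp: "\<And>l. l \<notin> S \<Longrightarrow> F l = 0"
  shows "integrable lborel F" "\<bar>\<integral>l. F l \<partial>lborel\<bar> \<le> measure lborel S * M"
proof -
  have intS: "integrable lborel (\<lambda>l. indicator S l *\<^sub>R M)"
    using emeasure_bounded_finite[OF S(1)] S(2)
    by (intro integrable_scaleR_left integrable_real_indicator) (auto simp: top.not_eq_extremum)
  have le: "norm (F l) \<le> indicator S l *\<^sub>R M" for l
    using M[of l] supp[of l] by (auto simp: indicator_def)
  show i: "integrable lborel F"
    by (rule Bochner_Integration.integrable_bound[OF intS]) (use le in \<open>auto intro!: AE_I2 order_trans[OF _ abs_ge_self]\<close>)
  have "norm (\<integral>l. F l \<partial>lborel) \<le> (\<integral>l. norm (F l) \<partial>lborel)" by (rule integral_norm_bound)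
  also have "\<dots> \<le> (\<integral>l. indicator S l *\<^sub>R M \<partial>lborel)"
    using i intS le by (intro integral_mono) auto
  finally show "\<bar>\<integral>l. F l \<partial>lborel\<bar> \<le> measure lborel S * M" using S(2) by simp
qed

lemma fmeasurable_lborel_cball: "cball (x::'a::euclidean_space) r \<in> fmeasurable lborel"
  using emeasure_bounded_finite[OF bounded_cball, of x r] by (intro fmeasurableI) auto

text \<open>Transversality is stated at the centre of the ball; \<open>transversal_direction\<close>
  spreads it over a smaller ball whose radius depends on the remainder constant
  \<open>H\<close>.\<close>

locale transversal_ifs = param_ifs a b m "ball l0 R" f f1 fl C \<gamma>1 \<gamma>2 \<beta>
  for a b :: real and m :: nat and l0 :: "'a::euclidean_space" and R :: real
    and f f1 :: "nat \<Rightarrow> 'a \<Rightarrow> real \<Rightarrow> real" and fl :: "nat \<Rightarrow> 'a \<Rightarrow> real \<Rightarrow> 'a"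
    and C \<gamma>1 \<gamma>2 \<beta> :: real +
  fixes \<eta> :: real
  assumes R: "0 < R" and \<eta>: "0 < \<eta>"
    and trans: "\<And>i j. \<forall>n. i n \<in> {1..m} \<Longrightarrow> \<forall>n. j n \<in> {1..m} \<Longrightarrow> i 0 \<noteq> j 0 \<Longrightarrow> \<bar>P l0 i - P l0 j\<bar> < \<eta> \<Longrightarrow>
       (\<exists>g. ((\<lambda>l'. P l' i - P l' j) has_derivative (\<lambda>h. g \<bullet> h)) (at l0) \<and> \<eta> \<le> norm g)"
begin

lemma l0_in: "l0 \<in> ball l0 R" using R by simp

lemma diff_exp:
  assumes "\<forall>n. i n \<in> {1..m}" "\<forall>n. j n \<in> {1..m}" "l \<in> ball l0 R"
  shows "\<exists>G. \<forall>l'\<in>ball l0 R. \<bar>(P l' i - P l' j) - (P l i - P l j) - G \<bullet> (l' - l)\<bar> \<le> 2 * H * norm (l' - l) powr (1 + \<beta>)"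
proof -
  obtain G1 where G1: "\<And>l'. l' \<in> ball l0 R \<Longrightarrow> \<bar>P l' i - P l i - G1 \<bullet> (l' - l)\<bar> \<le> H * norm (l' - l) powr (1 + \<beta>)"
    using proj_exp[OF assms(1,3)] by blast
  obtain G2 where G2: "\<And>l'. l' \<in> ball l0 R \<Longrightarrow> \<bar>P l' j - P l j - G2 \<bullet> (l' - l)\<bar> \<le> H * norm (l' - l) powr (1 + \<beta>)"
    using proj_exp[OF assms(2,3)] by blast
  show ?thesis
  proof (intro exI[of _ "G1 - G2"] ballI)
    fix l' assume "l' \<in> ball l0 R"
    from G1[OF this] G2[OF this]
    show "\<bar>(P l' i - P l' j) - (P l i - P l j) - (G1 - G2) \<bullet> (l' - l)\<bar> \<le> 2 * H * norm (l' - l) powr (1 + \<beta>)"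
      by (simp add: inner_diff_left)
  qed
qed

text \<open>Comparing the expansions at l0 and at l along the three points l0, l, l + R1 e
  gives the Hoelder continuity of the gradient.\<close>

lemma transversal_direction:
  assumes i: "\<forall>n. i n \<in> {1..m}" and j: "\<forall>n. j n \<in> {1..m}" and ij: "i 0 \<noteq> j 0" "\<bar>P l0 i - P l0 j\<bar> < \<eta>"
    and R1: "0 < R1" "2 * R1 < R" "48 * H * R1 powr \<beta> \<le> \<eta>"
  shows "\<exists>e. norm e = 1 \<and> (\<forall>l\<in>ball l0 R1. \<exists>h1. \<eta> / 2 \<le> \<bar>h1\<bar> \<and>
     (\<forall>s. l + s *\<^sub>R e \<in> ball l0 R1 \<longrightarrow>
        \<eta> / 2 * \<bar>s\<bar> \<le> \<bar>(P (l + s *\<^sub>R e) i - P (l + s *\<^sub>R e) j) - (P l i - P l j)\<bar> \<and>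
        \<bar>(P (l + s *\<^sub>R e) i - P (l + s *\<^sub>R e) j) - (P l i - P l j) - h1 * s\<bar> \<le> 2 * H * \<bar>s\<bar> powr (1 + \<beta>)))"
proof -
  let ?h = "\<lambda>l. P l i - P l j"
  obtain G0 where G0: "\<And>l'. l' \<in> ball l0 R \<Longrightarrow> \<bar>?h l' - ?h l0 - G0 \<bullet> (l' - l0)\<bar> \<le> 2 * H * norm (l' - l0) powr (1 + \<beta>)"
    using diff_exp[OF i j l0_in] by blast
  obtain g where g: "(?h has_derivative (\<lambda>h. g \<bullet> h)) (at l0)" "\<eta> \<le> norm g"
    using trans[OF i j ij] by blast
  \<comment> \<open>The gradient supplied by transversality must be the one in the uniform
    expansion; uniqueness of the derivative at the interior point l0 identifies the two.\<close>
  have "(?h has_derivative (\<lambda>h. G0 \<bullet> h)) (at l0)"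
  proof (rule has_derivativeI_sandwich[OF R])
    show "bounded_linear (\<lambda>h. G0 \<bullet> h)" by (rule bounded_linear_inner_right)
    fix y assume y: "y \<noteq> l0" "dist y l0 < R"
    then have "\<bar>?h y - ?h l0 - G0 \<bullet> (y - l0)\<bar> \<le> 2 * H * norm (y - l0) powr (1 + \<beta>)"
      by (intro G0) (simp add: dist_commute)
    then show "norm (?h y - ?h l0 - G0 \<bullet> (y - l0)) / norm (y - l0) \<le> 2 * H * norm (y - l0) powr \<beta>"
      using y by (simp add: powr_add divide_le_eq ac_simps)
  next
    have "((\<lambda>y. 2 * H * norm (y - l0) powr \<beta>) \<longlongrightarrow> 2 * H * norm (l0 - l0) powr \<beta>) (at l0)"
      using \<beta> by (intro tendsto_intros) auto
    then show "((\<lambda>y. 2 * H * norm (y - l0) powr \<beta>) \<longlongrightarrow> 0) (at l0)" by simp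
  qed
  then have "(\<lambda>h. g \<bullet> h) = (\<lambda>h. G0 \<bullet> h)" using g(1) by (rule has_derivative_unique[rotated])
  then have "g = G0" by (simp add: fun_eq_iff vector_eq_rdot)
  then have G0\<eta>: "\<eta> \<le> norm G0" using g by simp
  define e where "e = (1 / norm G0) *\<^sub>R G0"
  have e: "norm e = 1" and G0e: "\<eta> \<le> G0 \<bullet> e"
    using G0\<eta> \<eta> by (auto simp: e_def power2_norm_eq_inner[symmetric] power2_eq_square)
  show ?thesis
  proof (intro exI[of _ e] conjI ballI e)
    fix l assume l: "l \<in> ball l0 R1"
    then have lR: "l \<in> ball l0 R" using R1 by simp
    obtain G where G: "\<And>l'. l' \<in> ball l0 R \<Longrightarrow> \<bar>?h l' - ?h l - G \<bullet> (l' - l)\<bar> \<le> 2 * H * norm (l' - l) powr (1 + \<beta>)"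
      using diff_exp[OF i j lR] by blast
    \<comment> \<open>The third point, at distance R1 from l in the direction e; the larger ball of
      radius R contains it because 2 R1 < R.\<close>
    define q where "q = l + R1 *\<^sub>R e"
    have nl: "norm (l - l0) \<le> R1" using l by (simp add: dist_norm norm_minus_commute)
    have nq: "norm (q - l0) \<le> 2 * R1"
      using norm_triangle_ineq[of "l - l0" "R1 *\<^sub>R e"] nl e R1 by (simp add: q_def algebra_simps)
    then have qR: "q \<in> ball l0 R" using R1 by (simp add: dist_norm norm_minus_commute)
    define Z where "Z = R1 powr (1 + \<beta>)"
    have Z: "0 \<le> Z" "Z = R1 * R1 powr \<beta>" unfolding Z_def using R1 by (simp_all add: powr_add)
    have two: "(2 * R1) powr (1 + \<beta>) \<le> 4 * Z"
      using powr_mono[of "1 + \<beta>" 2 2] \<beta> R1 by (simp add: Z_def powr_mult powr_numeral mult_right_mono)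
    have a1: "\<bar>?h q - ?h l0 - G0 \<bullet> (q - l0)\<bar> \<le> 8 * H * Z"
    proof -
      have "norm (q - l0) powr (1 + \<beta>) \<le> (2 * R1) powr (1 + \<beta>)" using nq \<beta> by (intro powr_mono2) auto
      then have "2 * H * norm (q - l0) powr (1 + \<beta>) \<le> 2 * H * (4 * Z)" using two H(1) by (intro mult_left_mono) auto
      then show ?thesis using G0[OF qR] by linarith
    qed
    have a2: "\<bar>?h l - ?h l0 - G0 \<bullet> (l - l0)\<bar> \<le> 2 * H * Z"
    proof -
      have "norm (l - l0) powr (1 + \<beta>) \<le> Z" unfolding Z_def using nl \<beta> by (intro powr_mono2) auto
      then have "2 * H * norm (l - l0) powr (1 + \<beta>) \<le> 2 * H * Z" using H(1) by (intro mult_left_mono) auto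
      then show ?thesis using G0[OF lR] by linarith
    qed
    have a3: "\<bar>?h q - ?h l - G \<bullet> (q - l)\<bar> \<le> 2 * H * Z"
      using G[OF qR] e R1 by (simp add: q_def Z_def)
    have "G0 \<bullet> (q - l0) - G0 \<bullet> (l - l0) = R1 * (G0 \<bullet> e)" "G \<bullet> (q - l) = R1 * (G \<bullet> e)"
      by (simp_all add: q_def inner_diff_right inner_add_right)
    \<comment> \<open>The three remainders add up to 8 + 2 + 2 = 12 times H Z. After division by R1
      the bound 48 H R1^\<beta> <= \<eta> turns this into a loss of at most \<eta> / 4.\<close>
    then have "R1 * (G \<bullet> e) \<ge> R1 * (G0 \<bullet> e) - 12 * H * Z" using a1 a2 a3 by linarith
    also have "R1 * (G0 \<bullet> e) - 12 * H * Z = R1 * (G0 \<bullet> e - 12 * H * R1 powr \<beta>)"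
      unfolding Z(2) by (simp add: algebra_simps)
    finally have "G \<bullet> e \<ge> G0 \<bullet> e - 12 * H * R1 powr \<beta>" using R1(1) by simp
    then have Ge: "G \<bullet> e \<ge> 3 * \<eta> / 4" using G0e R1(3) by linarith
    show "\<exists>h1. \<eta> / 2 \<le> \<bar>h1\<bar> \<and> (\<forall>s. l + s *\<^sub>R e \<in> ball l0 R1 \<longrightarrow>
        \<eta> / 2 * \<bar>s\<bar> \<le> \<bar>?h (l + s *\<^sub>R e) - ?h l\<bar> \<and> \<bar>?h (l + s *\<^sub>R e) - ?h l - h1 * s\<bar> \<le> 2 * H * \<bar>s\<bar> powr (1 + \<beta>))"
    proof (intro exI[of _ "G \<bullet> e"] conjI allI impI)
      show "\<eta> / 2 \<le> \<bar>G \<bullet> e\<bar>" using Ge \<eta> by linarith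
      fix s assume s: "l + s *\<^sub>R e \<in> ball l0 R1"
      then have sR: "l + s *\<^sub>R e \<in> ball l0 R" using R1 by simp
      show *: "\<bar>?h (l + s *\<^sub>R e) - ?h l - (G \<bullet> e) * s\<bar> \<le> 2 * H * \<bar>s\<bar> powr (1 + \<beta>)"
        using G[OF sR] e by (simp add: mult.commute)
      have "dist l (l + s *\<^sub>R e) < R1 + R1" using l s by (intro dist_triangle_less_add) (auto simp: dist_commute)
      then have s2: "\<bar>s\<bar> \<le> 2 * R1" using e by (simp add: dist_norm)
      \<comment> \<open>Both points lie in the ball of radius R1, so |s| <= 2 R1 and the remainder
        is at most |s| \<eta> / 4; of the slope 3 \<eta> / 4 at least \<eta> / 2 remains.\<close>
      have "\<bar>s\<bar> powr (1 + \<beta>) = \<bar>s\<bar> * \<bar>s\<bar> powr \<beta>" by (simp add: powr_add powr_one_gt_zero_iff)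
      also have "\<bar>s\<bar> powr \<beta> \<le> (2 * R1) powr \<beta>" using s2 \<beta> by (intro powr_mono2) auto
      also have "(2 * R1) powr \<beta> = 2 powr \<beta> * R1 powr \<beta>" using R1 by (simp add: powr_mult)
      also have "2 powr \<beta> \<le> (2::real)" using powr_mono[of \<beta> 1 2] \<beta> by simp
      finally have "\<bar>s\<bar> powr (1 + \<beta>) \<le> \<bar>s\<bar> * (2 * R1 powr \<beta>)" by (simp add: mult_left_mono mult_right_mono)
      then have "2 * H * \<bar>s\<bar> powr (1 + \<beta>) \<le> 2 * H * (\<bar>s\<bar> * (2 * R1 powr \<beta>))"
        using H(1) by (intro mult_left_mono) auto
      also have "\<dots> = \<bar>s\<bar> * (4 * H * R1 powr \<beta>)" by simp
      also have "\<dots> \<le> \<bar>s\<bar> * (\<eta> / 4)" using R1(3) \<eta> H(1) by (intro mult_left_mono) auto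
      finally have b: "2 * H * \<bar>s\<bar> powr (1 + \<beta>) \<le> \<bar>s\<bar> * (\<eta> / 4)" .
      have "3 * \<eta> / 4 * \<bar>s\<bar> \<le> \<bar>G \<bullet> e\<bar> * \<bar>s\<bar>" using Ge by (intro mult_right_mono) auto
      also have "\<dots> = \<bar>(G \<bullet> e) * s\<bar>" by (simp add: abs_mult)
      finally have c: "3 * (\<eta> * \<bar>s\<bar>) / 4 \<le> \<bar>(G \<bullet> e) * s\<bar>" by (simp add: ac_simps)
      have "2 * H * \<bar>s\<bar> powr (1 + \<beta>) \<le> \<eta> * \<bar>s\<bar> / 4" using b by (simp add: mult.commute)
      then have "\<eta> * \<bar>s\<bar> / 2 \<le> \<bar>?h (l + s *\<^sub>R e) - ?h l\<bar>" using * c by linarith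
      then show "\<eta> / 2 * \<bar>s\<bar> \<le> \<bar>?h (l + s *\<^sub>R e) - ?h l\<bar>" by simp
    qed
  qed
qed

text \<open>The bracket in \<open>oscillatory_integral_bound\<close> for \<kappa> = \<eta> / 2, D =
  2 \<open>K1\<close>, H = 2 \<open>H\<close>, after the word length, the powers of E and the weight
  at l0 have been pulled out.\<close>

definition Cosc :: "real \<Rightarrow> real" where
  "Cosc c = 1 + 2 * c + 2 * (Kd * (1 + 2 * K1) * (2 + 16 * K1 / \<eta>) + 16 * H / \<eta>)"

text \<open>The square dominates (8 / \<eta>)^\<alpha> for every positive exponent up to 2; the
  summand 1 next to \<open>2 * Cosc c\<close> serves the trivial bound at low effective
  frequency.\<close>

definition Cpair :: "real \<Rightarrow> real" where
  "Cpair c = measure lborel (cball l0 (2 * R + 1 + norm l0)) * (2 * Cosc c + 1) * (1 + 8 / \<eta>)\<^sup>2"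

text \<open>The rate of both exponential losses on a ball of radius R1: 4 c for the weights, whose
  arguments are up to 2 R1 apart, and the rest for the slopes, where R1 <= R1^\<theta> is
  used.\<close>

definition Cexp :: "real \<Rightarrow> real" where "Cexp c = 4 * c + 2 * Kd * (1 + 2 * K1)"

text \<open>Lipschitz continuity is as much regularity as the amplitude needs, and positivity
  throughout the open ball allows the cutoff to be divided out at the end.\<close>

definition cutoff :: "real \<Rightarrow> 'a \<Rightarrow> real" where "cutoff R1 l = max 0 (R1 - norm (l - l0))"

lemma cutoff_lip: "\<bar>cutoff R1 l - cutoff R1 l'\<bar> \<le> norm (l - l')"
  using norm_triangle_ineq3[of "l - l0" "l' - l0"] unfolding cutoff_def by (simp add: max_def) linarith

lemma cutoff_bd: "0 \<le> cutoff R1 l" "0 \<le> R1 \<Longrightarrow> cutoff R1 l \<le> R1"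
  unfolding cutoff_def by auto

lemma cutoff_eq_0: "l \<notin> ball l0 R1 \<Longrightarrow> cutoff R1 l = 0"
  unfolding cutoff_def by (auto simp: dist_norm norm_minus_commute)

lemma continuous_on_cutoff: "continuous_on A (cutoff R1)"
  unfolding cutoff_def[abs_def] by (intro continuous_intros)

text \<open>The assumption on w is what (M) provides for a product of two cylinder masses.\<close>

lemma weight_bounds:
  fixes w :: "'a \<Rightarrow> real"
  assumes w0: "\<And>l. l \<in> ball l0 R \<Longrightarrow> 0 \<le> w l"
    and w: "\<And>l l'. l \<in> ball l0 R \<Longrightarrow> l' \<in> ball l0 R \<Longrightarrow> w l \<le> exp (2 * c * real k * norm (l - l') powr \<theta>) * w l'"
    and c: "0 \<le> c" and \<theta>: "0 < \<theta>" "\<theta> \<le> 1" and R1: "0 < R1" "R1 \<le> R"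
    and E: "E = exp (Cexp c * real k * R1 powr \<theta>)"
  shows "1 \<le> E" "l \<in> ball l0 R1 \<Longrightarrow> w l \<le> E * w l0"
    "l \<in> ball l0 R1 \<Longrightarrow> l' \<in> ball l0 R1 \<Longrightarrow> \<bar>w l - w l'\<bar> \<le> 2 * c * real k * E\<^sup>2 * w l0 * norm (l - l') powr \<theta>"
proof -
  have K: "0 \<le> Kd * (1 + 2 * K1)" using Kd K1(1) by simp
  show E1: "1 \<le> E" unfolding E Cexp_def using c K by simp
  have wle: "w l \<le> E * w l0" if l: "l \<in> ball l0 R1" for l
  proof -
    have "norm (l - l0) powr \<theta> \<le> R1 powr \<theta>"
      using l \<theta> by (intro powr_mono2) (auto simp: dist_norm norm_minus_commute)
    then have "2 * c * real k * norm (l - l0) powr \<theta> \<le> Cexp c * real k * R1 powr \<theta>"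
      unfolding Cexp_def using c K by (intro mult_mono) auto
    then have "exp (2 * c * real k * norm (l - l0) powr \<theta>) * w l0 \<le> E * w l0"
      unfolding E by (intro mult_right_mono w0 l0_in) auto
    then show ?thesis using w[of l l0] l R1 l0_in by auto
  qed
  then show "l \<in> ball l0 R1 \<Longrightarrow> w l \<le> E * w l0" .
  have half: "w l - w l' \<le> 2 * c * real k * E\<^sup>2 * w l0 * norm (l - l') powr \<theta>" if l: "l \<in> ball l0 R1" "l' \<in> ball l0 R1" for l l'
  proof -
    let ?x = "2 * c * real k * norm (l - l') powr \<theta>"
    have x0: "0 \<le> ?x" using c by simp
    have "dist l l' < R1 + R1" using l by (intro dist_triangle_less_add[of _ l0]) (auto simp: dist_commute)
    then have "norm (l - l') powr \<theta> \<le> (2 * R1) powr \<theta>" using \<theta> by (intro powr_mono2) (auto simp: dist_norm)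
    also have "\<dots> = 2 powr \<theta> * R1 powr \<theta>" using R1 by (simp add: powr_mult)
    also have "\<dots> \<le> 2 * R1 powr \<theta>" using powr_mono[of \<theta> 1 2] \<theta> by (intro mult_right_mono) auto
    finally have "?x \<le> 2 * c * real k * (2 * R1 powr \<theta>)" using c by (intro mult_left_mono) auto
    also have "\<dots> \<le> Cexp c * real k * R1 powr \<theta>" 
      using mult_right_mono[of "4 * c" "Cexp c" "real k * R1 powr \<theta>"] K by (simp add: Cexp_def ac_simps)
    finally have xE: "exp ?x \<le> E" unfolding E by simp
    have wl': "0 \<le> w l'" using w0 l R1 by auto
    have "w l \<le> exp ?x * w l'" using w l R1 by auto
    then have "w l - w l' \<le> (exp ?x - 1) * w l'" by (simp add: algebra_simps)
    also have "\<dots> \<le> (?x * E) * (E * w l0)"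
      using exp_minus_one_le[of ?x] mult_left_mono[OF xE x0] wle[OF l(2)] wl' x0 E1
      by (intro mult_mono) auto
    finally show ?thesis by (simp add: power2_eq_square ac_simps)
  qed
  show "\<bar>w l - w l'\<bar> \<le> 2 * c * real k * E\<^sup>2 * w l0 * norm (l - l') powr \<theta>" if "l \<in> ball l0 R1" "l' \<in> ball l0 R1"
    using half[OF that] half[OF that(2,1)] by (simp add: norm_minus_commute abs_le_iff)
qed

section \<open>The integral over the parameter for one pair of sequences\<close>

lemma continuous_on_proj: "\<forall>n. i n \<in> {1..m} \<Longrightarrow> continuous_on (ball l0 R) (\<lambda>l. P l i)"
  by (rule holder_continuous_on[of _ _ K1 1]) (use proj_lam in auto)

text \<open>Beyond the common prefix the two sequences start with different letters, so
  transversality applies to their tails, and the prefix contributes only a slope. The effective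
  frequency is N times this slope at l0; the losses are a factor k and powers of E.\<close>

lemma pair_integral_bound:
  fixes w :: "'a \<Rightarrow> real"
  assumes i: "\<forall>n. i n \<in> {1..m}" and j: "\<forall>n. j n \<in> {1..m}"
    and p: "pref i p = pref j p" "i p \<noteq> j p" and k: "p \<le> k" "1 \<le> k"
    and w0: "\<And>l. l \<in> ball l0 R \<Longrightarrow> 0 \<le> w l"
    and w: "\<And>l l'. l \<in> ball l0 R \<Longrightarrow> l' \<in> ball l0 R \<Longrightarrow> w l \<le> exp (2 * c * real k * norm (l - l') powr \<theta>) * w l'"
    and c: "0 \<le> c" and \<theta>: "\<beta> \<le> \<theta>" "\<theta> \<le> 1" and N: "0 < N" and \<alpha>: "0 < \<alpha>" "\<alpha> \<le> 1 + \<beta>"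
    and R1: "0 < R1" "2 * R1 < R" "R1 \<le> 1/2" "48 * H * R1 powr \<beta> \<le> \<eta>" "4 * K1 * R1 \<le> \<eta>"
    and E: "E = exp (Cexp c * real k * R1 powr \<theta>)"
    and x0: "x0 = P l0 (\<lambda>n. i (n + p))" and y0: "y0 = P l0 (\<lambda>n. j (n + p))"
  shows "integrable lborel (\<lambda>l. cutoff R1 l * w l * wavelet (N * (P l i - P l j)))" (is "integrable lborel ?F")
    and "\<bar>\<integral>l. cutoff R1 l * w l * wavelet (N * (P l i - P l j)) \<partial>lborel\<bar>
      \<le> Cpair c * real k * E ^ 6 * w l0 * (N * \<bar>slope (pref i p) l0 x0 y0\<bar>) powr (- \<alpha>)"
proof -
  have \<theta>0: "0 < \<theta>" using \<theta> \<beta> by linarith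
  have RR: "R1 \<le> R" using R1 by linarith
  have sub: "l \<in> ball l0 R1 \<Longrightarrow> l \<in> ball l0 R" for l using RR by auto
  have E1: "1 \<le> E" by (rule weight_bounds(1)[OF w0 w c \<theta>0 \<theta>(2) R1(1) RR E]) auto
  have wb2: "w q \<le> E * w l0" if "q \<in> ball l0 R1" for q
    by (rule weight_bounds(2)[OF w0 w c \<theta>0 \<theta>(2) R1(1) RR E that]) auto
  have wb3: "\<bar>w q - w q'\<bar> \<le> 2 * c * real k * E\<^sup>2 * w l0 * norm (q - q') powr \<theta>"
    if "q \<in> ball l0 R1" "q' \<in> ball l0 R1" for q q'
    by (rule weight_bounds(3)[OF w0 w c \<theta>0 \<theta>(2) R1(1) RR E that]) auto
  have wl0: "0 \<le> w l0" using w0 l0_in .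
  define i' where "i' = (\<lambda>n. i (n + p))"
  define j' where "j' = (\<lambda>n. j (n + p))"
  have ij': "\<forall>n. i' n \<in> {1..m}" "\<forall>n. j' n \<in> {1..m}" "i' 0 \<noteq> j' 0" using i j p by (auto simp: i'_def j'_def)
  define u where "u = pref i p"
  have u: "set u \<subseteq> {1..m}" "length u = p" using set_pref[OF i] by (auto simp: u_def)
  define G where "G = \<bar>slope u l0 x0 y0\<bar>"
  define g where "g = (\<lambda>l. \<bar>slope u l (P l i') (P l j')\<bar>)"
  define h where "h = (\<lambda>l. P l i' - P l j')"
  have G: "G = g l0" unfolding G_def g_def x0 y0 i'_def j'_def ..
  have Gpos: "0 < G" unfolding G_def x0 y0
    using slope_bd[OF u(1) l0_in proj_in[OF ij'(1) l0_in] proj_in[OF ij'(2) l0_in]] by (simp add: i'_def j'_def)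
  \<comment> \<open>The slope may be negative; evenness of the wavelet permits its modulus.\<close>
  have prod: "wavelet (N * (P l i - P l j)) = wavelet (N * g l * h l)" if "l \<in> ball l0 R" for l
  proof -
    have "P l i - P l j = slope u l (P l i') (P l j') * h l"
      using proj_shift[OF i that, of p] proj_shift[OF j that, of p] slope_eq[OF u(1) that proj_in[OF ij'(1) that] proj_in[OF ij'(2) that]]
      by (simp add: i'_def j'_def u_def h_def p(1))
    then have "\<bar>N * (P l i - P l j)\<bar> = \<bar>N * g l * h l\<bar>" by (simp add: g_def abs_mult)
    then show ?thesis by (metis wavelet_abs)
  qed
  let ?V = "measure lborel (cball l0 (2 * R + 1 + norm l0))"
  have VR1: "measure lborel (ball l0 R1) \<le> ?V"
  proof (rule measure_mono_fmeasurable)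
    have "R1 \<le> 2 * R + 1 + norm l0" using RR R R1 norm_ge_zero[of l0] by linarith
    then show "ball l0 R1 \<subseteq> cball l0 (2 * R + 1 + norm l0)" by auto
  qed (use fmeasurable_lborel_cball in auto)
  have Fsup: "?F l = 0" if "l \<notin> ball l0 R1" for l using cutoff_eq_0[OF that] by simp
  have A0: "0 \<le> cutoff R1 l * w l" and A1: "cutoff R1 l * w l \<le> E * w l0" for l
  proof -
    have "0 \<le> cutoff R1 l * w l \<and> cutoff R1 l * w l \<le> E * w l0"
    proof (cases "l \<in> ball l0 R1")
      case True
      then have "cutoff R1 l * w l \<le> 1 * (E * w l0)"
        using cutoff_bd(2)[of R1 l] R1 w0[OF sub[OF True]] by (intro mult_mono wb2) auto
      then show ?thesis using cutoff_bd(1) w0[OF sub[OF True]] by simp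
    next
      case False
      then show ?thesis using cutoff_eq_0 E1 wl0 by simp
    qed
    then show "0 \<le> cutoff R1 l * w l" "cutoff R1 l * w l \<le> E * w l0" by auto
  qed
  have FM: "\<bar>?F l\<bar> \<le> E * w l0" for l
  proof -
    have "\<bar>?F l\<bar> = (cutoff R1 l * w l) * \<bar>wavelet (N * (P l i - P l j))\<bar>"
      by (simp only: abs_mult[of "cutoff R1 l * w l"] abs_of_nonneg[OF A0[of l]])
    also have "\<dots> \<le> (E * w l0) * 1" by (intro mult_mono A1 abs_wavelet_le_1) (use E1 wl0 in auto)
    finally show ?thesis by simp
  qed
  have contw: "continuous_on (ball l0 R1) w"
    by (rule holder_continuous_on[OF _ \<theta>0]) (use wb3 in auto)
  have contF: "continuous_on (ball l0 R1) ?F"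
    by (intro continuous_intros continuous_on_cutoff contw continuous_on_subset[OF continuous_on_proj[OF i]] continuous_on_subset[OF continuous_on_proj[OF j]])
       (use RR in auto)
  \<comment> \<open>Nothing is known about w outside the ball, so the integrand is obtained as the
    extension by zero of a function continuous on an open set.\<close>
  have [measurable]: "?F \<in> borel_measurable borel"
  proof -
    have "(\<lambda>l. indicator (ball l0 R1) l *\<^sub>R ?F l) \<in> borel_measurable borel"
      by (intro borel_measurable_continuous_on_indicator contF) auto
    moreover have "(\<lambda>l. indicator (ball l0 R1) l *\<^sub>R ?F l) = ?F"
      using Fsup by (auto simp: indicator_def fun_eq_iff)
    ultimately show ?thesis by simp
  qed
  note triv = norm_integral_le_ball[of ?F "ball l0 R1" "E * w l0", OF _ bounded_ball _ FM Fsup]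
  show intF: "integrable lborel ?F" by (rule triv) auto
  \<comment> \<open>The support length 4 / (N g0 \<kappa>) of
    \<open>oscillatory_integral_bound\<close>, with g0 = G / E and \<kappa> = \<eta> / 2.\<close>
  define l where "l = 8 * E / (N * G * \<eta>)"
  have lpos: "0 < l" unfolding l_def using E1 N Gpos \<eta> by simp
  \<comment> \<open>Two of the six factors E come from l^\<alpha>, since \<alpha> <= 2.\<close>
  have final: "?V * ((2 * Cosc c + 1) * (real k * E ^ 4 * w l0) * l powr \<alpha>)
     \<le> Cpair c * real k * E ^ 6 * w l0 * (N * G) powr (- \<alpha>)"
  proof -
    have a2: "\<alpha> \<le> 2" using \<alpha> \<beta> by linarith
    have "l = (8 / \<eta>) * E * (1 / (N * G))" unfolding l_def by simp
    then have "l powr \<alpha> = (8 / \<eta>) powr \<alpha> * E powr \<alpha> * (1 / (N * G)) powr \<alpha>"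
      using E1 N Gpos \<eta> by (simp only: powr_mult[symmetric])
    also have "(1 / (N * G)) powr \<alpha> = (N * G) powr (- \<alpha>)"
      using N Gpos by (simp add: powr_minus_divide powr_divide)
    also have "(8 / \<eta>) powr \<alpha> \<le> (1 + 8 / \<eta>)\<^sup>2"
    proof -
      have "(8 / \<eta>) powr \<alpha> \<le> (1 + 8 / \<eta>) powr \<alpha>" using \<eta> \<alpha> by (intro powr_mono2) auto
      also have "\<dots> \<le> (1 + 8 / \<eta>) powr 2" using \<eta> a2 by (intro powr_mono) auto
      finally show ?thesis using \<eta> by (simp add: powr_numeral add_pos_pos)
    qed
    also have "E powr \<alpha> \<le> E\<^sup>2"
      using powr_mono[OF a2 E1] E1 by (simp add: powr_numeral)
    finally have "l powr \<alpha> \<le> (1 + 8 / \<eta>)\<^sup>2 * E\<^sup>2 * (N * G) powr (- \<alpha>)"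
      by (simp add: mult_right_mono mult_left_mono)
    then have "?V * ((2 * Cosc c + 1) * (real k * E ^ 4 * w l0) * l powr \<alpha>)
       \<le> ?V * ((2 * Cosc c + 1) * (real k * E ^ 4 * w l0) * ((1 + 8 / \<eta>)\<^sup>2 * E\<^sup>2 * (N * G) powr (- \<alpha>)))"
      using E1 wl0 c Kd K1(1) H(1) \<eta> by (intro mult_left_mono) (auto simp: Cosc_def)
    also have "\<dots> = Cpair c * real k * E ^ 6 * w l0 * (N * G) powr (- \<alpha>)"
      unfolding Cpair_def by (simp add: power_numeral_reduce)
    finally show ?thesis .
  qed
  have Cosc: "0 \<le> Cosc c" unfolding Cosc_def using c Kd K1(1) H(1) \<eta> by simp
  have kE: "E * w l0 \<le> real k * E ^ 4 * w l0"
  proof -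
    have "1 * E ^ 1 \<le> real k * E ^ 4" using k E1 by (intro mult_mono power_increasing) auto
    then show ?thesis using wl0 by (intro mult_right_mono) auto
  qed
  have main: "\<bar>\<integral>l. ?F l \<partial>lborel\<bar> \<le> ?V * ((2 * Cosc c + 1) * (real k * E ^ 4 * w l0) * l powr \<alpha>)"
  proof (cases "l \<le> 1")
    case False
    \<comment> \<open>For l > 1 the power l^\<alpha> is at least 1, so the bound by volume times
      maximum suffices.\<close>
    have "\<bar>\<integral>l. ?F l \<partial>lborel\<bar> \<le> measure lborel (ball l0 R1) * (E * w l0)" by (rule triv) auto
    also have "\<dots> \<le> ?V * ((2 * Cosc c + 1) * (real k * E ^ 4 * w l0) * l powr \<alpha>)"
    proof (rule mult_mono[OF VR1])
      have "1 * (E * w l0) \<le> (2 * Cosc c + 1) * (real k * E ^ 4 * w l0)"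
        by (rule mult_mono[OF _ kE]) (use Cosc E1 wl0 in auto)
      from mult_mono[OF this, of 1 "l powr \<alpha>"]
      have "1 * (E * w l0) * 1 \<le> (2 * Cosc c + 1) * (real k * E ^ 4 * w l0) * l powr \<alpha>"
        using Cosc False \<alpha> E1 wl0 ge_one_powr_ge_zero[of l \<alpha>] by auto
      then show "E * w l0 \<le> (2 * Cosc c + 1) * (real k * E ^ 4 * w l0) * l powr \<alpha>" by simp
    qed (use E1 wl0 in auto)
    finally show ?thesis .
  next
    case l1: True
    have kpos: "1 \<le> real k" using k by simp
    have grat: "g l \<le> exp (Kd * (1 + 2 * K1) * real k * norm (l - l')) * g l'" if "l \<in> ball l0 R1" "l' \<in> ball l0 R1" for l l'
    proof -
      note lR = sub[OF that(1)] and l'R = sub[OF that(2)]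
      have "g l \<le> exp (Kd * (real p * norm (l - l') + \<bar>P l i' - P l' i'\<bar> + \<bar>P l j' - P l' j'\<bar>)) * g l'"
        unfolding g_def u(2)[symmetric] by (intro slope_distortion u lR l'R proj_in ij')
      also have "Kd * (real p * norm (l - l') + \<bar>P l i' - P l' i'\<bar> + \<bar>P l j' - P l' j'\<bar>) \<le> Kd * (1 + 2 * K1) * real k * norm (l - l')"
      proof -
        have "real p * norm (l - l') \<le> real k * norm (l - l')" using k by (intro mult_right_mono) auto
        moreover have "K1 * norm (l - l') \<le> real k * (K1 * norm (l - l'))"
          using mult_right_mono[OF kpos, of "K1 * norm (l - l')"] K1(1) by simp
        ultimately have "real p * norm (l - l') + \<bar>P l i' - P l' i'\<bar> + \<bar>P l j' - P l' j'\<bar> \<le> (1 + 2 * K1) * real k * norm (l - l')"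
          using proj_lam[OF ij'(1) l'R lR] proj_lam[OF ij'(2) l'R lR] by (simp add: algebra_simps)
        then show ?thesis using Kd by (simp add: mult.assoc mult_left_mono)
      qed
      finally show ?thesis by (simp add: mult_right_mono g_def)
    qed
    have expE: "exp (Kd * (1 + 2 * K1) * real k * norm (l - l')) \<le> E" if "l \<in> ball l0 R1" "l' \<in> ball l0 R1" for l l'
    proof -
      have "dist l l' < R1 + R1" using that by (intro dist_triangle_less_add[of _ l0]) (auto simp: dist_commute)
      also have "R1 \<le> R1 powr \<theta>" using powr_mono'[of \<theta> 1 R1] \<theta> R1 by simp
      finally have "norm (l - l') \<le> 2 * R1 powr \<theta>" by (simp add: dist_norm)
      then have "Kd * (1 + 2 * K1) * real k * norm (l - l') \<le> Kd * (1 + 2 * K1) * real k * (2 * R1 powr \<theta>)"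
        using Kd K1(1) by (intro mult_left_mono) auto
      also have "\<dots> \<le> Cexp c * real k * R1 powr \<theta>" 
        using mult_right_mono[of "2 * (Kd * (1 + 2 * K1))" "Cexp c" "real k * R1 powr \<theta>"] c by (simp add: Cexp_def ac_simps)
      finally show ?thesis unfolding E by simp
    qed
    have l0R1: "l0 \<in> ball l0 R1" using R1 by simp
    have gpos: "0 \<le> g l" for l unfolding g_def by simp
    have gup: "g l \<le> G * E" and glow: "G / E \<le> g l" if "l \<in> ball l0 R1" for l
    proof -
      show "g l \<le> G * E" using grat[OF that l0R1] mult_right_mono[OF expE[OF that l0R1] gpos[of l0]] unfolding G by (simp add: mult.commute)
      have "G \<le> E * g l" using grat[OF l0R1 that] mult_right_mono[OF expE[OF l0R1 that] gpos[of l]] unfolding G by simp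
      then show "G / E \<le> g l" using E1 by (simp add: divide_le_eq mult.commute)
    qed
    show ?thesis
    proof (cases "\<bar>h l0\<bar> < \<eta>")
      case False
      \<comment> \<open>Transversality says nothing when h is large at l0. Then 4 \<open>K1\<close>
        R1 <= \<eta> keeps |h| above \<eta> / 2 on the small ball, and l <= 1 pushes the argument of
        the wavelet out of its support.\<close>
      have "?F q = 0" for q
      proof (cases "q \<in> ball l0 R1")
        case True
        have "2 \<le> \<bar>N * g q * h q\<bar>"
        proof -
          have "\<bar>h l0\<bar> \<le> \<bar>h q\<bar> + 2 * (K1 * norm (q - l0))"
            using proj_lam[OF ij'(1) l0_in sub[OF True]] proj_lam[OF ij'(2) l0_in sub[OF True]] unfolding h_def by linarith
          also have "K1 * norm (q - l0) \<le> K1 * R1" using True K1(1) by (intro mult_left_mono) (auto simp: dist_norm norm_minus_commute)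
          finally have "\<eta> / 2 \<le> \<bar>h q\<bar>" using False R1(5) by linarith
          have "l * \<eta> / 4 \<le> \<eta> / 4" using l1 \<eta> by simp
          then have "2 * E / (N * G) \<le> \<eta> / 4" unfolding l_def using \<eta> by (simp add: ac_simps)
          then have "2 * E / (N * G) \<le> \<bar>h q\<bar>" using \<open>\<eta> / 2 \<le> \<bar>h q\<bar>\<close> \<eta> by linarith
          then have "2 \<le> N * (G / E) * \<bar>h q\<bar>" using N Gpos E1 by (simp add: field_simps)
          also have "\<dots> \<le> N * g q * \<bar>h q\<bar>" using N glow[OF True] by (intro mult_right_mono mult_left_mono) auto
          finally show ?thesis using N gpos[of q] by (simp add: abs_mult)
        qed
        then show ?thesis using prod[OF sub[OF True]] wavelet_eq_0 by simp
      qed (rule Fsup)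
      then have F0: "?F = (\<lambda>q. 0)" by (rule ext)
      have "(\<integral>l. ?F l \<partial>lborel) = 0" unfolding F0 by simp
      then show ?thesis using Cosc E1 wl0 by simp
    next
      case True
      obtain e where e: "norm e = 1" and e2: "\<And>l. l \<in> ball l0 R1 \<Longrightarrow> \<exists>h1. \<eta> / 2 \<le> \<bar>h1\<bar> \<and>
         (\<forall>s. l + s *\<^sub>R e \<in> ball l0 R1 \<longrightarrow> \<eta> / 2 * \<bar>s\<bar> \<le> \<bar>h (l + s *\<^sub>R e) - h l\<bar> \<and>
            \<bar>h (l + s *\<^sub>R e) - h l - h1 * s\<bar> \<le> 2 * H * \<bar>s\<bar> powr (1 + \<beta>))"
        using transversal_direction[OF ij' _ R1(1,2,4)] True unfolding h_def by blast
      show ?thesis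
      proof (rule integral_le_slices[OF intF e, of l0 R1, THEN order_trans])
        show "?F l = 0" if "l \<notin> ball l0 R1" for l by (rule Fsup[OF that])
        fix q :: 'a
        define I where "I = {s. q + s *\<^sub>R e \<in> ball l0 R1}"
        let ?q = "\<lambda>s. q + s *\<^sub>R e"
        have shift: "?q t = ?q s + (t - s) *\<^sub>R e" for s t by (simp add: algebra_simps)
        have nq: "norm (?q s - ?q t) = \<bar>s - t\<bar>" for s t
          using e by (simp flip: scaleR_left_diff_distrib)
        have eqF: "?F (?q s) = (cutoff R1 (?q s) * w (?q s)) * wavelet (N * g (?q s) * h (?q s))" for s
          using prod[OF sub, of "?q s"] cutoff_eq_0[of "?q s" R1] by (cases "?q s \<in> ball l0 R1") auto
        have "\<bar>\<integral>s. (cutoff R1 (?q s) * w (?q s)) * wavelet (N * g (?q s) * h (?q s)) \<partial>lborel\<bar>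
          \<le> 2 * l * (l powr \<beta> * (E\<^sup>2 * w l0 * (1 + 2 * c * real k) + 2 * (E * w l0) * (G * E / (G / E)) *
             (Kd * (1 + 2 * K1) * real k * E * (2 + 4 * (2 * K1) / (\<eta> / 2)) + 4 * (2 * H) / (\<eta> / 2))))"
        proof (rule oscillatory_integral_bound[where I=I])
          show "(\<lambda>s. cutoff R1 (?q s) * w (?q s) * wavelet (N * g (?q s) * h (?q s))) \<in> borel_measurable borel"
            unfolding eqF[symmetric] by measurable
          show "cutoff R1 (?q s) * w (?q s) = 0" if "s \<notin> I" for s
            using that cutoff_eq_0 by (auto simp: I_def)
          show "\<bar>cutoff R1 (?q s) * w (?q s)\<bar> \<le> E * w l0" for s using A0[of "?q s"] A1[of "?q s"] by simp
          fix s t assume s: "s \<in> I"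
          then have qs: "?q s \<in> ball l0 R1" by (simp add: I_def)
          show "G / E \<le> g (?q s)" "g (?q s) \<le> G * E" using gup[OF qs] glow[OF qs] by auto
          \<comment> \<open>The point t may leave the ball here: the cutoff then vanishes at t, and
            its Lipschitz bound alone controls the difference.\<close>
          show "\<bar>cutoff R1 (?q s) * w (?q s) - cutoff R1 (?q t) * w (?q t)\<bar> \<le> E\<^sup>2 * w l0 * (1 + 2 * c * real k) * \<bar>s - t\<bar> powr \<beta>"
            if st: "\<bar>s - t\<bar> \<le> 1"
          proof -
            have p\<beta>: "\<bar>s - t\<bar> \<le> \<bar>s - t\<bar> powr \<beta>" "\<bar>s - t\<bar> powr \<theta> \<le> \<bar>s - t\<bar> powr \<beta>"
              using powr_mono'[of \<beta> 1 "\<bar>s - t\<bar>"] powr_mono'[of \<beta> \<theta> "\<bar>s - t\<bar>"] st \<beta> \<theta> by auto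
            have "\<bar>(cutoff R1 (?q s) - cutoff R1 (?q t)) * w (?q s)\<bar> \<le> \<bar>s - t\<bar> * (E * w l0)"
              unfolding abs_mult using cutoff_lip[of R1 "?q s" "?q t", unfolded nq] wb2[OF qs] w0[OF sub[OF qs]]
              by (intro mult_mono) auto
            also have "\<dots> \<le> \<bar>s - t\<bar> powr \<beta> * (E\<^sup>2 * w l0)"
              using p\<beta> wl0 E1 self_le_power[OF E1, of 2] by (intro mult_mono) auto
            finally have 1: "\<bar>(cutoff R1 (?q s) - cutoff R1 (?q t)) * w (?q s)\<bar> \<le> \<bar>s - t\<bar> powr \<beta> * (E\<^sup>2 * w l0)" .
            have 2: "\<bar>cutoff R1 (?q t) * (w (?q s) - w (?q t))\<bar> \<le> 1 * (2 * c * real k * E\<^sup>2 * w l0 * \<bar>s - t\<bar> powr \<beta>)"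
            proof (cases "?q t \<in> ball l0 R1")
              case True
              have "\<bar>w (?q s) - w (?q t)\<bar> \<le> 2 * c * real k * E\<^sup>2 * w l0 * norm (?q s - ?q t) powr \<theta>"
                by (rule wb3[OF qs True])
              also have "\<dots> \<le> 2 * c * real k * E\<^sup>2 * w l0 * \<bar>s - t\<bar> powr \<beta>"
                unfolding nq using p\<beta> c wl0 by (intro mult_left_mono) auto
              finally show ?thesis unfolding abs_mult using cutoff_bd(1)[of R1 "?q t"] cutoff_bd(2)[of R1 "?q t"] R1 by (intro mult_mono) auto
            next
              case False
              then show ?thesis using cutoff_eq_0[OF False] c wl0 by simp
            qed
            have "cutoff R1 (?q s) * w (?q s) - cutoff R1 (?q t) * w (?q t)
               = (cutoff R1 (?q s) - cutoff R1 (?q t)) * w (?q s) + cutoff R1 (?q t) * (w (?q s) - w (?q t))"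
              by (simp add: algebra_simps)
            then show ?thesis using 1 2 by (simp add: algebra_simps)
          qed
          assume t: "t \<in> I"
          then have qt: "?q t \<in> ball l0 R1" by (simp add: I_def)
          have gh: "g (?q s) - g (?q t) \<le> Kd * (1 + 2 * K1) * real k * E * (G * E) * \<bar>s - t\<bar>"
            if "?q s \<in> ball l0 R1" "?q t \<in> ball l0 R1" for s t
          proof -
            let ?x = "Kd * (1 + 2 * K1) * real k * \<bar>s - t\<bar>"
            have x0: "0 \<le> ?x" using Kd K1(1) by simp
            have xE: "exp ?x \<le> E" using expE[OF that] unfolding nq .
            have "g (?q s) - g (?q t) \<le> (exp ?x - 1) * g (?q t)"
              using grat[OF that] unfolding nq by (simp add: algebra_simps)
            also have "\<dots> \<le> (?x * E) * (G * E)"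
              using exp_minus_one_le[of ?x] mult_left_mono[OF xE x0] gup[OF that(2)] gpos x0 E1
              by (intro mult_mono) auto
            finally show ?thesis by (simp add: ac_simps)
          qed
          show "\<bar>g (?q s) - g (?q t)\<bar> \<le> Kd * (1 + 2 * K1) * real k * E * (G * E) * \<bar>s - t\<bar>"
            using gh[OF qs qt] gh[OF qt qs] by (simp add: abs_le_iff abs_minus_commute)
          have qts: "?q s + (t - s) *\<^sub>R e \<in> ball l0 R1" using qt unfolding shift[of t s] .
          show "\<eta> / 2 * \<bar>s - t\<bar> \<le> \<bar>h (?q s) - h (?q t)\<bar>"
            using e2[OF qs] qts unfolding shift[of t s] by (metis abs_minus_commute)
          show "\<bar>h (?q s) - h (?q t)\<bar> \<le> 2 * K1 * \<bar>s - t\<bar>"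
            using proj_lam[OF ij'(1) sub[OF qt] sub[OF qs]] proj_lam[OF ij'(2) sub[OF qt] sub[OF qs]]
            unfolding nq h_def by linarith
        next
          fix s assume s: "s \<in> I"
          then have qs: "?q s \<in> ball l0 R1" by (simp add: I_def)
          obtain h1 where h1: "\<eta> / 2 \<le> \<bar>h1\<bar>" "\<And>s'. ?q s + s' *\<^sub>R e \<in> ball l0 R1 \<Longrightarrow> \<bar>h (?q s + s' *\<^sub>R e) - h (?q s) - h1 * s'\<bar> \<le> 2 * H * \<bar>s'\<bar> powr (1 + \<beta>)"
            using e2[OF qs] by blast
          show "\<exists>h1. \<eta> / 2 \<le> \<bar>h1\<bar> \<and> (\<forall>t\<in>I. \<bar>h (?q t) - h (?q s) - h1 * (t - s)\<bar> \<le> 2 * H * \<bar>t - s\<bar> powr (1 + \<beta>))"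
          proof (intro exI[of _ h1] conjI ballI h1(1))
            fix t assume "t \<in> I"
            then show "\<bar>h (?q t) - h (?q s) - h1 * (t - s)\<bar> \<le> 2 * H * \<bar>t - s\<bar> powr (1 + \<beta>)"
              using h1(2)[of "t - s"] unfolding shift[of t s] by (simp add: I_def shift[of t s, symmetric])
          qed
        next
          show "l = 4 / (N * (G / E) * (\<eta> / 2))" unfolding l_def using E1 by simp
          show "G / E \<le> G * E"
          proof -
            have "G / E \<le> G / 1" using E1 Gpos by (intro divide_left_mono) auto
            also have "G / 1 \<le> G * E" using E1 Gpos by simp
            finally show ?thesis .
          qed
        qed (use N \<beta> \<eta> Gpos E1 Kd K1 H c wl0 l1 in auto)
        also have "\<dots> \<le> (2 * Cosc c + 1) * (real k * E ^ 4 * w l0) * l powr \<alpha>"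
        proof -
          \<comment> \<open>In the product of constants one factor E comes from the weight, two come
            from this ratio of slope bounds, and one from the Lipschitz constant of g; this explains
            \<open>E ^ 4\<close>.\<close>
          have G2: "G * E / (G / E) = E\<^sup>2" using Gpos E1 by (simp add: power2_eq_square)
          have b1: "E\<^sup>2 * w l0 * (1 + 2 * c * real k) \<le> (real k * E ^ 4 * w l0) * (1 + 2 * c)"
          proof -
            have "1 + 2 * c * real k \<le> real k * (1 + 2 * c)" using kpos c by (simp add: algebra_simps)
            moreover have "E\<^sup>2 \<le> E ^ 4" using E1 by (intro power_increasing) auto
            ultimately have "(E\<^sup>2 * w l0) * (1 + 2 * c * real k) \<le> (E ^ 4 * w l0) * (real k * (1 + 2 * c))"
              using wl0 c by (intro mult_mono) auto
            then show ?thesis by (simp add: ac_simps)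
          qed
          have b2: "2 * (E * w l0) * E\<^sup>2 * (Kd * (1 + 2 * K1) * real k * E * (2 + 4 * (2 * K1) / (\<eta> / 2)) + 4 * (2 * H) / (\<eta> / 2))
             \<le> (real k * E ^ 4 * w l0) * (2 * (Kd * (1 + 2 * K1) * (2 + 16 * K1 / \<eta>) + 16 * H / \<eta>))"
          proof -
            have "16 * H / \<eta> \<le> real k * E * (16 * H / \<eta>)"
              using mult_right_mono[OF mult_mono[OF kpos E1], of "16 * H / \<eta>"] H(1) \<eta> by simp
            then have "Kd * (1 + 2 * K1) * real k * E * (2 + 16 * K1 / \<eta>) + 16 * H / \<eta> \<le> real k * E * (Kd * (1 + 2 * K1) * (2 + 16 * K1 / \<eta>) + 16 * H / \<eta>)"
              by (simp add: algebra_simps)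
            then have "2 * (E * w l0) * E\<^sup>2 * (Kd * (1 + 2 * K1) * real k * E * (2 + 16 * K1 / \<eta>) + 16 * H / \<eta>)
              \<le> 2 * (E * w l0) * E\<^sup>2 * (real k * E * (Kd * (1 + 2 * K1) * (2 + 16 * K1 / \<eta>) + 16 * H / \<eta>))"
              using E1 wl0 by (intro mult_left_mono) auto
            then show ?thesis by (simp add: power_numeral_reduce power2_eq_square ac_simps)
          qed
          \<comment> \<open>The place where the cap \<alpha> <= 1 + \<beta> enters: since l <= 1,
            the gain l^(1+\<beta>) is at most l^\<alpha>.\<close>
          have "l * l powr \<beta> = l powr (1 + \<beta>)" using lpos by (simp add: powr_add)
          also have "\<dots> \<le> l powr \<alpha>" using lpos l1 \<alpha> by (intro powr_mono') auto
          finally have l\<alpha>: "2 * (l * l powr \<beta>) \<le> 2 * l powr \<alpha>" by simp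
          have "2 * l * (l powr \<beta> * (E\<^sup>2 * w l0 * (1 + 2 * c * real k) + 2 * (E * w l0) * (G * E / (G / E)) *
             (Kd * (1 + 2 * K1) * real k * E * (2 + 4 * (2 * K1) / (\<eta> / 2)) + 4 * (2 * H) / (\<eta> / 2))))
             \<le> 2 * l * (l powr \<beta> * ((real k * E ^ 4 * w l0) * (1 + 2 * c) + (real k * E ^ 4 * w l0) * (2 * (Kd * (1 + 2 * K1) * (2 + 16 * K1 / \<eta>) + 16 * H / \<eta>))))"
            unfolding G2 using b1 b2 lpos by (intro mult_left_mono add_mono) auto
          also have "\<dots> = (2 * (l * l powr \<beta>)) * (Cosc c * (real k * E ^ 4 * w l0))"
            unfolding Cosc_def by (simp only: algebra_simps)
          also have "\<dots> \<le> (2 * l powr \<alpha>) * (Cosc c * (real k * E ^ 4 * w l0))"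
            using l\<alpha> Cosc E1 wl0 by (intro mult_right_mono) auto
          also have "\<dots> \<le> (2 * Cosc c + 1) * (real k * E ^ 4 * w l0) * l powr \<alpha>"
            using E1 wl0 by (simp add: algebra_simps)
          finally show ?thesis .
        qed
        finally show "\<bar>\<integral>s. ?F (?q s) \<partial>lborel\<bar> \<le> (2 * Cosc c + 1) * (real k * E ^ 4 * w l0) * l powr \<alpha>"
          unfolding eqF .
      next
        have "measure lborel (cball l0 (2 * R1 + 1 + norm l0)) \<le> ?V"
          by (rule measure_mono_fmeasurable) (use RR fmeasurable_lborel_cball in auto)
        then show "measure lborel (cball l0 (2 * R1 + 1 + norm l0)) * ((2 * Cosc c + 1) * (real k * E ^ 4 * w l0) * l powr \<alpha>)
          \<le> ?V * ((2 * Cosc c + 1) * (real k * E ^ 4 * w l0) * l powr \<alpha>)"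
          using Cosc E1 wl0 by (intro mult_right_mono) auto
      qed
    qed
  qed
  show "\<bar>\<integral>l. ?F l \<partial>lborel\<bar> \<le> Cpair c * real k * E ^ 6 * w l0 * (N * \<bar>slope (pref i p) l0 x0 y0\<bar>) powr (- \<alpha>)"
    using main final unfolding G_def u_def by linarith
qed

end

section \<open>Discretization and energy\<close>

definition words :: "nat \<Rightarrow> nat \<Rightarrow> nat list set" where "words m k = {w. set w \<subseteq> {1..m} \<and> length w = k}"

text \<open>A representative sequence in the cylinder of w; continuing by the letter 1 is admissible
  for any nonempty alphabet.\<close>

definition pad :: "nat list \<Rightarrow> nat \<Rightarrow> nat" where "pad w n = (if n < length w then w ! n else 1)"

lemma finite_words: "finite (words m k)"
  unfolding words_def by (rule finite_lists_length_eq) simp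

lemma pref_pad: "pref (pad w) (length w) = w"
  unfolding pref_def by (rule nth_equalityI) (auto simp: pad_def)

lemma pad_in: "set w \<subseteq> {1..m} \<Longrightarrow> 1 \<le> m \<Longrightarrow> \<forall>n. pad w n \<in> {1..m}"
proof
  fix n assume w: "set w \<subseteq> {1..m}" "1 \<le> m"
  have "w ! n \<in> {1..m}" if "n < length w"
    using nth_mem[OF that] w(1) by blast
  then show "pad w n \<in> {1..m}"
    unfolding pad_def using w(2) by simp
qed

lemma cyl_iff: "i \<in> cyl m w \<longleftrightarrow> i \<in> space (seqspace m) \<and> (\<forall>n<length w. i n = w ! n)"
proof -
  have "pref i (length w) = w \<longleftrightarrow> (\<forall>n<length w. i n = w ! n)"
    unfolding list_eq_iff_nth_eq length_pref by (simp add: pref_def)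
  then show ?thesis by (simp add: cyl_def)
qed

lemma cyl_sets: "cyl m w \<in> sets (seqspace m)"
proof -
  have "{i \<in> space (seqspace m). \<forall>n\<in>{..<length w}. i n = w ! n} \<in> sets (seqspace m)"
  proof (rule sets.sets_Collect_finite_All)
    fix n
    have "(\<lambda>i. i n) \<in> measurable (seqspace m) (count_space {1..m})"
      unfolding seqspace_def by measurable
    then have "(\<lambda>i. i n) -` ({w ! n} \<inter> {1..m}) \<inter> space (seqspace m) \<in> sets (seqspace m)"
      by (rule measurable_sets) simp
    moreover have "(\<lambda>i. i n) -` ({w ! n} \<inter> {1..m}) \<inter> space (seqspace m) = {i \<in> space (seqspace m). i n = w ! n}"
      by (auto simp: in_seqspace_iff) metis+
    ultimately show "{i \<in> space (seqspace m). i n = w ! n} \<in> sets (seqspace m)" by simp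
  qed simp
  moreover have "cyl m w = {i \<in> space (seqspace m). \<forall>n\<in>{..<length w}. i n = w ! n}"
    using cyl_iff[of _ m w] by auto
  ultimately show ?thesis by simp
qed

lemma pref_in_words: "i \<in> space (seqspace m) \<Longrightarrow> pref i k \<in> words m k"
  unfolding words_def using set_pref[of i m k] by (auto simp: in_seqspace_iff)

lemma sum_indicator_cyl:
  fixes \<phi> :: "nat list \<Rightarrow> real"
  assumes "i \<in> space (seqspace m)"
  shows "(\<Sum>w\<in>words m k. \<phi> w * indicator (cyl m w) i) = \<phi> (pref i k)"
proof -
  have "(\<Sum>w\<in>words m k. \<phi> w * indicator (cyl m w) i) = (\<Sum>w\<in>words m k. if w = pref i k then \<phi> w else 0)"
    using assms by (intro sum.cong) (auto simp: cyl_def words_def indicator_def)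
  then show ?thesis using finite_words pref_in_words[OF assms] by simp
qed

text \<open>A function of the first k letters is a finite combination of cylinder
  indicators.\<close>

lemma measurable_pref:
  fixes \<phi> :: "nat list \<Rightarrow> real"
  shows "(\<lambda>i. \<phi> (pref i k)) \<in> borel_measurable (seqspace m)"
proof -
  have "(\<lambda>i. \<Sum>w\<in>words m k. \<phi> w * indicator (cyl m w) i) \<in> borel_measurable (seqspace m)"
    using cyl_sets by (intro borel_measurable_sum borel_measurable_times borel_measurable_indicator) auto
  then show ?thesis
    by (rule measurable_cong[THEN iffD1, rotated]) (rule sum_indicator_cyl)
qed

text \<open>Distinct words of length k already differ within the first k letters, so the common
  prefix is the same for all pairs of points of the two cylinders and can be read off the padded
  words.\<close>

lemma common_prefix_cyl:
  assumes "i \<in> cyl m v" "j \<in> cyl m w" "length v = k" "length w = k" "v \<noteq> w"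
    and p: "p = (LEAST n. pad v n \<noteq> pad w n)"
  shows "p < k" "pad v p \<noteq> pad w p" "pref (pad v) p = pref (pad w) p" "i \<noteq> j" "common_prefix i j = pref (pad v) p"
proof -
  obtain n where n: "n < k" "v ! n \<noteq> w ! n" using assms(3-5) nth_equalityI[of v w] by auto
  then have ne: "pad v n \<noteq> pad w n" using assms by (simp add: pad_def)
  show pp: "pad v p \<noteq> pad w p" unfolding p by (rule LeastI[of "\<lambda>n. pad v n \<noteq> pad w n", OF ne])
  have pn: "p \<le> n" unfolding p by (rule Least_le[of "\<lambda>n. pad v n \<noteq> pad w n", OF ne])
  then show pk: "p < k" using n by simp
  have less: "pad v q = pad w q" if "q < p" for q using not_less_Least[of q "\<lambda>n. pad v n \<noteq> pad w n"] that unfolding p by auto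
  show "pref (pad v) p = pref (pad w) p" unfolding pref_def using less by simp
  have iq: "i q = pad v q" "j q = pad w q" if "q < k" for q
    using assms(1-4) that by (auto simp: cyl_iff pad_def)
  show "i \<noteq> j" using iq[OF pk] pp by auto
  have "(LEAST q. i q \<noteq> j q) = p"
  proof (rule Least_equality)
    show "i p \<noteq> j p" using iq[OF pk] pp by auto
    fix q assume "i q \<noteq> j q"
    then show "p \<le> q" using iq[of q] less[of q] pk by (metis less_trans not_le)
  qed
  then show "common_prefix i j = pref (pad v) p" unfolding common_prefix_def pref_def using iq pk by simp
qed

text \<open>For two points of one cylinder only a lower bound on the prefix length is available; it
  bounds their distance from above, the direction that the energy requires.\<close>

lemma common_prefix_cyl_same:
  assumes "i \<in> cyl m v" "j \<in> cyl m v" "i \<noteq> j"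
  shows "length v \<le> length (common_prefix i j)" "set (common_prefix i j) \<subseteq> {1..m}"
proof -
  have "\<exists>q. i q \<noteq> j q" using assms(3) by auto
  then have q: "i (LEAST q. i q \<noteq> j q) \<noteq> j (LEAST q. i q \<noteq> j q)" by (rule LeastI_ex)
  then show "length v \<le> length (common_prefix i j)"
    using assms(1,2) unfolding common_prefix_def by (auto simp: cyl_iff not_less[symmetric])
  show "set (common_prefix i j) \<subseteq> {1..m}"
    unfolding common_prefix_def using assms(1) by (intro set_pref) (auto simp: cyl_iff in_seqspace_iff)
qed

text \<open>Interchanging l and l' turns the single inequality into the two-sided form of
  (M).\<close>

locale measured_ifs = transversal_ifs a b m l0 R f f1 fl C \<gamma>1 \<gamma>2 \<beta> \<eta>
  for a b :: real and m :: nat and l0 :: "'a::euclidean_space" and R :: real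
    and f f1 :: "nat \<Rightarrow> 'a \<Rightarrow> real \<Rightarrow> real" and fl :: "nat \<Rightarrow> 'a \<Rightarrow> real \<Rightarrow> 'a"
    and C \<gamma>1 \<gamma>2 \<beta> \<eta> :: real +
  fixes \<mu> :: "'a \<Rightarrow> (nat \<Rightarrow> nat) measure" and c \<theta> :: real
  assumes m1: "1 \<le> m" and c0: "0 \<le> c" and \<theta>: "\<beta> \<le> \<theta>" "\<theta> \<le> 1"
    and meas_fin: "\<And>l. l \<in> ball l0 R \<Longrightarrow> finite_measure (\<mu> l)"
    and meas_sets: "\<And>l. l \<in> ball l0 R \<Longrightarrow> sets (\<mu> l) = sets (seqspace m)"
    and M: "\<And>l l' w. l \<in> ball l0 R \<Longrightarrow> l' \<in> ball l0 R \<Longrightarrow> set w \<subseteq> {1..m} \<Longrightarrow> length w \<ge> 1 \<Longrightarrow>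
       measure (\<mu> l) (cyl m w) \<le> exp (c * norm (l - l') powr \<theta> * real (length w)) * measure (\<mu> l') (cyl m w)"
begin

section \<open>Cylinder masses and the discretized band\<close>

abbreviation mass where "mass l w \<equiv> measure (\<mu> l) (cyl m w)"

lemma meas_space: "l \<in> ball l0 R \<Longrightarrow> space (\<mu> l) = space (seqspace m)"
  using meas_sets by (rule sets_eq_imp_space_eq)

lemma proj_measurable:
  assumes "l \<in> ball l0 R"
  shows "P l \<in> borel_measurable (\<mu> l)"
proof -
  have "P l \<in> borel_measurable (seqspace m)"
  proof (rule borel_measurable_LIMSEQ_metric)
    show "(\<lambda>i. comp_word f l (pref i n) a) \<in> borel_measurable (seqspace m)" for n
      by (rule measurable_pref)
    fix i assume "i \<in> space (seqspace m)"
    then show "(\<lambda>n. comp_word f l (pref i n) a) \<longlonglongrightarrow> P l i"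
      by (intro proj_lim assms) (auto simp: in_seqspace_iff)
  qed
  then show ?thesis using measurable_cong_sets[OF meas_sets[OF assms] refl] by blast
qed

lemma integral_pref:
  fixes \<phi> :: "nat list \<Rightarrow> real"
  assumes l: "l \<in> ball l0 R"
  shows "integrable (\<mu> l) (\<lambda>i. \<phi> (pref i k))" "(\<integral>i. \<phi> (pref i k) \<partial>\<mu> l) = (\<Sum>w\<in>words m k. \<phi> w * mass l w)"
proof -
  interpret finite_measure "\<mu> l" by (rule meas_fin[OF l])
  have sm: "cyl m w \<in> sets (\<mu> l)" for w using cyl_sets meas_sets[OF l] by simp
  have eq: "(\<Sum>w\<in>words m k. \<phi> w * indicator (cyl m w) i) = \<phi> (pref i k)" if "i \<in> space (\<mu> l)" for i
    using sum_indicator_cyl that meas_space[OF l] by simp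
  have int: "integrable (\<mu> l) (\<lambda>i. \<phi> w * indicator (cyl m w) i)" for w
    using sm by (intro integrable_mult_right integrable_real_indicator) (auto simp: less_top[symmetric])
  show "integrable (\<mu> l) (\<lambda>i. \<phi> (pref i k))"
  proof -
    have "integrable (\<mu> l) (\<lambda>i. \<Sum>w\<in>words m k. \<phi> w * indicator (cyl m w) i)"
      using int by (intro Bochner_Integration.integrable_sum)
    moreover have "integrable (\<mu> l) (\<lambda>i. \<Sum>w\<in>words m k. \<phi> w * indicator (cyl m w) i) \<longleftrightarrow> integrable (\<mu> l) (\<lambda>i. \<phi> (pref i k))"
      by (rule Bochner_Integration.integrable_cong[OF refl]) (rule eq)
    ultimately show ?thesis by simp
  qed
  have "(\<integral>i. \<phi> (pref i k) \<partial>\<mu> l) = (\<integral>i. (\<Sum>w\<in>words m k. \<phi> w * indicator (cyl m w) i) \<partial>\<mu> l)"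
    by (intro Bochner_Integration.integral_cong refl eq[symmetric])
  also have "\<dots> = (\<Sum>w\<in>words m k. \<phi> w * mass l w)"
    using int sm by (subst Bochner_Integration.integral_sum) auto
  finally show "(\<integral>i. \<phi> (pref i k) \<partial>\<mu> l) = (\<Sum>w\<in>words m k. \<phi> w * mass l w)" .
qed

text \<open>(M) at length 1, summed over the cylinders of single letters. It makes the
  discretization error uniform over the ball.\<close>

lemma total_mass_le:
  assumes l: "l \<in> ball l0 R"
  shows "measure (\<mu> l) (space (\<mu> l)) \<le> exp c * measure (\<mu> l0) (space (\<mu> l0))"
proof -
  have tot: "measure (\<mu> l) (space (\<mu> l)) = (\<Sum>w\<in>words m 1. mass l w)" if "l \<in> ball l0 R" for l
    using integral_pref(2)[OF that, of "\<lambda>_. 1" 1] by simp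
  have "norm (l - l0) powr \<theta> \<le> 1"
    using B1[OF l0_in l] \<theta> \<beta> by (intro powr_le1) auto
  then have "c * norm (l - l0) powr \<theta> * real 1 \<le> c" using mult_left_mono[OF _ c0] by fastforce
  then have e: "exp (c * norm (l - l0) powr \<theta> * real 1) \<le> exp c" by simp
  have "(\<Sum>w\<in>words m 1. mass l w) \<le> (\<Sum>w\<in>words m 1. exp c * mass l0 w)"
  proof (rule sum_mono)
    fix w assume "w \<in> words m 1"
    then have "mass l w \<le> exp (c * norm (l - l0) powr \<theta> * real 1) * mass l0 w"
      using M[OF l l0_in, of w] by (auto simp: words_def)
    also have "\<dots> \<le> exp c * mass l0 w" using e by (intro mult_right_mono) auto
    finally show "mass l w \<le> exp c * mass l0 w" .
  qed
  then show ?thesis unfolding tot[OF l] tot[OF l0_in] by (simp add: sum_distrib_left)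
qed

definition Sdisc :: "real \<Rightarrow> nat \<Rightarrow> 'a \<Rightarrow> real" where
  "Sdisc N k l = (\<Sum>v\<in>words m k. \<Sum>w\<in>words m k. mass l v * mass l w * wavelet (N * (P l (pad v) - P l (pad w))))"

text \<open>The sequence and its padded prefix share the first k letters, so both projections lie
  within \<open>\<gamma>2 ^ k * (b - a)\<close> of the same finite composition.\<close>

lemma proj_pad:
  assumes "i \<in> space (seqspace m)" "l \<in> ball l0 R"
  shows "\<bar>P l i - P l (pad (pref i k))\<bar> \<le> 2 * (\<gamma>2 ^ k * (b - a))"
proof -
  have i: "\<forall>n. i n \<in> {1..m}" using assms(1) by (simp add: in_seqspace_iff)
  have pi: "\<forall>n. pad (pref i k) n \<in> {1..m}" by (intro pad_in set_pref i m1)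
  show ?thesis using proj_approx[OF i assms(2), of k] proj_approx[OF pi assms(2), of k] pref_pad[of "pref i k"] by simp
qed

text \<open>The constant 8 is the Lipschitz constant 2 of the wavelet times 2 + 2 from
  \<open>proj_pad\<close> in the two variables.\<close>

lemma band_discretize:
  assumes l: "l \<in> ball l0 R" and N: "0 < N"
  shows "band (distr (\<mu> l) borel (P l)) N \<le> Sdisc N k l + 8 * N * (\<gamma>2 ^ k * (b - a)) * (measure (\<mu> l) (space (\<mu> l)))\<^sup>2"
proof -
  interpret finite_measure "\<mu> l" by (rule meas_fin[OF l])
  interpret PF: finite_measure "\<mu> l \<Otimes>\<^sub>M \<mu> l" by (rule finite_measure_pair_measure) (rule meas_fin[OF l])+
  interpret PS: pair_sigma_finite "\<mu> l" "\<mu> l" ..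
  have [measurable]: "P l \<in> borel_measurable (\<mu> l)" by (rule proj_measurable[OF l])
  interpret D: finite_measure "distr (\<mu> l) borel (P l)" by (rule finite_measure_distr) measurable
  have "band (distr (\<mu> l) borel (P l)) N = (\<integral>p. wavelet (N * (P l (fst p) - P l (snd p))) \<partial>(\<mu> l \<Otimes>\<^sub>M \<mu> l))"
    unfolding band_def
    by (subst pair_measure_distr) (auto simp: integral_distr case_prod_beta D.sigma_finite_measure_axioms)
  also have "\<dots> = (\<integral>i. (\<integral>j. wavelet (N * (P l i - P l j)) \<partial>\<mu> l) \<partial>\<mu> l)"
    by (subst PS.integral_fst'[symmetric]) (auto intro!: PF.integrable_const_bound[where B=1] simp: abs_wavelet_le_1)
  also have "\<dots> \<le> (\<integral>i. (\<integral>j. wavelet (N * (P l (pad (pref i k)) - P l (pad (pref j k)))) + 8 * N * (\<gamma>2 ^ k * (b - a)) \<partial>\<mu> l) \<partial>\<mu> l)"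
  proof -
    let ?\<phi> = "\<lambda>v w. wavelet (N * (P l (pad v) - P l (pad w)))"
    have i1: "integrable (\<mu> l) (\<lambda>j. wavelet (N * (P l i - P l j)))" for i
      by (intro integrable_const_bound[where B=1]) (auto simp: abs_wavelet_le_1)
    have i2: "integrable (\<mu> l) (\<lambda>j. ?\<phi> v (pref j k) + 8 * N * (\<gamma>2 ^ k * (b - a)))" for v
      using integral_pref(1)[OF l, of "?\<phi> v"] by auto
    have i3: "integrable (\<mu> l) (\<lambda>i. \<integral>j. wavelet (N * (P l i - P l j)) \<partial>\<mu> l)"
    proof -
      have "integrable (\<mu> l \<Otimes>\<^sub>M \<mu> l) (\<lambda>p. wavelet (N * (P l (fst p) - P l (snd p))))"
        by (intro PF.integrable_const_bound[where B=1]) (auto simp: abs_wavelet_le_1)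
      from PS.integrable_fst'[OF this] show ?thesis by simp
    qed
    have i4: "integrable (\<mu> l) (\<lambda>i. \<integral>j. ?\<phi> (pref i k) (pref j k) + 8 * N * (\<gamma>2 ^ k * (b - a)) \<partial>\<mu> l)"
      by (rule integral_pref(1)[OF l, of "\<lambda>v. \<integral>j. ?\<phi> v (pref j k) + 8 * N * (\<gamma>2 ^ k * (b - a)) \<partial>\<mu> l"])
    show ?thesis
    proof (intro integral_mono i1 i2 i3 i4)
      fix i j assume ij: "i \<in> space (\<mu> l)" "j \<in> space (\<mu> l)"
      have "\<bar>wavelet (N * (P l i - P l j)) - ?\<phi> (pref i k) (pref j k)\<bar>
        \<le> 2 * \<bar>N * (P l i - P l j) - N * (P l (pad (pref i k)) - P l (pad (pref j k)))\<bar>"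
        by (rule wavelet_lipschitz)
      also have "\<dots> = 2 * N * \<bar>(P l i - P l (pad (pref i k))) - (P l j - P l (pad (pref j k)))\<bar>"
        using N by (simp add: abs_mult flip: right_diff_distrib)
      also have "\<dots> \<le> 2 * N * (2 * (\<gamma>2 ^ k * (b - a)) + 2 * (\<gamma>2 ^ k * (b - a)))"
      proof -
        have "\<bar>P l i - P l (pad (pref i k))\<bar> \<le> 2 * (\<gamma>2 ^ k * (b - a))" "\<bar>P l j - P l (pad (pref j k))\<bar> \<le> 2 * (\<gamma>2 ^ k * (b - a))"
          using ij meas_space[OF l] by (auto intro!: proj_pad l simp del: mem_ball)
        then have "\<bar>(P l i - P l (pad (pref i k))) - (P l j - P l (pad (pref j k)))\<bar> \<le> 2 * (\<gamma>2 ^ k * (b - a)) + 2 * (\<gamma>2 ^ k * (b - a))"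
          by linarith
        then show ?thesis using N by (intro mult_left_mono) auto
      qed
      also have "\<dots> = 8 * N * (\<gamma>2 ^ k * (b - a))" by simp
      finally show "wavelet (N * (P l i - P l j)) \<le> ?\<phi> (pref i k) (pref j k) + 8 * N * (\<gamma>2 ^ k * (b - a))" by linarith
    qed
  qed
  also have "\<dots> = Sdisc N k l + 8 * N * (\<gamma>2 ^ k * (b - a)) * (measure (\<mu> l) (space (\<mu> l)))\<^sup>2"
  proof -
    let ?\<phi> = "\<lambda>v w. wavelet (N * (P l (pad v) - P l (pad w)))"
    let ?c = "8 * N * (\<gamma>2 ^ k * (b - a))" and ?t = "measure (\<mu> l) (space (\<mu> l))"
    have "(\<integral>i. (\<integral>j. ?\<phi> (pref i k) (pref j k) + ?c \<partial>\<mu> l) \<partial>\<mu> l) = (\<integral>i. (\<Sum>w\<in>words m k. ?\<phi> (pref i k) w * mass l w) + ?c * ?t \<partial>\<mu> l)"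
    proof (intro Bochner_Integration.integral_cong refl)
      fix i
      show "(\<integral>j. ?\<phi> (pref i k) (pref j k) + ?c \<partial>\<mu> l) = (\<Sum>w\<in>words m k. ?\<phi> (pref i k) w * mass l w) + ?c * ?t"
        using integral_pref[OF l, of "?\<phi> (pref i k)" k] by simp
    qed
    also have "\<dots> = (\<integral>i. (\<lambda>v. (\<Sum>w\<in>words m k. ?\<phi> v w * mass l w)) (pref i k) \<partial>\<mu> l) + ?c * ?t * ?t"
      using integral_pref(1)[OF l, of "\<lambda>v. (\<Sum>w\<in>words m k. ?\<phi> v w * mass l w)" k] by (simp add: mult.commute)
    also have "(\<integral>i. (\<lambda>v. (\<Sum>w\<in>words m k. ?\<phi> v w * mass l w)) (pref i k) \<partial>\<mu> l) = (\<Sum>v\<in>words m k. (\<Sum>w\<in>words m k. ?\<phi> v w * mass l w) * mass l v)"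
      by (rule integral_pref(2)[OF l])
    also have "\<dots> = Sdisc N k l" unfolding Sdisc_def sum_distrib_right by (intro sum.cong refl) (simp add: ac_simps)
    finally show ?thesis by (simp add: power2_eq_square)
  qed
  finally show ?thesis .
qed

section \<open>Comparison with the energy at the centre\<close>

definition energy_kernel :: "real \<Rightarrow> (nat \<Rightarrow> nat) \<Rightarrow> (nat \<Rightarrow> nat) \<Rightarrow> ennreal" where
  "energy_kernel \<alpha> i j = (if symb_dist f {a..b} l0 i j = 0 then \<infinity> else ennreal (symb_dist f {a..b} l0 i j powr (- \<alpha>)))"

lemma energy_kernel_ge:
  assumes "symb_dist f {a..b} l0 i j \<le> r" "0 \<le> symb_dist f {a..b} l0 i j" "0 < \<alpha>"
  shows "ennreal (r powr (- \<alpha>)) \<le> energy_kernel \<alpha> i j"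
proof (cases "symb_dist f {a..b} l0 i j = 0")
  case False
  then show ?thesis unfolding energy_kernel_def using assms
    by (auto intro!: ennreal_leI powr_mono2')
qed (simp add: energy_kernel_def)

text \<open>The sum is the double integral of a kernel constant on products of cylinders, and its
  pointwise domination survives both integrations.\<close>

lemma energy_sum_le:
  assumes "\<And>v w i j. v \<in> words m k \<Longrightarrow> w \<in> words m k \<Longrightarrow> i \<in> cyl m v \<Longrightarrow> j \<in> cyl m w \<Longrightarrow> ennreal (bb v w) \<le> energy_kernel \<alpha> i j"
    and bb: "\<And>v w. 0 \<le> bb v w"
  shows "ennreal (\<Sum>v\<in>words m k. \<Sum>w\<in>words m k. mass l0 v * mass l0 w * bb v w)
    \<le> (\<integral>\<^sup>+ i. (\<integral>\<^sup>+ j. energy_kernel \<alpha> i j \<partial>\<mu> l0) \<partial>\<mu> l0)"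
proof -
  interpret finite_measure "\<mu> l0" by (rule meas_fin[OF l0_in])
  let ?s = "\<lambda>v. \<Sum>w\<in>words m k. bb v w * mass l0 w"
  have "(\<Sum>v\<in>words m k. \<Sum>w\<in>words m k. mass l0 v * mass l0 w * bb v w) = (\<Sum>v\<in>words m k. ?s v * mass l0 v)"
    unfolding sum_distrib_right by (intro sum.cong refl) (simp add: ac_simps)
  also have "\<dots> = (\<integral>i. ?s (pref i k) \<partial>\<mu> l0)" by (rule integral_pref(2)[OF l0_in, symmetric])
  also have "ennreal \<dots> = (\<integral>\<^sup>+ i. ennreal (?s (pref i k)) \<partial>\<mu> l0)"
    using integral_pref(1)[OF l0_in] bb by (intro nn_integral_eq_integral[symmetric]) (auto intro!: AE_I2 sum_nonneg)
  also have "\<dots> \<le> (\<integral>\<^sup>+ i. (\<integral>\<^sup>+ j. energy_kernel \<alpha> i j \<partial>\<mu> l0) \<partial>\<mu> l0)"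
  proof (rule nn_integral_mono)
    fix i assume i: "i \<in> space (\<mu> l0)"
    have "?s (pref i k) = (\<integral>j. bb (pref i k) (pref j k) \<partial>\<mu> l0)" by (rule integral_pref(2)[OF l0_in, symmetric])
    then have "ennreal (?s (pref i k)) = (\<integral>\<^sup>+ j. ennreal (bb (pref i k) (pref j k)) \<partial>\<mu> l0)"
      using integral_pref(1)[OF l0_in] bb by (subst nn_integral_eq_integral) (auto intro!: AE_I2)
    also have "\<dots> \<le> (\<integral>\<^sup>+ j. energy_kernel \<alpha> i j \<partial>\<mu> l0)"
    proof (rule nn_integral_mono)
      fix j assume j: "j \<in> space (\<mu> l0)"
      show "ennreal (bb (pref i k) (pref j k)) \<le> energy_kernel \<alpha> i j"
        using i j meas_space[OF l0_in] by (intro assms(1) pref_in_words) (auto simp: cyl_def)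
    qed
    finally show "ennreal (?s (pref i k)) \<le> (\<integral>\<^sup>+ j. energy_kernel \<alpha> i j \<partial>\<mu> l0)" .
  qed
  finally show ?thesis .
qed

definition Cd where "Cd = exp (Kd * (2 * (b - a))) * (b - a)"

text \<open>The first summand serves pairs of distinct words, the second the diagonal pairs.\<close>

definition Ctot :: "real \<Rightarrow> real" where
  "Ctot \<alpha>0 = Cpair c * Cd powr \<alpha>0 + measure lborel (cball l0 (2 * R + 1 + norm l0)) * (b - a) powr \<alpha>0"

text \<open>The number bb is a lower bound for the energy kernel on the product of the two
  cylinders, so that the bounds sum to at most the energy. Two exponents are needed: \<alpha> obeys
  the cap and governs the decay in N, while \<alpha>0 is an exponent of finite energy that may
  exceed the cap.\<close>

lemma pair_energy:
  assumes vw: "v \<in> words m k" "w \<in> words m k" and k: "1 \<le> k"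
    and N: "1 \<le> N" "\<gamma>2 ^ k \<le> 1 / N" and \<alpha>: "0 < \<alpha>" "\<alpha> \<le> 1 + \<beta>" "\<alpha> \<le> \<alpha>0"
    and R1: "0 < R1" "2 * R1 < R" "R1 \<le> 1/2" "48 * H * R1 powr \<beta> \<le> \<eta>" "4 * K1 * R1 \<le> \<eta>"
    and E: "E = exp (Cexp c * real k * R1 powr \<theta>)"
  shows "\<exists>bb. 0 \<le> bb \<and> (\<forall>i\<in>cyl m v. \<forall>j\<in>cyl m w. ennreal bb \<le> energy_kernel \<alpha>0 i j) \<and>
     integrable lborel (\<lambda>l. cutoff R1 l * (mass l v * mass l w) * wavelet (N * (P l (pad v) - P l (pad w)))) \<and>
     \<bar>\<integral>l. cutoff R1 l * (mass l v * mass l w) * wavelet (N * (P l (pad v) - P l (pad w))) \<partial>lborel\<bar>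
       \<le> Ctot \<alpha>0 * real k * E ^ 6 * N powr (- \<alpha>) * (mass l0 v * mass l0 w * bb)"
proof -
  have \<theta>0: "0 < \<theta>" using \<theta> \<beta> by linarith
  let ?W = "\<lambda>l. mass l v * mass l w"
  have v: "set v \<subseteq> {1..m}" "length v = k" and w: "set w \<subseteq> {1..m}" "length w = k" using vw by (auto simp: words_def)
  have pv: "\<forall>n. pad v n \<in> {1..m}" and pw: "\<forall>n. pad w n \<in> {1..m}" using pad_in v w m1 by auto
  have W0: "0 \<le> ?W l" for l by simp
  have WM: "?W l \<le> exp (2 * c * real k * norm (l - l') powr \<theta>) * ?W l'" if "l \<in> ball l0 R" "l' \<in> ball l0 R" for l l'
  proof -
    have e2: "exp (2 * c * real k * norm (l - l') powr \<theta>) = exp (c * norm (l - l') powr \<theta> * real k) * exp (c * norm (l - l') powr \<theta> * real k)"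
      by (simp add: algebra_simps flip: exp_add)
    have "?W l \<le> (exp (c * norm (l - l') powr \<theta> * real k) * mass l' v) * (exp (c * norm (l - l') powr \<theta> * real k) * mass l' w)"
      using M[OF that v(1)] M[OF that w(1)] v w k by (intro mult_mono) auto
    also have "\<dots> = exp (2 * c * real k * norm (l - l') powr \<theta>) * ?W l'"
      unfolding e2 by (simp only: mult_ac)
    finally show ?thesis .
  qed
  have E1: "1 \<le> E" by (rule weight_bounds(1)[of ?W c k \<theta> R1, OF W0 WM c0 \<theta>0 \<theta>(2) R1(1) _ E]) (use R1 in auto)
  have WE: "?W l \<le> E * ?W l0" if "l \<in> ball l0 R1" for l
    by (rule weight_bounds(2)[of ?W c k \<theta> R1, OF W0 WM c0 \<theta>0 \<theta>(2) R1(1) _ E that]) (use R1 in auto)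
  let ?V = "measure lborel (cball l0 (2 * R + 1 + norm l0))"
  have Cd0: "0 < Cd" unfolding Cd_def using ab by simp
  have Cp: "0 \<le> Cpair c" unfolding Cpair_def Cosc_def using c0 Kd K1(1) H(1) \<eta> by simp
  have \<alpha>0: "0 < \<alpha>0" using \<alpha> by simp
  show ?thesis
  proof (cases "v = w")
    case False
    define p where "p = (LEAST n. pad v n \<noteq> pad w n)"
    have padv: "pad v \<in> cyl m v" "pad w \<in> cyl m w" using pv pw by (auto simp: cyl_iff in_seqspace_iff pad_def)
    note cp = common_prefix_cyl[OF _ _ v(2) w(2) False p_def]
    define x0 where "x0 = P l0 (\<lambda>n. pad v (n + p))"
    define y0 where "y0 = P l0 (\<lambda>n. pad w (n + p))"
    define G where "G = \<bar>slope (pref (pad v) p) l0 x0 y0\<bar>"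
    note sp = set_pref[OF pv, of p]
    have x0: "x0 \<in> {a..b}" and y0: "y0 \<in> {a..b}" unfolding x0_def y0_def using pv pw by (auto intro!: proj_in l0_in simp del: atLeastAtMost_iff)
    have G: "0 < G" "G \<le> 1" unfolding G_def using slope_bd[OF sp l0_in x0 y0] by auto
    note pib = pair_integral_bound[OF pv pw cp(3)[OF padv] cp(2)[OF padv] _ k W0 WM c0 \<theta> _ \<alpha>(1,2) R1 E x0_def y0_def, of N]
    show ?thesis
    proof (intro exI[of _ "(Cd * G) powr (- \<alpha>0)"] conjI ballI)
      \<comment> \<open>\<open>Cd * G\<close> bounds the diameter of the image of the common prefix,
        which is the symbolic distance for every pair of points from the two cylinders.\<close>
      show "0 \<le> (Cd * G) powr (- \<alpha>0)" by simp
      fix i j assume ij: "i \<in> cyl m v" "j \<in> cyl m w"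
      have sd: "symb_dist f {a..b} l0 i j = diameter (comp_word f l0 (pref (pad v) p) ` {a..b})"
        unfolding symb_dist_def using cp(4,5)[OF ij] by simp
      show "ennreal ((Cd * G) powr (- \<alpha>0)) \<le> energy_kernel \<alpha>0 i j"
      proof (rule energy_kernel_ge[OF _ _ \<alpha>0])
        show "symb_dist f {a..b} l0 i j \<le> Cd * G"
          unfolding sd Cd_def G_def by (rule diameter_le_slope[OF sp l0_in x0 y0])
        show "0 \<le> symb_dist f {a..b} l0 i j" unfolding sd
          by (intro diameter_ge_0 bounded_subset[OF bounded_closed_interval[of a b]]) (use comp_word_in[OF sp l0_in] in blast)
      qed
    next
      show "integrable lborel (\<lambda>l. cutoff R1 l * ?W l * wavelet (N * (P l (pad v) - P l (pad w))))"
        by (rule pib(1)) (use cp(1)[OF padv] N in auto)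
      have "\<bar>\<integral>l. cutoff R1 l * ?W l * wavelet (N * (P l (pad v) - P l (pad w))) \<partial>lborel\<bar>
        \<le> Cpair c * real k * E ^ 6 * ?W l0 * (N * G) powr (- \<alpha>)"
        unfolding G_def by (rule pib(2)) (use cp(1)[OF padv] N in auto)
      also have "\<dots> \<le> Cpair c * real k * E ^ 6 * ?W l0 * (N powr (- \<alpha>) * (Cd powr \<alpha>0 * (Cd * G) powr (- \<alpha>0)))"
      proof -
        have "(N * G) powr (- \<alpha>) = N powr (- \<alpha>) * G powr (- \<alpha>)" using N G by (simp add: powr_mult)
        \<comment> \<open>A slope is at most 1, so the exponent may be raised from \<alpha> to
          \<alpha>0 pair by pair, without comparing energies of different exponents.\<close>
        also have "G powr (- \<alpha>) \<le> G powr (- \<alpha>0)" using G \<alpha> by (intro powr_mono') auto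
        also have "G powr (- \<alpha>0) = Cd powr \<alpha>0 * (Cd * G) powr (- \<alpha>0)"
          using Cd0 G by (simp add: powr_mult powr_minus field_simps)
        finally have "(N * G) powr (- \<alpha>) \<le> N powr (- \<alpha>) * (Cd powr \<alpha>0 * (Cd * G) powr (- \<alpha>0))"
          by (simp add: mult_left_mono)
        then show ?thesis using Cp E1 by (intro mult_left_mono) auto
      qed
      also have "\<dots> = (Cpair c * Cd powr \<alpha>0) * (real k * E ^ 6 * N powr (- \<alpha>) * (?W l0 * (Cd * G) powr (- \<alpha>0)))" by simp
      also have "\<dots> \<le> Ctot \<alpha>0 * (real k * E ^ 6 * N powr (- \<alpha>) * (?W l0 * (Cd * G) powr (- \<alpha>0)))"
        unfolding Ctot_def using E1 by (intro mult_right_mono) auto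
      finally show "\<bar>\<integral>l. cutoff R1 l * ?W l * wavelet (N * (P l (pad v) - P l (pad w))) \<partial>lborel\<bar>
       \<le> Ctot \<alpha>0 * real k * E ^ 6 * N powr (- \<alpha>) * (?W l0 * (Cd * G) powr (- \<alpha>0))" by (simp add: mult.assoc)
    qed
  next
    case True
    \<comment> \<open>On the diagonal the wavelet is the constant \<open>wavelet 0\<close> and does
      not oscillate; the gain must come from the small diameter of the cylinder.\<close>
    let ?F = "\<lambda>l. cutoff R1 l * ?W l * wavelet (N * (P l (pad v) - P l (pad w)))"
    have Feq: "?F = (\<lambda>l. cutoff R1 l * ?W l * wavelet 0)" using True by simp
    have Fsup: "?F l = 0" if "l \<notin> ball l0 R1" for l using cutoff_eq_0[OF that] by simp
    have FM: "\<bar>?F l\<bar> \<le> E * ?W l0" for l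
    proof (cases "l \<in> ball l0 R1")
      case True
      have "\<bar>?F l\<bar> = cutoff R1 l * ?W l * \<bar>wavelet (N * (P l (pad v) - P l (pad w)))\<bar>"
        using cutoff_bd(1)[of R1 l] by (simp add: abs_mult)
      also have "\<dots> \<le> (1 * (E * ?W l0)) * 1"
        by (rule mult_mono[OF mult_mono[OF _ WE[OF True]] abs_wavelet_le_1]) (use cutoff_bd[of R1 l] R1 E1 in auto)
      finally show ?thesis by simp
    next
      case False
      then show ?thesis unfolding Fsup[OF False] using E1 by simp
    qed
    have meas: "?F \<in> borel_measurable borel"
    proof -
      have "continuous_on (ball l0 R1) ?W"
      proof (rule holder_continuous_on[OF _ \<theta>0])
        fix l l' assume "l \<in> ball l0 R1" "l' \<in> ball l0 R1"
        then show "\<bar>?W l - ?W l'\<bar> \<le> (2 * c * real k * E\<^sup>2 * ?W l0) * norm (l - l') powr \<theta>"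
          by (intro weight_bounds(3)[of ?W c k \<theta> R1, OF W0 WM c0 \<theta>0 \<theta>(2) R1(1) _ E]) (use R1 in auto)
      qed
      then have "continuous_on (ball l0 R1) (\<lambda>l. cutoff R1 l * ?W l * wavelet 0)"
        by (intro continuous_on_mult[of _ "\<lambda>l. cutoff R1 l * ?W l"] continuous_on_mult[of _ "cutoff R1"] continuous_on_cutoff continuous_on_const)
      then have "continuous_on (ball l0 R1) ?F" by (simp only: Feq)
      then have "(\<lambda>l. indicator (ball l0 R1) l *\<^sub>R ?F l) \<in> borel_measurable borel"
        by (intro borel_measurable_continuous_on_indicator) auto
      moreover have "(\<lambda>l. indicator (ball l0 R1) l *\<^sub>R ?F l) = ?F"
        using Fsup by (auto simp: indicator_def fun_eq_iff)
      ultimately show ?thesis by simp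
    qed
    note triv = norm_integral_le_ball[of ?F "ball l0 R1", OF meas bounded_ball _ FM Fsup]
    define r where "r = \<gamma>2 ^ k * (b - a)"
    have r: "0 < r" unfolding r_def using \<gamma> ab by simp
    show ?thesis
    proof (intro exI[of _ "r powr (- \<alpha>0)"] conjI ballI)
      show "0 \<le> r powr (- \<alpha>0)" by simp
      fix i j assume ij: "i \<in> cyl m v" "j \<in> cyl m w"
      show "ennreal (r powr (- \<alpha>0)) \<le> energy_kernel \<alpha>0 i j"
      proof (cases "i = j")
        case True
        then show ?thesis unfolding energy_kernel_def symb_dist_def by simp
      next
        case False
        note cs = common_prefix_cyl_same[OF ij(1) ij(2)[folded \<open>v = w\<close>] False]
        have sd: "symb_dist f {a..b} l0 i j = diameter (comp_word f l0 (common_prefix i j) ` {a..b})"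
          unfolding symb_dist_def using False by simp
        show ?thesis
        proof (rule energy_kernel_ge[OF _ _ \<alpha>0])
          have "symb_dist f {a..b} l0 i j \<le> \<gamma>2 ^ length (common_prefix i j) * (b - a)"
            unfolding sd by (rule diameter_le_pow[OF cs(2) l0_in])
          also have "\<dots> \<le> r" unfolding r_def using cs(1) v \<gamma> ab by (intro mult_right_mono power_decreasing) auto
          finally show "symb_dist f {a..b} l0 i j \<le> r" .
          show "0 \<le> symb_dist f {a..b} l0 i j" unfolding sd
            by (intro diameter_ge_0 bounded_subset[OF bounded_closed_interval[of a b]]) (use comp_word_in[OF cs(2) l0_in] in blast)
        qed
      qed
    next
      show "integrable lborel ?F" by (rule triv(1)) auto
      have "\<bar>\<integral>l. ?F l \<partial>lborel\<bar> \<le> measure lborel (ball l0 R1) * (E * ?W l0)" by (rule triv(2)) auto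
      also have "\<dots> \<le> ?V * (E * ?W l0)"
      proof (intro mult_right_mono measure_mono_fmeasurable)
        have "R1 \<le> 2 * R + 1 + norm l0" using R R1 norm_ge_zero[of l0] by linarith
        then show "ball l0 R1 \<subseteq> cball l0 (2 * R + 1 + norm l0)" by auto
      qed (use fmeasurable_lborel_cball E1 in auto)
      also have "\<dots> \<le> ?V * (real k * E ^ 6 * ?W l0 * ((b - a) powr \<alpha>0 * N powr (- \<alpha>) * r powr (- \<alpha>0)))"
      proof -
        \<comment> \<open>The length k is so large that r <= (b - a) / N, hence r^(-\<alpha>0)
          already compensates the missing decay in N.\<close>
        have "r powr \<alpha>0 \<le> ((b - a) * (1 / N)) powr \<alpha>0"
          unfolding r_def using mult_left_mono[OF N(2), of "b - a"] ab \<gamma> \<alpha>0 by (intro powr_mono2) (auto simp: mult.commute)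
        also have "\<dots> = (b - a) powr \<alpha>0 * N powr (- \<alpha>0)"
          using ab N by (simp add: powr_mult powr_divide powr_minus_divide)
        also have "N powr (- \<alpha>0) \<le> N powr (- \<alpha>)" using N \<alpha> by (intro powr_mono) auto
        finally have "r powr \<alpha>0 * r powr (- \<alpha>0) \<le> (b - a) powr \<alpha>0 * N powr (- \<alpha>) * r powr (- \<alpha>0)"
          by (intro mult_right_mono) (auto simp: mult_left_mono)
        then have one: "1 \<le> (b - a) powr \<alpha>0 * N powr (- \<alpha>) * r powr (- \<alpha>0)"
          using r by (simp flip: powr_add)
        have "1 * E ^ 1 \<le> real k * E ^ 6" using k E1 by (intro mult_mono power_increasing) auto
        then have kE: "E * ?W l0 \<le> real k * E ^ 6 * ?W l0" by (intro mult_right_mono) auto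
        have "E * ?W l0 * 1 \<le> real k * E ^ 6 * ?W l0 * ((b - a) powr \<alpha>0 * N powr (- \<alpha>) * r powr (- \<alpha>0))"
          by (rule mult_mono[OF kE one]) (use E1 in auto)
        then show ?thesis by (intro mult_left_mono) auto
      qed
      also have "\<dots> = (?V * (b - a) powr \<alpha>0) * (real k * E ^ 6 * N powr (- \<alpha>) * (?W l0 * r powr (- \<alpha>0)))" by simp
      also have "\<dots> \<le> Ctot \<alpha>0 * (real k * E ^ 6 * N powr (- \<alpha>) * (?W l0 * r powr (- \<alpha>0)))"
        unfolding Ctot_def using E1 Cp by (intro mult_right_mono) auto
      finally show "\<bar>\<integral>l. ?F l \<partial>lborel\<bar> \<le> Ctot \<alpha>0 * real k * E ^ 6 * N powr (- \<alpha>) * (?W l0 * r powr (- \<alpha>0))" by (simp add: mult.assoc)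
    qed
  qed
qed

lemma Ctot_nonneg: "0 \<le> Ctot \<alpha>0"
  unfolding Ctot_def Cpair_def Cosc_def using c0 Kd K1(1) H(1) \<eta> by simp

lemma Sdisc_integral:
  assumes k: "1 \<le> k"
    and N: "1 \<le> N" "\<gamma>2 ^ k \<le> 1 / N" and \<alpha>: "0 < \<alpha>" "\<alpha> \<le> 1 + \<beta>" "\<alpha> \<le> \<alpha>0"
    and R1: "0 < R1" "2 * R1 < R" "R1 \<le> 1/2" "48 * H * R1 powr \<beta> \<le> \<eta>" "4 * K1 * R1 \<le> \<eta>"
    and E: "E = exp (Cexp c * real k * R1 powr \<theta>)"
    and en: "(\<integral>\<^sup>+ i. (\<integral>\<^sup>+ j. energy_kernel \<alpha>0 i j \<partial>\<mu> l0) \<partial>\<mu> l0) \<le> ennreal En" "0 \<le> En"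
  shows "integrable lborel (\<lambda>l. cutoff R1 l * Sdisc N k l)"
    "(\<integral>l. cutoff R1 l * Sdisc N k l \<partial>lborel) \<le> Ctot \<alpha>0 * real k * E ^ 6 * N powr (- \<alpha>) * En"
proof -
  let ?F = "\<lambda>v w l. cutoff R1 l * (mass l v * mass l w) * wavelet (N * (P l (pad v) - P l (pad w)))"
  let ?Q = "Ctot \<alpha>0 * real k * E ^ 6 * N powr (- \<alpha>)"
  define \<Phi> where "\<Phi> v w bb \<longleftrightarrow> 0 \<le> bb \<and> (\<forall>i\<in>cyl m v. \<forall>j\<in>cyl m w. ennreal bb \<le> energy_kernel \<alpha>0 i j) \<and>
     integrable lborel (?F v w) \<and> \<bar>\<integral>l. ?F v w l \<partial>lborel\<bar> \<le> ?Q * (mass l0 v * mass l0 w * bb)" for v w bb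
  \<comment> \<open>One kernel bound is chosen for each pair of words, so that all bounds enter a
    single sum.\<close>
  define bb where "bb v w = (SOME x. \<Phi> v w x)" for v w
  have \<Phi>: "\<Phi> v w (bb v w)" if "v \<in> words m k" "w \<in> words m k" for v w
    unfolding bb_def \<Phi>_def by (rule someI_ex) (rule pair_energy[OF that k N \<alpha> R1 E])
  have bb: "0 \<le> bb v w" "\<And>i j. i \<in> cyl m v \<Longrightarrow> j \<in> cyl m w \<Longrightarrow> ennreal (bb v w) \<le> energy_kernel \<alpha>0 i j"
     "integrable lborel (?F v w)" "(\<integral>l. ?F v w l \<partial>lborel) \<le> ?Q * (mass l0 v * mass l0 w * bb v w)"
    if "v \<in> words m k" "w \<in> words m k" for v w
    using \<Phi>[OF that] unfolding \<Phi>_def by (auto dest: abs_le_D1)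
  have eq: "cutoff R1 l * Sdisc N k l = (\<Sum>v\<in>words m k. \<Sum>w\<in>words m k. ?F v w l)" for l
    unfolding Sdisc_def sum_distrib_left by (intro sum.cong refl) (simp only: mult.assoc)
  show "integrable lborel (\<lambda>l. cutoff R1 l * Sdisc N k l)"
    unfolding eq by (intro Bochner_Integration.integrable_sum bb(3))
  have "(\<integral>l. cutoff R1 l * Sdisc N k l \<partial>lborel) = (\<Sum>v\<in>words m k. \<Sum>w\<in>words m k. (\<integral>l. ?F v w l \<partial>lborel))"
    unfolding eq using bb(3)
    by (simp add: Bochner_Integration.integral_sum Bochner_Integration.integrable_sum)
  also have "\<dots> \<le> (\<Sum>v\<in>words m k. \<Sum>w\<in>words m k. ?Q * (mass l0 v * mass l0 w * bb v w))"
    by (intro sum_mono bb(4))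
  also have "\<dots> = ?Q * (\<Sum>v\<in>words m k. \<Sum>w\<in>words m k. mass l0 v * mass l0 w * bb v w)"
    by (simp add: sum_distrib_left)
  also have "\<dots> \<le> ?Q * En"
  proof (intro mult_left_mono)
    \<comment> \<open>The chosen bounds are meaningful only for words of length k; extension by zero
      provides the nonnegativity that \<open>energy_sum_le\<close> demands for all lists.\<close>
    let ?bb = "\<lambda>v w. if v \<in> words m k \<and> w \<in> words m k then bb v w else 0"
    have "ennreal (\<Sum>v\<in>words m k. \<Sum>w\<in>words m k. mass l0 v * mass l0 w * ?bb v w) \<le> ennreal En"
      by (rule order_trans[OF energy_sum_le en(1)]) (use bb(1,2) in auto)
    then show "(\<Sum>v\<in>words m k. \<Sum>w\<in>words m k. mass l0 v * mass l0 w * bb v w) \<le> En"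
      using en(2) by (simp add: ennreal_le_iff)
    have "0 \<le> E" unfolding E by simp
    then show "0 \<le> ?Q" using Ctot_nonneg by simp
  qed
  finally show "(\<integral>l. cutoff R1 l * Sdisc N k l \<partial>lborel) \<le> ?Q * En" .
qed

end

section \<open>Sobolev dimension of the projected measures\<close>

text \<open>The denominator \<open>A + 1\<close> keeps the witness positive and finite when A =
  0.\<close>

lemma small_radius:
  fixes A B s :: real
  assumes "0 \<le> A" "0 < B" "0 < s"
  shows "\<exists>r>0. \<forall>x. 0 < x \<and> x \<le> r \<longrightarrow> A * x powr s \<le> B"
proof (intro exI[of _ "(B / (A + 1)) powr (1 / s)"] conjI allI impI)
  fix x assume x: "0 < x \<and> x \<le> (B / (A + 1)) powr (1 / s)"
  then have "x powr s \<le> ((B / (A + 1)) powr (1 / s)) powr s" using assms by (intro powr_mono2) auto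
  also have "\<dots> = B / (A + 1)" using assms by (simp add: powr_powr)
  finally have "A * x powr s \<le> A * (B / (A + 1))" using assms by (intro mult_left_mono) auto
  also have "\<dots> \<le> B" using assms by (simp add: field_simps)
  finally show "A * x powr s \<le> B" .
qed (use assms in auto)

lemma summable_Suc_geometric:
  fixes x :: real
  assumes "0 \<le> x" "x < 1"
  shows "summable (\<lambda>n. real (Suc n) * x ^ n)"
  using geometric_deriv_sums[of x] assms by (auto simp: sums_iff)

context measured_ifs
begin

text \<open>The word length is K (n + 1) with K fixed beforehand; the radius is chosen afterwards so
  that E^6 grows at most like 2^(s(n+1)), where s is half the gap \<alpha> - q. The remaining half
  of the gap gives geometric decay.\<close>

lemma local_sobolev:
  assumes q: "0 < q" "q < \<alpha>" and \<alpha>: "\<alpha> \<le> 1 + \<beta>" "\<alpha> \<le> \<alpha>0"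
    and en: "(\<integral>\<^sup>+ i. (\<integral>\<^sup>+ j. energy_kernel \<alpha>0 i j \<partial>\<mu> l0) \<partial>\<mu> l0) < \<infinity>"
  shows "\<exists>r>0. AE l in lborel. l \<in> ball l0 r \<longrightarrow>
    (\<integral>\<^sup>+ t. ennreal ((cmod (char (distr (\<mu> l) borel (P l)) t))\<^sup>2 * (1 + \<bar>t\<bar>) powr (q - 1)) \<partial>lborel) < \<infinity>"
proof -
  have \<theta>0: "0 < \<theta>" using \<theta> \<beta> by linarith
  have \<alpha>pos: "0 < \<alpha>" using q by linarith
  obtain En where En: "(\<integral>\<^sup>+ i. (\<integral>\<^sup>+ j. energy_kernel \<alpha>0 i j \<partial>\<mu> l0) \<partial>\<mu> l0) = ennreal En" "0 \<le> En"
    using en by (metis ennreal_cases top.not_eq_extremum infinity_ennreal_def)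
  \<comment> \<open>With 1/16 the discretization error at scale 2^n is of order 8^(-n). It stays
    summable against 2^(q n), because q < \<alpha> <= 1 + \<beta> <= 2.\<close>
  obtain K where K: "\<gamma>2 ^ K < 1 / 16" using real_arch_pow_inv[of "1/16" \<gamma>2] \<gamma> by auto
  have K1': "1 \<le> K" using K by (cases K) auto
  have Cx: "0 \<le> Cexp c" unfolding Cexp_def using c0 Kd K1(1) by simp
  obtain r1 where r1: "0 < r1" "\<And>x. 0 < x \<Longrightarrow> x \<le> r1 \<Longrightarrow> 48 * H * x powr \<beta> \<le> \<eta>"
    using small_radius[of "48 * H" \<eta> \<beta>] H(1) \<eta> \<beta> by auto
  obtain r2 where r2: "0 < r2" "\<And>x. 0 < x \<Longrightarrow> x \<le> r2 \<Longrightarrow> 6 * Cexp c * real K * x powr \<theta> \<le> ln 2 * ((\<alpha> - q) / 2)"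
    using small_radius[of "6 * Cexp c * real K" "ln 2 * ((\<alpha> - q) / 2)" \<theta>] Cx q \<theta>0 by auto
  obtain r3 where r3: "0 < r3" "\<And>x. 0 < x \<Longrightarrow> x \<le> r3 \<Longrightarrow> 4 * K1 * x powr 1 \<le> \<eta>"
    using small_radius[of "4 * K1" \<eta> 1] K1(1) \<eta> by auto
  define R1 where "R1 = min (min r1 r2) (min r3 (min (R / 4) (1 / 2)))"
  have R1: "0 < R1" "2 * R1 < R" "R1 \<le> 1/2" "48 * H * R1 powr \<beta> \<le> \<eta>" "4 * K1 * R1 \<le> \<eta>"
    and R1': "6 * Cexp c * real K * R1 powr \<theta> \<le> ln 2 * ((\<alpha> - q) / 2)"
    using r1 r2 r3(1) r3(2)[of R1] R unfolding R1_def by (auto simp: min_le_iff_disj)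
  define k where "k n = K * Suc n" for n
  define E where "E n = exp (Cexp c * real (k n) * R1 powr \<theta>)" for n
  define s where "s = (\<alpha> - q) / 2"
  have s: "0 < s" unfolding s_def using q by simp
  have k1: "1 \<le> k n" for n unfolding k_def using K1' by simp
  have \<gamma>k: "\<gamma>2 ^ k n \<le> (1 / 16) ^ Suc n" for n
    unfolding k_def power_mult using K \<gamma> by (intro power_mono) auto
  have \<gamma>k': "\<gamma>2 ^ k n \<le> 1 / 2 ^ n" for n
  proof -
    have "(1 / 16 :: real) ^ Suc n \<le> (1 / 2) ^ Suc n" by (intro power_mono) auto
    also have "\<dots> \<le> (1 / 2) ^ n" by (intro power_decreasing) auto
    finally show ?thesis using \<gamma>k[of n] by (simp add: power_divide)
  qed
  have E6: "E n ^ 6 \<le> 2 powr (s * real (Suc n))" for n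
  proof -
    have "E n ^ 6 = exp (6 * Cexp c * real K * R1 powr \<theta> * real (Suc n))"
      unfolding E_def k_def of_nat_mult by (simp add: exp_of_nat_mult[symmetric] ac_simps del: of_nat_Suc)
    also have "\<dots> \<le> exp (ln 2 * s * real (Suc n))"
      using R1' unfolding s_def by (simp add: mult_right_mono del: of_nat_Suc)
    also have "\<dots> = 2 powr (s * real (Suc n))" by (simp add: powr_def ac_simps del: of_nat_Suc)
    finally show ?thesis .
  qed
  note SI = Sdisc_integral[OF k1 _ _ \<alpha>pos \<alpha> R1 E_def eq_refl[OF En(1)] En(2)]
  define Z0 where "Z0 = 8 * (b - a) * (exp c * measure (\<mu> l0) (space (\<mu> l0)))\<^sup>2"
  \<comment> \<open>The discretized sum may be negative. Adding the error bound makes it a majorant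
    of the nonnegative band, so sum and integral can be exchanged.\<close>
  define T where "T n l = Sdisc (2 ^ n) (k n) l + Z0 * (1 / 8) ^ n" for n l
  have Z0: "0 \<le> Z0" unfolding Z0_def using ab by simp
  define \<nu> where "\<nu> l = distr (\<mu> l) borel (P l)" for l
  have \<nu>fin: "finite_measure (\<nu> l)" "sets (\<nu> l) = sets borel" if "l \<in> ball l0 R" for l
  proof -
    interpret finite_measure "\<mu> l" by (rule meas_fin[OF that])
    show "finite_measure (\<nu> l)" unfolding \<nu>_def by (rule finite_measure_distr[OF proj_measurable[OF that]])
    show "sets (\<nu> l) = sets borel" unfolding \<nu>_def by simp
  qed
  have bandT: "0 \<le> band (\<nu> l) (2 ^ n)" "band (\<nu> l) (2 ^ n) \<le> T n l" if l: "l \<in> ball l0 R" for l n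
  proof -
    show "0 \<le> band (\<nu> l) (2 ^ n)" by (rule nn_integral_char_band(2)[OF \<nu>fin[OF l]]) simp
    have "8 * 2 ^ n * (\<gamma>2 ^ k n * (b - a)) * (measure (\<mu> l) (space (\<mu> l)))\<^sup>2
      \<le> 8 * 2 ^ n * ((1 / 16) ^ Suc n * (b - a)) * (exp c * measure (\<mu> l0) (space (\<mu> l0)))\<^sup>2"
      using ab \<gamma> by (intro mult_mono power_mono total_mass_le l \<gamma>k) auto
    also have "\<dots> = Z0 * (2 ^ n * (1 / 16) ^ Suc n)" unfolding Z0_def by simp
    also have "\<dots> \<le> Z0 * (1 / 8) ^ n"
    proof (rule mult_left_mono[OF _ Z0])
      have "(2 :: real) ^ n * (1 / 16) ^ n = (2 * (1 / 16)) ^ n" by (rule power_mult_distrib[symmetric])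
      then have "(2 :: real) ^ n * (1 / 16) ^ Suc n = (1 / 16) * (1 / 8) ^ n" by simp
      also have "\<dots> \<le> (1 / 8) ^ n" by simp
      finally show "(2 :: real) ^ n * (1 / 16) ^ Suc n \<le> (1 / 8) ^ n" .
    qed
    finally show "band (\<nu> l) (2 ^ n) \<le> T n l"
      using band_discretize[OF l, of "2 ^ n" "k n"] unfolding T_def \<nu>_def by simp
  qed
  have intc: "integrable lborel (cutoff R1)"
  proof (rule norm_integral_le_ball(1)[of _ "ball l0 R1" R1])
    show "cutoff R1 \<in> borel_measurable borel"
      by (intro borel_measurable_continuous_onI continuous_on_cutoff)
  qed (use cutoff_bd[of R1] cutoff_eq_0[of _ R1] R1 in auto)
  define Ic where "Ic = (\<integral>l. cutoff R1 l \<partial>lborel)"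
  have Ic: "0 \<le> Ic" unfolding Ic_def by (intro Bochner_Integration.integral_nonneg cutoff_bd)
  define G where "G n l = 2 powr (q * real n) * (cutoff R1 l * T n l)" for n l
  have ball_sub: "l \<in> ball l0 R1 \<Longrightarrow> l \<in> ball l0 R" for l using R1 by auto
  have G0: "0 \<le> G n l" for n l
  proof (cases "l \<in> ball l0 R1")
    case True
    then have "0 \<le> T n l" using bandT[OF ball_sub[OF True], of n] by linarith
    then show ?thesis unfolding G_def using cutoff_bd(1) by simp
  next
    case False
    then show ?thesis unfolding G_def using cutoff_eq_0 by simp
  qed
  have cT: "cutoff R1 l * T n l = cutoff R1 l * Sdisc (2 ^ n) (k n) l + cutoff R1 l * (Z0 * (1 / 8) ^ n)" for n l
    unfolding T_def by (simp add: algebra_simps)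
  have intG: "integrable lborel (G n)" for n
    unfolding G_def cT using SI(1)[of "2 ^ n" n] \<gamma>k'[of n] intc by (intro integrable_mult_right Bochner_Integration.integrable_add) auto
  define D1 where "D1 = Ctot \<alpha>0 * real K * 2 powr s * En"
  \<comment> \<open>Since q + s - \<alpha> = - s, the main term decays like 2^(- s n) up to the
    factor \<open>Suc n\<close> from the word length; the second term is the discretization
    error.\<close>
  define u where "u n = D1 * (real (Suc n) * (2 powr (- s)) ^ n) + Z0 * Ic * (2 powr q / 8) ^ n" for n
  have Gle: "(\<integral>l. G n l \<partial>lborel) \<le> u n" for n
  proof -
    have 2: "2 powr (q * real n) * (2 powr (- s)) ^ 0 = (2 powr q) ^ n"
      by (simp add: powr_realpow[symmetric] powr_powr)
    have "(\<integral>l. G n l \<partial>lborel) = 2 powr (q * real n) * ((\<integral>l. cutoff R1 l * Sdisc (2 ^ n) (k n) l \<partial>lborel) + Ic * (Z0 * (1 / 8) ^ n))"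
      unfolding G_def cT Ic_def using SI(1)[of "2 ^ n" n] \<gamma>k'[of n] intc by simp
    also have "\<dots> \<le> 2 powr (q * real n) * (Ctot \<alpha>0 * real (k n) * E n ^ 6 * (2 ^ n) powr (- \<alpha>) * En + Ic * (Z0 * (1 / 8) ^ n))"
      using SI(2)[of "2 ^ n" n] \<gamma>k'[of n] Ic Z0 by (intro mult_left_mono add_mono) auto
    also have "\<dots> \<le> 2 powr (q * real n) * (Ctot \<alpha>0 * real (k n) * 2 powr (s * real (Suc n)) * (2 ^ n) powr (- \<alpha>) * En + Ic * (Z0 * (1 / 8) ^ n))"
      using E6[of n] Ctot_nonneg En(2) Ic Z0 by (intro mult_left_mono add_mono mult_right_mono) auto
    also have "\<dots> = Ctot \<alpha>0 * real (k n) * En * (2 powr (q * real n) * 2 powr (s * real (Suc n)) * (2 ^ n) powr (- \<alpha>)) + Z0 * Ic * (2 powr (q * real n) * (1 / 8) ^ n)"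
      by (simp add: algebra_simps)
    also have "2 powr (q * real n) * 2 powr (s * real (Suc n)) * (2 ^ n) powr (- \<alpha>) = 2 powr s * (2 powr (- s)) ^ n"
    proof -
      have e1: "(2 ^ n) powr (- \<alpha>) = (2::real) powr (- \<alpha> * real n)" by (simp add: powr_realpow[symmetric] powr_powr mult.commute)
      have e2: "(2 powr (- s)) ^ n = (2::real) powr (- s * real n)" by (simp add: powr_realpow[symmetric] powr_powr)
      have "2 powr (q * real n) * 2 powr (s * real (Suc n)) * (2 ^ n) powr (- \<alpha>) = 2 powr (q * real n + s * real (Suc n) + (- \<alpha> * real n))"
        unfolding e1 by (simp only: powr_add)
      also have "q * real n + s * real (Suc n) + (- \<alpha> * real n) = s + (- s * real n)"
        unfolding s_def by (simp add: field_simps)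
      finally show ?thesis unfolding e2 by (simp only: powr_add)
    qed
    also have "2 powr (q * real n) * (1 / 8) ^ n = (2 powr q / 8) ^ n"
      by (simp add: powr_realpow[symmetric] powr_powr power_divide)
    finally show ?thesis unfolding u_def D1_def k_def of_nat_mult by (simp only: ac_simps)
  qed
  have u0: "0 \<le> u n" for n using Gle[of n] Bochner_Integration.integral_nonneg[of lborel "G n"] G0 by fastforce
  have sumu: "summable u"
  proof -
    have "2 powr q < (2::real) powr 2" using q \<alpha> \<beta> by (intro powr_less_mono) auto
    then have "2 powr q / 8 < (1::real)" by (simp add: powr_numeral)
    moreover have "(2::real) powr (- s) < 2 powr 0" using s by (intro powr_less_mono) auto
    ultimately show ?thesis unfolding u_def
      by (intro summable_add summable_mult summable_Suc_geometric summable_geometric) auto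
  qed
  have "(\<integral>\<^sup>+ l. (\<Sum>n. ennreal (G n l)) \<partial>lborel) = (\<Sum>n. \<integral>\<^sup>+ l. ennreal (G n l) \<partial>lborel)"
    using intG by (intro nn_integral_suminf) auto
  also have "\<dots> = (\<Sum>n. ennreal (\<integral>l. G n l \<partial>lborel))"
    using intG G0 by (intro suminf_cong nn_integral_eq_integral) auto
  also have "\<dots> \<le> (\<Sum>n. ennreal (u n))"
    using Gle by (intro suminf_le ennreal_leI) auto
  also have "\<dots> = ennreal (\<Sum>n. u n)" by (intro suminf_ennreal2 u0 sumu)
  also have "\<dots> < \<infinity>" by simp
  finally have "AE l in lborel. (\<Sum>n. ennreal (G n l)) \<noteq> \<infinity>"
    using intG by (intro nn_integral_PInf_AE) auto
  then have "AE l in lborel. l \<in> ball l0 R1 \<longrightarrow>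
    (\<integral>\<^sup>+ t. ennreal ((cmod (char (distr (\<mu> l) borel (P l)) t))\<^sup>2 * (1 + \<bar>t\<bar>) powr (q - 1)) \<partial>lborel) < \<infinity>"
  proof eventually_elim
    case (elim l)
    show ?case
    proof
      assume l: "l \<in> ball l0 R1"
      note lR = ball_sub[OF l]
      have "summable (\<lambda>n. G n l)" using elim G0 by (intro summable_suminf_not_top) auto
      then have "summable (\<lambda>n. (1 / cutoff R1 l) * G n l)" by (rule summable_mult)
      \<comment> \<open>Inside the open ball the cutoff is positive, so it can be removed from the
        series.\<close>
      moreover have "cutoff R1 l \<noteq> 0" using l unfolding cutoff_def by (auto simp: dist_norm norm_minus_commute)
      ultimately have "summable (\<lambda>n. 2 powr (q * real n) * T n l)" unfolding G_def by simp
      then have "summable (\<lambda>n. 2 powr (q * real n) * band (\<nu> l) (2 ^ n))"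
        by (rule summable_comparison_test'[where N=0]) (use bandT[OF lR] in \<open>auto simp: abs_mult intro!: mult_left_mono\<close>)
      from sobolev_integral_finite[OF \<nu>fin[OF lR] this]
      show "(\<integral>\<^sup>+ t. ennreal ((cmod (char (distr (\<mu> l) borel (P l)) t))\<^sup>2 * (1 + \<bar>t\<bar>) powr (q - 1)) \<partial>lborel) < \<infinity>"
        unfolding \<nu>_def .
    qed
  qed
  then show ?thesis using R1(1) by blast
qed

end

text \<open>Each band is bounded by the total mass of the product measure, so the weighted series is
  dominated by a geometric one for every negative exponent. The covering argument may then restrict
  itself to positive exponents.\<close>

lemma sobolev_dim_nonneg:
  assumes "finite_measure \<nu>" "sets \<nu> = sets borel"
  shows "0 \<le> sobolev_dim \<nu>"
proof (rule ccontr)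
  assume "\<not> 0 \<le> sobolev_dim \<nu>"
  then obtain z where z: "sobolev_dim \<nu> < ereal z" "ereal z < 0" using ereal_dense2[of "sobolev_dim \<nu>" 0] by (auto simp: not_le)
  interpret finite_measure \<nu> by fact
  interpret PF: finite_measure "\<nu> \<Otimes>\<^sub>M \<nu>" by (rule finite_measure_pair_measure) (rule assms(1))+
  have bd: "\<bar>band \<nu> N\<bar> \<le> measure (\<nu> \<Otimes>\<^sub>M \<nu>) (space (\<nu> \<Otimes>\<^sub>M \<nu>))" for N
  proof -
    note [measurable_cong] = assms(2)
    have "norm (band \<nu> N) \<le> (\<integral>p. norm (wavelet (N * (fst p - snd p))) \<partial>(\<nu> \<Otimes>\<^sub>M \<nu>))"
      unfolding band_def by (rule integral_norm_bound)
    also have "\<dots> \<le> (\<integral>p. 1 \<partial>(\<nu> \<Otimes>\<^sub>M \<nu>))"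
      by (intro integral_mono PF.integrable_const_bound[where B=1]) (auto simp: abs_wavelet_le_1)
    finally show ?thesis by simp
  qed
  have "summable (\<lambda>n. (2 powr z) ^ n * measure (\<nu> \<Otimes>\<^sub>M \<nu>) (space (\<nu> \<Otimes>\<^sub>M \<nu>)))"
    using z powr_less_mono[of z 0 2] by (intro summable_mult2 summable_geometric) auto
  then have "summable (\<lambda>n. 2 powr (z * real n) * band \<nu> (2 ^ n))"
  proof (rule summable_comparison_test'[where N=0])
    fix n
    show "norm (2 powr (z * real n) * band \<nu> (2 ^ n)) \<le> (2 powr z) ^ n * measure (\<nu> \<Otimes>\<^sub>M \<nu>) (space (\<nu> \<Otimes>\<^sub>M \<nu>))"
      using bd[of "2 ^ n"] by (simp add: abs_mult powr_realpow[symmetric] powr_powr mult_left_mono)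
  qed
  from sobolev_integral_finite[OF assms this]
  have "ereal z \<le> sobolev_dim \<nu>" unfolding sobolev_dim_def by (intro Sup_upper) auto
  then show False using z by simp
qed

text \<open>Applied to the difference of one map at two parameters, it turns a bound on mixed
  increments into a bound on the change of the x-derivative, without exchanging the order of
  differentiation.\<close>

lemma deriv_le_lipschitz:
  fixes \<phi> :: "real \<Rightarrow> real"
  assumes d: "(\<phi> has_real_derivative D) (at x within {a..b})" and x: "x \<in> {a..b}" and ab: "a < b"
    and lip: "\<And>y. y \<in> {a..b} \<Longrightarrow> \<bar>\<phi> y - \<phi> x\<bar> \<le> K * \<bar>y - x\<bar>"
  shows "\<bar>D\<bar> \<le> K"
proof (rule tendsto_upperbound)
  have "((\<lambda>y. (\<phi> y - \<phi> x) / (y - x)) \<longlongrightarrow> D) (at x within {a..b})"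
    using d by (simp add: has_field_derivative_iff)
  then show "((\<lambda>y. \<bar>(\<phi> y - \<phi> x) / (y - x)\<bar>) \<longlongrightarrow> \<bar>D\<bar>) (at x within {a..b})"
    by (rule tendsto_rabs)
  show "\<forall>\<^sub>F y in at x within {a..b}. \<bar>(\<phi> y - \<phi> x) / (y - x)\<bar> \<le> K"
    unfolding eventually_at_filter
    using lip by (intro always_eventually) (auto simp: abs_divide divide_le_eq)
  show "at x within {a..b} \<noteq> bot"
    using x ab by (simp add: trivial_limit_within islimpt_Icc)
qed

section \<open>Local hypotheses and the covering argument\<close>

theorem mainTheorem4:
  fixes a b :: real and m :: nat and U :: "'a::euclidean_space set"
    and f f1 f2 :: "nat \<Rightarrow> 'a \<Rightarrow> real \<Rightarrow> real"
    and fl flx :: "nat \<Rightarrow> 'a \<Rightarrow> real \<Rightarrow> 'a"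
    and \<mu> :: "'a \<Rightarrow> (nat \<Rightarrow> nat) measure"
    and \<delta> c \<theta> \<eta> :: real
  assumes X: "a < b"
    and m: "m \<ge> 2"
    and U: "open U" "bounded U"
    and \<delta>: "0 < \<delta>" "\<delta> < 1"
    and maps: "\<And>j l x. j \<in> {1..m} \<Longrightarrow> l \<in> closure U \<Longrightarrow> x \<in> {a..b} \<Longrightarrow> f j l x \<in> {a..b}"
    and MA1_d1: "\<And>j l x. j \<in> {1..m} \<Longrightarrow> l \<in> closure U \<Longrightarrow> x \<in> {a..b} \<Longrightarrow>
                   (f j l has_real_derivative f1 j l x) (at x within {a..b})"
    and MA1_d2: "\<And>j l x. j \<in> {1..m} \<Longrightarrow> l \<in> closure U \<Longrightarrow> x \<in> {a..b} \<Longrightarrow>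
                   (f1 j l has_real_derivative f2 j l x) (at x within {a..b})"
    and MA1_holder: "\<exists>C. \<forall>j\<in>{1..m}. \<forall>l\<in>closure U. \<forall>l'\<in>closure U. \<forall>x\<in>{a..b}. \<forall>y\<in>{a..b}.
                   \<bar>f2 j l x\<bar> \<le> C \<and> \<bar>f2 j l x - f2 j l y\<bar> \<le> C * \<bar>x - y\<bar> powr \<delta>
                   \<and> \<bar>f2 j l x - f2 j l' x\<bar> \<le> C * norm (l - l') powr \<delta>"
    and MA2_d: "\<And>j l x. j \<in> {1..m} \<Longrightarrow> l \<in> U \<Longrightarrow> x \<in> {a..b} \<Longrightarrow>
                   ((\<lambda>l'. f j l' x) has_derivative (\<lambda>h. fl j l x \<bullet> h)) (at l)"
    and MA2_holder: "\<exists>C. \<forall>j\<in>{1..m}. \<forall>l\<in>U. \<forall>l'\<in>U. \<forall>x\<in>{a..b}.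
                   norm (fl j l x - fl j l' x) \<le> C * norm (l - l') powr \<delta>"
    and MA3_d: "\<And>j l x. j \<in> {1..m} \<Longrightarrow> l \<in> U \<Longrightarrow> x \<in> {a..b} \<Longrightarrow>
                   ((\<lambda>y. fl j l y) has_vector_derivative flx j l x) (at x within {a..b})"
    and MA3_cont: "\<And>j. j \<in> {1..m} \<Longrightarrow> continuous_on (U \<times> {a..b}) (\<lambda>(l, x). flx j l x)"
    and MA3_holder: "\<exists>C. \<forall>j\<in>{1..m}. \<forall>l\<in>U. \<forall>l'\<in>U. \<forall>x\<in>{a..b}. \<forall>y\<in>{a..b}.
                   norm (flx j l x) \<le> C \<and> norm (flx j l x - flx j l y) \<le> C * \<bar>x - y\<bar> powr \<delta>
                   \<and> norm (flx j l x - flx j l' x) \<le> C * norm (l - l') powr \<delta>"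
    and MA4: "\<exists>\<gamma>1 \<gamma>2. 0 < \<gamma>1 \<and> \<gamma>2 < 1 \<and> (\<forall>j\<in>{1..m}. \<forall>l\<in>closure U. \<forall>x\<in>{a..b}.
                   \<gamma>1 \<le> \<bar>f1 j l x\<bar> \<and> \<bar>f1 j l x\<bar> \<le> \<gamma>2)"
    and MT_pos: "\<eta> > 0"
    and MT: "\<And>l i j. l \<in> closure U \<Longrightarrow> i \<in> space (seqspace m) \<Longrightarrow> j \<in> space (seqspace m) \<Longrightarrow>
                   i 0 \<noteq> j 0 \<Longrightarrow> \<bar>proj f {a..b} l i - proj f {a..b} l j\<bar> < \<eta> \<Longrightarrow>
                   (\<exists>g. ((\<lambda>l'. proj f {a..b} l' i - proj f {a..b} l' j) has_derivative (\<lambda>h. g \<bullet> h))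
                          (at l within U) \<and> \<eta> \<le> norm g)"
    and meas_fin: "\<And>l. l \<in> closure U \<Longrightarrow> finite_measure (\<mu> l)"
    and meas_sets: "\<And>l. l \<in> closure U \<Longrightarrow> sets (\<mu> l) = sets (seqspace m)"
    and c: "c > 0"
    and \<theta>: "0 < \<theta>" "\<theta> \<le> 1"
    and M: "\<And>l l' w. l \<in> closure U \<Longrightarrow> l' \<in> closure U \<Longrightarrow> set w \<subseteq> {1..m} \<Longrightarrow> length w \<ge> 1 \<Longrightarrow>
              exp (- c * norm (l - l') powr \<theta> * real (length w)) * measure (\<mu> l') (cyl m w) \<le> measure (\<mu> l) (cyl m w)
            \<and> measure (\<mu> l) (cyl m w) \<le> exp (c * norm (l - l') powr \<theta> * real (length w)) * measure (\<mu> l') (cyl m w)"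
  shows "AE l in lborel. l \<in> U \<longrightarrow>
           min (corr_dim (\<mu> l) (symb_dist f {a..b} l)) (ereal (1 + min \<delta> \<theta>))
             \<le> sobolev_dim (distr (\<mu> l) borel (proj f {a..b} l))"
proof -
  define \<beta> where "\<beta> = min \<delta> \<theta>"
  have \<beta>: "0 < \<beta>" "\<beta> \<le> 1" "\<beta> \<le> \<delta>" "\<beta> \<le> \<theta>" using \<delta> \<theta> by (auto simp: \<beta>_def)
  obtain Cx where Cx: "\<And>j l x. j \<in> {1..m} \<Longrightarrow> l \<in> closure U \<Longrightarrow> x \<in> {a..b} \<Longrightarrow> \<bar>f2 j l x\<bar> \<le> Cx"
    using MA1_holder by blast
  obtain Ch where Ch: "\<And>j l l' x. j \<in> {1..m} \<Longrightarrow> l \<in> U \<Longrightarrow> l' \<in> U \<Longrightarrow> x \<in> {a..b} \<Longrightarrow> norm (fl j l x - fl j l' x) \<le> Ch * norm (l - l') powr \<delta>"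
    using MA2_holder by blast
  obtain Cm where Cm: "\<And>j l x. j \<in> {1..m} \<Longrightarrow> l \<in> U \<Longrightarrow> x \<in> {a..b} \<Longrightarrow> norm (flx j l x) \<le> Cm"
    using MA3_holder by blast
  obtain \<gamma>1 \<gamma>2' where \<gamma>': "0 < \<gamma>1" "\<gamma>2' < 1" "\<And>j l x. j \<in> {1..m} \<Longrightarrow> l \<in> closure U \<Longrightarrow> x \<in> {a..b} \<Longrightarrow> \<gamma>1 \<le> \<bar>f1 j l x\<bar> \<and> \<bar>f1 j l x\<bar> \<le> \<gamma>2'"
    using MA4 by blast
  \<comment> \<open>The maximum with 1/2 secures positivity even when (MA4) is vacuous because U is
    empty.\<close>
  define \<gamma>2 where "\<gamma>2 = max \<gamma>2' (1 / 2)"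
  have \<gamma>: "0 < \<gamma>1" "0 < \<gamma>2" "\<gamma>2 < 1" "\<And>j l x. j \<in> {1..m} \<Longrightarrow> l \<in> closure U \<Longrightarrow> x \<in> {a..b} \<Longrightarrow> \<gamma>1 \<le> \<bar>f1 j l x\<bar> \<and> \<bar>f1 j l x\<bar> \<le> \<gamma>2"
    using \<gamma>' unfolding \<gamma>2_def by (auto simp: le_max_iff_disj)
  have UcU: "l \<in> U \<Longrightarrow> l \<in> closure U" for l using closure_subset by blast
  have local: "\<exists>r>0. \<exists>C. measured_ifs a b m l0 r f f1 fl C \<gamma>1 \<gamma>2 \<beta> \<eta> \<mu> c \<theta>" if l0: "l0 \<in> U" for l0
  proof -
    obtain r0 where r0: "0 < r0" "ball l0 r0 \<subseteq> U" using U(1) l0 openE by blast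
    \<comment> \<open>Radius at most 1/2 gives the ball diameter at most 1.\<close>
    define R where "R = min r0 (1 / 2)"
    have R: "0 < R" "R \<le> 1 / 2" "ball l0 R \<subseteq> U" using r0 by (auto simp: R_def)
    have inU: "l \<in> U" "l \<in> closure U" if "l \<in> ball l0 R" for l using that R UcU by auto
    have dist1: "norm (l' - l) \<le> 1" if "l \<in> ball l0 R" "l' \<in> ball l0 R" for l l'
    proof -
      have "dist l' l < R + R" using that by (intro dist_triangle_less_add[of _ l0]) (auto simp: dist_commute)
      then show ?thesis using R by (simp add: dist_norm)
    qed
    \<comment> \<open>The parameter gradient is bounded by starting from its finitely many values at
      (l0, a), moving in x with the bound on the mixed derivative and in the parameter with the
      Hoelder bound. The resulting constant depends on l0.\<close>
    define S where "S = (\<Sum>j\<in>{1..m}. norm (fl j l0 a))"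
    define C where "C = \<bar>Cx\<bar> + \<bar>Ch\<bar> + \<bar>Cm\<bar> + (S + \<bar>Cm\<bar> * (b - a))"
    have S: "0 \<le> S" unfolding S_def by (intro sum_nonneg) simp
    have Cge: "\<bar>Cx\<bar> \<le> C" "\<bar>Ch\<bar> \<le> C" "\<bar>Cm\<bar> \<le> C" "\<bar>Ch\<bar> + S + \<bar>Cm\<bar> * (b - a) \<le> C" "0 \<le> C"
      unfolding C_def using S X by auto
    have fl_lip: "norm (fl j l x - fl j l y) \<le> \<bar>Cm\<bar> * \<bar>x - y\<bar>"
      if "j \<in> {1..m}" "l \<in> U" "x \<in> {a..b}" "y \<in> {a..b}" for j l x y
    proof -
      have "norm (fl j l x - fl j l y) \<le> \<bar>Cm\<bar> * norm (x - y)"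
      proof (rule differentiable_bound[of "{a..b}" _ "\<lambda>x h. h *\<^sub>R flx j l x"])
        fix z assume z: "z \<in> {a..b}"
        show "((\<lambda>y. fl j l y) has_derivative (\<lambda>h. h *\<^sub>R flx j l z)) (at z within {a..b})"
          using MA3_d[OF that(1,2) z] by (simp add: has_vector_derivative_def)
        show "onorm (\<lambda>h. h *\<^sub>R flx j l z) \<le> \<bar>Cm\<bar>"
        proof (rule onorm_le)
          fix h :: real
          have "norm (flx j l z) \<le> \<bar>Cm\<bar>" using Cm[OF that(1,2) z] by linarith
          then have "norm h * norm (flx j l z) \<le> norm h * \<bar>Cm\<bar>" by (intro mult_left_mono) auto
          then show "norm (h *\<^sub>R flx j l z) \<le> \<bar>Cm\<bar> * norm h" by (simp add: mult.commute)
        qed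
      qed (use that in auto)
      then show ?thesis by simp
    qed
    have ifs: "param_ifs a b m (ball l0 R) f f1 fl C \<gamma>1 \<gamma>2 \<beta>"
    proof
      show "a < b" "0 \<le> C" "0 < \<gamma>1" "0 < \<gamma>2" "\<gamma>2 < 1" "0 < \<beta>" "\<beta> \<le> 1" using X Cge \<gamma> \<beta> by auto
      show "norm (l' - l) \<le> 1" if "l \<in> ball l0 R" "l' \<in> ball l0 R" for l l' using dist1 that .
      fix j l x assume j: "j \<in> {1..m}" and l: "l \<in> ball l0 R" and x: "x \<in> {a..b}"
      show "f j l x \<in> {a..b}" by (rule maps[OF j inU(2)[OF l] x])
      show "(f j l has_real_derivative f1 j l x) (at x within {a..b})" by (rule MA1_d1[OF j inU(2)[OF l] x])
      show "\<gamma>1 \<le> \<bar>f1 j l x\<bar> \<and> \<bar>f1 j l x\<bar> \<le> \<gamma>2" by (rule \<gamma>(4)[OF j inU(2)[OF l] x])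
      show "norm (fl j l x) \<le> C"
      proof -
        have "norm (fl j l x) \<le> norm (fl j l x - fl j l0 x) + norm (fl j l0 x - fl j l0 a) + norm (fl j l0 a)"
          using norm_triangle_ineq[of "fl j l x - fl j l0 x" "fl j l0 x - fl j l0 a"]
            norm_triangle_ineq[of "fl j l x - fl j l0 a" "fl j l0 a"] by simp
        also have "\<dots> \<le> \<bar>Ch\<bar> * 1 + \<bar>Cm\<bar> * (b - a) + S"
        proof (intro add_mono)
          have "norm (l - l0) powr \<delta> \<le> 1" using dist1[OF _ l, of l0] R \<delta> by (intro powr_le1) auto
          then have "Ch * norm (l - l0) powr \<delta> \<le> \<bar>Ch\<bar> * 1" by (intro mult_mono) auto
          then show "norm (fl j l x - fl j l0 x) \<le> \<bar>Ch\<bar> * 1" using Ch[OF j inU(1)[OF l] l0 x] by linarith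
          have "\<bar>Cm\<bar> * \<bar>x - a\<bar> \<le> \<bar>Cm\<bar> * (b - a)" using x by (intro mult_left_mono) auto
          then show "norm (fl j l0 x - fl j l0 a) \<le> \<bar>Cm\<bar> * (b - a)" using fl_lip[OF j l0 x, of a] X by auto
          show "norm (fl j l0 a) \<le> S" unfolding S_def by (rule member_le_sum[OF j]) auto
        qed
        finally show ?thesis using Cge by linarith
      qed
      show "\<bar>f1 j l x - f1 j l y\<bar> \<le> C * \<bar>x - y\<bar>" if y: "y \<in> {a..b}" for y
      proof -
        have "norm (f1 j l x - f1 j l y) \<le> C * norm (x - y)"
        proof (rule field_differentiable_bound[of "{a..b}" _ "f2 j l"])
          fix z assume z: "z \<in> {a..b}"
          show "(f1 j l has_real_derivative f2 j l z) (at z within {a..b})" by (rule MA1_d2[OF j inU(2)[OF l] z])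
          show "norm (f2 j l z) \<le> C" using Cx[OF j inU(2)[OF l] z] Cge by simp
        qed (use x y in auto)
        then show ?thesis by simp
      qed
      fix l' assume l': "l' \<in> ball l0 R"
      show "\<bar>f1 j l' x - f1 j l x\<bar> \<le> C * norm (l' - l)"
      proof (rule deriv_le_lipschitz[OF _ x X])
        show "((\<lambda>y. f j l' y - f j l y) has_real_derivative f1 j l' x - f1 j l x) (at x within {a..b})"
          by (intro DERIV_diff MA1_d1 j inU l l' x)
        fix y assume y: "y \<in> {a..b}"
        \<comment> \<open>The increment in x is differentiated in the parameter; its gradient is an
          increment of \<open>fl\<close> in x, which the mixed derivative bounds by a multiple of |y
          - x|.\<close>
        have "norm ((f j l' y - f j l' x) - (f j l y - f j l x)) \<le> (C * \<bar>y - x\<bar>) * norm (l' - l)"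
        proof (rule differentiable_bound[of "ball l0 R" _ "\<lambda>q h. (fl j q y - fl j q x) \<bullet> h"])
          fix q assume q: "q \<in> ball l0 R"
          have "((\<lambda>q. f j q y - f j q x) has_derivative (\<lambda>h. fl j q y \<bullet> h - fl j q x \<bullet> h)) (at q)"
            by (intro has_derivative_diff MA2_d j inU(1)[OF q] x y)
          then show "((\<lambda>q. f j q y - f j q x) has_derivative (\<lambda>h. (fl j q y - fl j q x) \<bullet> h)) (at q within ball l0 R)"
            by (simp add: inner_diff_left has_derivative_at_withinI)
          show "onorm (\<lambda>h. (fl j q y - fl j q x) \<bullet> h) \<le> C * \<bar>y - x\<bar>"
          proof (rule onorm_le)
            fix h :: 'a
            have "\<bar>Cm\<bar> * \<bar>y - x\<bar> \<le> C * \<bar>y - x\<bar>" using Cge by (intro mult_right_mono) auto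
            then have "norm (fl j q y - fl j q x) \<le> C * \<bar>y - x\<bar>" using fl_lip[OF j inU(1)[OF q] y x] by linarith
            then have "norm (fl j q y - fl j q x) * norm h \<le> C * \<bar>y - x\<bar> * norm h" by (intro mult_right_mono) auto
            then show "norm ((fl j q y - fl j q x) \<bullet> h) \<le> C * \<bar>y - x\<bar> * norm h"
              using Cauchy_Schwarz_ineq2[of "fl j q y - fl j q x" h] by simp
          qed
        qed (use l l' in auto)
        then show "\<bar>(f j l' y - f j l y) - (f j l' x - f j l x)\<bar> \<le> C * norm (l' - l) * \<bar>y - x\<bar>"
          by (simp add: algebra_simps)
      qed
      show "\<bar>f j l' x - f j l x - fl j l x \<bullet> (l' - l)\<bar> \<le> C * norm (l' - l) powr (1 + \<beta>)"
      proof -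
        let ?n = "norm (l' - l)"
        have seg: "closed_segment l l' \<subseteq> ball l0 R" using closed_segment_subset[OF l l' convex_ball] .
        \<comment> \<open>The mean value inequality on the segment, applied after subtraction of the
          linear part at l: the gradient of what remains is controlled by the Hoelder bound on
          \<open>fl\<close>.\<close>
        have "norm ((f j l' x - fl j l x \<bullet> l') - (f j l x - fl j l x \<bullet> l)) \<le> (C * ?n powr \<delta>) * ?n"
        proof (rule differentiable_bound[of "closed_segment l l'" _ "\<lambda>q h. (fl j q x - fl j l x) \<bullet> h"])
          fix q assume q: "q \<in> closed_segment l l'"
          then have qU: "q \<in> U" using seg inU by blast
          have "((\<lambda>q. f j q x - fl j l x \<bullet> q) has_derivative (\<lambda>h. fl j q x \<bullet> h - fl j l x \<bullet> h)) (at q)"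
            by (intro has_derivative_diff MA2_d j qU x bounded_linear_imp_has_derivative bounded_linear_inner_right)
          then show "((\<lambda>q. f j q x - fl j l x \<bullet> q) has_derivative (\<lambda>h. (fl j q x - fl j l x) \<bullet> h)) (at q within closed_segment l l')"
            by (simp add: inner_diff_left has_derivative_at_withinI)
          show "onorm (\<lambda>h. (fl j q x - fl j l x) \<bullet> h) \<le> C * ?n powr \<delta>"
          proof (rule onorm_le)
            fix h :: 'a
            have "norm (q - l) powr \<delta> \<le> ?n powr \<delta>"
              using segment_bound(1)[OF q] \<delta> by (intro powr_mono2) auto
            then have "Ch * norm (q - l) powr \<delta> \<le> C * ?n powr \<delta>" using Cge by (intro mult_mono) auto
            then have "norm (fl j q x - fl j l x) \<le> C * ?n powr \<delta>"
              using Ch[OF j qU inU(1)[OF l] x] by linarith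
            then have "norm (fl j q x - fl j l x) * norm h \<le> C * ?n powr \<delta> * norm h" by (intro mult_right_mono) auto
            then show "norm ((fl j q x - fl j l x) \<bullet> h) \<le> C * ?n powr \<delta> * norm h"
              using Cauchy_Schwarz_ineq2[of "fl j q x - fl j l x" h] by simp
          qed
        qed auto
        moreover have "(C * ?n powr \<delta>) * ?n \<le> C * ?n powr (1 + \<beta>)"
        proof -
          have "?n powr \<delta> * ?n = ?n powr (1 + \<delta>)" by (simp add: powr_add mult.commute)
          also have "\<dots> \<le> ?n powr (1 + \<beta>)" using dist1[OF l l'] \<beta> by (intro powr_mono') auto
          finally show ?thesis using Cge(5) by (simp add: mult.assoc mult_left_mono)
        qed
        ultimately show ?thesis by (simp add: inner_diff_right algebra_simps)
      qed
    qed
    have "measured_ifs a b m l0 R f f1 fl C \<gamma>1 \<gamma>2 \<beta> \<eta> \<mu> c \<theta>"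
    proof (intro measured_ifs.intro transversal_ifs.intro transversal_ifs_axioms.intro measured_ifs_axioms.intro ifs)
      show "0 < R" "0 < \<eta>" "1 \<le> m" "0 \<le> c" "\<beta> \<le> \<theta>" "\<theta> \<le> 1" using R MT_pos m c \<beta> \<theta> by auto
      fix i j :: "nat \<Rightarrow> nat"
      assume "\<forall>n. i n \<in> {1..m}" "\<forall>n. j n \<in> {1..m}" "i 0 \<noteq> j 0" "\<bar>proj f {a..b} l0 i - proj f {a..b} l0 j\<bar> < \<eta>"
      then show "\<exists>g. ((\<lambda>l'. proj f {a..b} l' i - proj f {a..b} l' j) has_derivative (\<lambda>h. g \<bullet> h)) (at l0) \<and> \<eta> \<le> norm g"
        \<comment> \<open>Openness of U turns the derivative within U into a derivative at
          l0.\<close>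
        using MT[OF UcU[OF l0], of i j] by (simp add: in_seqspace_iff at_within_open[OF l0 U(1)])
    next
      fix l assume "l \<in> ball l0 R"
      then show "finite_measure (\<mu> l)" "sets (\<mu> l) = sets (seqspace m)" using meas_fin meas_sets inU by auto
      fix l' w assume "l' \<in> ball l0 R" "set w \<subseteq> {1..m}" "1 \<le> length w"
      then show "measure (\<mu> l) (cyl m w) \<le> exp (c * norm (l - l') powr \<theta> * real (length w)) * measure (\<mu> l') (cyl m w)"
        using M[of l l' w] inU \<open>l \<in> ball l0 R\<close> by blast
    qed
    then show ?thesis using R(1) by blast
  qed
  let ?sob = "\<lambda>l. sobolev_dim (distr (\<mu> l) borel (proj f {a..b} l))"
  let ?dim = "\<lambda>l. min (corr_dim (\<mu> l) (symb_dist f {a..b} l)) (ereal (1 + min \<delta> \<theta>))"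
  have ball_AE: "\<exists>r>0. AE l in lborel. l \<in> ball l0 r \<longrightarrow> ereal q \<le> ?sob l"
    if l0: "l0 \<in> U" and q: "0 < q" "ereal q < ?dim l0" for l0 q
  proof -
    obtain R C where "measured_ifs a b m l0 R f f1 fl C \<gamma>1 \<gamma>2 \<beta> \<eta> \<mu> c \<theta>" using local[OF l0] by blast
    then interpret measured_ifs a b m l0 R f f1 fl C \<gamma>1 \<gamma>2 \<beta> \<eta> \<mu> c \<theta> .
    have "ereal q < corr_dim (\<mu> l0) (symb_dist f {a..b} l0)" "q < 1 + \<beta>" using q(2) by (auto simp: \<beta>_def)
    \<comment> \<open>The element 0 inserted in the supremum is ruled out by q > 0, so an exponent
      of finite energy above q exists.\<close>
    then obtain \<alpha>0 where \<alpha>0: "q < \<alpha>0" "(\<integral>\<^sup>+ i. (\<integral>\<^sup>+ j. energy_kernel \<alpha>0 i j \<partial>\<mu> l0) \<partial>\<mu> l0) < \<infinity>"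
      unfolding corr_dim_def energy_kernel_def less_Sup_iff using q(1) by (auto simp: zero_ereal_def)
    have "\<exists>r>0. AE l in lborel. l \<in> ball l0 r \<longrightarrow>
      (\<integral>\<^sup>+ t. ennreal ((cmod (char (distr (\<mu> l) borel (P l)) t))\<^sup>2 * (1 + \<bar>t\<bar>) powr (q - 1)) \<partial>lborel) < \<infinity>"
      by (rule local_sobolev[of q "min \<alpha>0 (1 + \<beta>)" \<alpha>0]) (use q(1) \<alpha>0 \<open>q < 1 + \<beta>\<close> in auto)
    then obtain r where r: "0 < r" "AE l in lborel. l \<in> ball l0 r \<longrightarrow>
      (\<integral>\<^sup>+ t. ennreal ((cmod (char (distr (\<mu> l) borel (P l)) t))\<^sup>2 * (1 + \<bar>t\<bar>) powr (q - 1)) \<partial>lborel) < \<infinity>"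
      by blast
    have "AE l in lborel. l \<in> ball l0 r \<longrightarrow> ereal q \<le> ?sob l"
      using r(2)
    proof eventually_elim
      case (elim l)
      then show ?case unfolding sobolev_dim_def by (intro impI Sup_upper) auto
    qed
    then show ?thesis using r(1) by blast
  qed
  have rat_AE: "AE l in lborel. l \<in> U \<and> 0 < q \<and> ereal q < ?dim l \<longrightarrow> ereal q \<le> ?sob l" for q
  proof (cases "0 < q")
    case True
    \<comment> \<open>No measurability of this set is known; a countable subfamily of the balls
      around its points covers it, which is enough for an almost-everywhere statement.\<close>
    define A where "A = {l \<in> U. ereal q < ?dim l}"
    define r where "r l0 = (SOME r. 0 < r \<and> (AE l in lborel. l \<in> ball l0 r \<longrightarrow> ereal q \<le> ?sob l))" for l0
    have r: "0 < r l0 \<and> (AE l in lborel. l \<in> ball l0 (r l0) \<longrightarrow> ereal q \<le> ?sob l)" if "l0 \<in> A" for l0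
      unfolding r_def by (rule someI_ex) (use ball_AE[of l0 q] that True in \<open>auto simp: A_def\<close>)
    obtain F' where F': "F' \<subseteq> (\<lambda>l. ball l (r l)) ` A" "countable F'" "\<Union>F' = \<Union>((\<lambda>l. ball l (r l)) ` A)"
      by (rule Lindelof[of "(\<lambda>l. ball l (r l)) ` A"]) auto
    have "AE l in lborel. \<forall>B\<in>F'. l \<in> B \<longrightarrow> ereal q \<le> ?sob l"
    proof (rule AE_ball_countable[THEN iffD2, OF F'(2)], rule ballI)
      fix B assume "B \<in> F'"
      then show "AE l in lborel. l \<in> B \<longrightarrow> ereal q \<le> ?sob l" using F'(1) r by auto
    qed
    then show ?thesis
    proof eventually_elim
      case (elim l)
      show ?case
      proof
        assume "l \<in> U \<and> 0 < q \<and> ereal q < ?dim l"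
        then have "l \<in> A" by (simp add: A_def)
        then have "l \<in> \<Union>((\<lambda>l. ball l (r l)) ` A)" using r[of l] by (auto intro!: bexI[of _ l])
        then have "l \<in> \<Union>F'" using F'(3) by simp
        then show "ereal q \<le> ?sob l" using elim by blast
      qed
    qed
  qed simp
  have "AE l in lborel. \<forall>q::rat. l \<in> U \<and> 0 < real_of_rat q \<and> ereal (real_of_rat q) < ?dim l \<longrightarrow> ereal (real_of_rat q) \<le> ?sob l"
    unfolding AE_all_countable using rat_AE by blast
  then show ?thesis
  proof eventually_elim
    case (elim l)
    show ?case
    proof
      assume l: "l \<in> U"
      show "?dim l \<le> ?sob l"
      proof (rule ccontr)
        assume "\<not> ?dim l \<le> ?sob l"
        then have "?sob l < ?dim l" by (simp only: not_le)
        from ereal_dense3[OF this] obtain q where q: "?sob l < ereal (real_of_rat q)" "ereal (real_of_rat q) < ?dim l"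
          by blast
        obtain R C where R: "0 < R" and mi: "measured_ifs a b m l R f f1 fl C \<gamma>1 \<gamma>2 \<beta> \<eta> \<mu> c \<theta>" using local[OF l] by blast
        interpret measured_ifs a b m l R f f1 fl C \<gamma>1 \<gamma>2 \<beta> \<eta> \<mu> c \<theta> by (rule mi)
        interpret finite_measure "\<mu> l" by (rule meas_fin[OF l0_in])
        have "finite_measure (distr (\<mu> l) borel (proj f {a..b} l))"
          by (rule finite_measure_distr[OF proj_measurable[OF l0_in]])
        \<comment> \<open>The separating rational q lies above a nonnegative number, hence is
          positive, as the almost-everywhere statement requires.\<close>
        then have "0 \<le> ?sob l" by (rule sobolev_dim_nonneg) simp
        then have "0 < ereal (real_of_rat q)" using q(1) by (rule le_less_trans)
        then have "0 < real_of_rat q" by simp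
        then have "ereal (real_of_rat q) \<le> ?sob l" using elim l q(2) by blast
        then show False using q(1) by simp
      qed
    qed
  qed
qed

end
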